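(* There is an absolute constant $K>0$ such that the following holds. Let $n\ge1$, $\epsilon\ge0$, and let $f\colon S_n\to\mathbb{R}$ be linear with $\Pr[f\notin\{0,1\}]\le\epsilon$ and $\Pr[f=1]\le1/2$. Then there is a set $\mathcal{C}\subseteq[n]^2$ of cosets with $|\mathcal{C}|\le Kn$ and at most $K\epsilon n^2$ unordered pairs of non-disjoint cosets in $\mathcal{C}$, such that $g=\sum_{(i,j)\in\mathcal{C}}x_{i,j}$ satisfies $\Pr[f\neq g]\le K\epsilon$. Conversely, for every $A>0$ there is $B>0$ such that for all $n\ge1$, $\epsilon\ge0$ and every $\mathcal{C}\subseteq[n]^2$ with $|\mathcal{C}|\le An$ and at most $A\epsilon n^2$ unordered pairs of non-disjoint cosets, $g=\sum_{(i,j)\in\mathcal{C}}x_{i,j}$ satisfies $\Pr[g\notin\{0,1\}]\le B\epsilon$.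
   Context: $S_n$ is the symmetric group on $[n]$; probabilities are over a uniformly random $\pi\in S_n$. $x_{i,j}(\pi)=1$ if $\pi(i)=j$ and $0$ otherwise. A function $S_n\to\mathbb{R}$ is linear if it equals $\sum_{i,j}c_{i,j}x_{i,j}$ for some reals $c_{i,j}$. The coset $(i,j)$ is $\{\pi:\pi(i)=j\}$; two distinct cosets $(i,j),(k,\ell)$ are non-disjoint iff $i\neq k$ and $j\neq\ell$. *)

theory Defs
  imports "HOL-Probability.Probability" "HOL-Combinatorics.Permutations"
begin

text \<open>
  $S_n$ consists of the bijections of \<open>{1..n}\<close>, encoded as functions on \<open>nat\<close> that are the identity
  outside \<open>{1..n}\<close>. A function $S_n \to \mathbb{R}$ is a HOL function on all of \<open>nat \<Rightarrow> nat\<close>; its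
  values outside \<open>sym_group n\<close> never matter below.
\<close>

definition sym_group :: "nat \<Rightarrow> (nat \<Rightarrow> nat) set" where
  "sym_group n = {\<pi>. \<pi> permutes {1..n}}"

definition perm_prob :: "nat \<Rightarrow> ((nat \<Rightarrow> nat) \<Rightarrow> bool) \<Rightarrow> real" where
  "perm_prob n P = measure_pmf.prob (pmf_of_set (sym_group n)) {\<pi>. P \<pi>}"

definition entry :: "nat \<Rightarrow> nat \<Rightarrow> (nat \<Rightarrow> nat) \<Rightarrow> real" where
  "entry i j \<pi> = (if \<pi> i = j then 1 else 0)"

definition linear_on_perms :: "nat \<Rightarrow> ((nat \<Rightarrow> nat) \<Rightarrow> real) \<Rightarrow> bool" where
  "linear_on_perms n f \<longleftrightarrow>
     (\<exists>c :: nat \<Rightarrow> nat \<Rightarrow> real. \<forall>\<pi> \<in> sym_group n. f \<pi> = (\<Sum>i\<in>{1..n}. \<Sum>j\<in>{1..n}. c i j * entry i j \<pi>))"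

definition perm_coset :: "nat \<Rightarrow> nat \<times> nat \<Rightarrow> (nat \<Rightarrow> nat) set" where
  "perm_coset n p = {\<pi> \<in> sym_group n. \<pi> (fst p) = snd p}"

text \<open>
  Families of cosets are sets of index pairs, and distinctness is distinctness of the index pairs:
  for $n = 2$ the pairs \<open>(1,1)\<close> and \<open>(2,2)\<close> are distinct although they describe the same
  subset of $S_2$. A two-element set \<open>{p, q}\<close> represents an unordered pair.
\<close>

definition nondisjoint_pairs :: "nat \<Rightarrow> (nat \<times> nat) set \<Rightarrow> (nat \<times> nat) set set" where
  "nondisjoint_pairs n C =
     {{p, q} | p q. p \<in> C \<and> q \<in> C \<and> p \<noteq> q \<and> perm_coset n p \<inter> perm_coset n q \<noteq> {}}"

definition coset_sum :: "(nat \<times> nat) set \<Rightarrow> (nat \<Rightarrow> nat) \<Rightarrow> real" where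
  "coset_sum C \<pi> = (\<Sum>(i, j)\<in>C. entry i j \<pi>)"

lemma sym_group_finite_nonempty: "finite (sym_group n)" "sym_group n \<noteq> {}"
  unfolding sym_group_def using finite_permutations[of "{1..n}"] permutes_id[of "{1..n}"] by blast+

lemma perm_prob_eq_card:
  "perm_prob n P = card {\<pi> \<in> sym_group n. P \<pi>} / card (sym_group n)"
proof -
  have "sym_group n \<inter> {\<pi>. P \<pi>} = {\<pi> \<in> sym_group n. P \<pi>}" by auto
  then show ?thesis
    unfolding perm_prob_def by (simp add: measure_pmf_of_set sym_group_finite_nonempty)
qed

lemma coset_nondisjoint_iff:
  assumes "i \<in> {1..n}" "j \<in> {1..n}" "k \<in> {1..n}" "l \<in> {1..n}" "(i, j) \<noteq> (k, l)"
  shows "perm_coset n (i, j) \<inter> perm_coset n (k, l) \<noteq> {} \<longleftrightarrow> i \<noteq> k \<and> j \<noteq> l"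
proof
  assume "perm_coset n (i, j) \<inter> perm_coset n (k, l) \<noteq> {}"
  then obtain \<pi> where \<pi>: "\<pi> permutes {1..n}" "\<pi> i = j" "\<pi> k = l"
    unfolding perm_coset_def sym_group_def by auto
  with permutes_inj[OF \<pi>(1)] assms(5) show "i \<noteq> k \<and> j \<noteq> l"
    by (auto dest: injD)
next
  assume ne: "i \<noteq> k \<and> j \<noteq> l"
  define m where "m = Transposition.transpose i j k"
  have m: "m \<in> {1..n}" "m \<noteq> j"
    using assms ne by (auto simp: m_def Transposition.transpose_def)
  define \<pi> where "\<pi> = Transposition.transpose m l \<circ> Transposition.transpose i j"
  have "\<pi> permutes {1..n}"
    unfolding \<pi>_def by (intro permutes_compose permutes_swap_id assms m)
  moreover have "\<pi> i = j" "\<pi> k = l"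
    using ne m by (auto simp: \<pi>_def m_def[symmetric])
  ultimately show "perm_coset n (i, j) \<inter> perm_coset n (k, l) \<noteq> {}"
    unfolding perm_coset_def sym_group_def by auto
qed

end

(*
  Write f as a sum of matrix entries c i (pi i). Swapping the images of i and k changes f by the cross
  difference c i j + c k l - c i l - c k j. If two disjoint row pairs had nonzero cross differences, one
  of four permutations would be non-Boolean; so this is rare, and a second moment argument shows that
  all but O(1/n) of the cross differences vanish. Hence, after adding constants to rows and columns,
  f = kappa + sum of d i (pi i) with only O(n) nonzero entries d, and with many zeros in each row and column.
  A switching argument shows that, for any at most two compatible nonzero entries, a positive
  fraction of the permutations through them meets no other nonzero entry. On these f is explicit, so
  kappa is 0 or 1, few entries d lie outside {0, 1} (or {0, -1} if kappa = 1), and few pairs of unit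
  entries are non-disjoint. For kappa = 1 the condition Pr[f = 1] <= 1/2 forces the entries -1 to
  concentrate on one row or column, whose complement in that line describes f.
  For bounded n a small error means that f is exactly Boolean, and integral assignment duality
  makes it a sum of pairwise disjoint cosets.
*)
theory Submission
  imports Defs
begin

section \<open>Counting permutations that extend a partial permutation\<close>

text \<open>The coefficients of \<open>f\<close> are determined only up to constants added to rows
  and columns, so single coefficients carry no information; cross differences are the invariants.
  Taking them relative to one entry \<open>(k, l)\<close> turns row \<open>k\<close> and column
  \<open>l\<close> into zeros, and averaging provides an entry for which only O(n) of them survive.
  A few lines may still be mostly nonzero; these are shifted by a frequent value of theirs. The
  obstacle is then that O(n) entries are hit a bounded but not small number of times on average, so
  no union bound avoids them. Many zeros in every line are what makes avoidance possible: a line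
  without zeros is always hit. The fraction of avoiding permutations does not depend on
  \<open>n\<close>, hence a wrong pattern of \<open>m\<close> entries costs of order
  \<open>(n - m)!\<close> non-Boolean permutations, while a union bound charges it at most
  \<open>(n - m)!\<close>. Since the two orders agree, every error stays linear in
  \<epsilon>.\<close>

definition partial_perm :: "nat \<Rightarrow> (nat \<times> nat) set \<Rightarrow> bool" where
  "partial_perm n s \<longleftrightarrow> s \<subseteq> {1..n} \<times> {1..n} \<and> inj_on fst s \<and> inj_on snd s"

definition extensions :: "nat \<Rightarrow> (nat \<times> nat) set \<Rightarrow> (nat \<Rightarrow> nat) set" where
  "extensions n s = {\<pi> \<in> sym_group n. \<forall>p\<in>s. \<pi> (fst p) = snd p}"

lemma partial_perm_finite: "partial_perm n s \<Longrightarrow> finite s"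
  unfolding partial_perm_def by (meson finite_SigmaI finite_atLeastAtMost finite_subset)

lemma partial_perm_card_le:
  assumes "partial_perm n s" shows "card s \<le> n"
proof -
  have "card s = card (fst ` s)" using assms by (simp add: card_image partial_perm_def)
  also have "\<dots> \<le> card {1..n}" using assms by (intro card_mono) (auto simp: partial_perm_def)
  finally show ?thesis by simp
qed

lemma finite_sym_group [simp]: "finite (sym_group n)"
  by (rule sym_group_finite_nonempty)

lemma finite_extensions [simp]: "finite (extensions n s)"
  by (simp add: extensions_def)

lemma card_sym_group: "card (sym_group n) = fact n"
  unfolding sym_group_def using card_permutations[of "{1..n}" n] by simp

lemma sym_group_bij: "\<pi> \<in> sym_group n \<Longrightarrow> bij_betw \<pi> {1..n} {1..n}"
  by (simp add: sym_group_def permutes_imp_bij)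

lemma sym_group_in: "\<pi> \<in> sym_group n \<Longrightarrow> i \<in> {1..n} \<Longrightarrow> \<pi> i \<in> {1..n}"
  by (simp only: sym_group_def mem_Collect_eq permutes_in_image)

lemma sym_group_eq_iff: "\<pi> \<in> sym_group n \<Longrightarrow> \<pi> i = \<pi> k \<longleftrightarrow> i = k"
  by (metis mem_Collect_eq permutes_def sym_group_def)

lemma sym_group_comp: "\<pi> \<in> sym_group n \<Longrightarrow> \<sigma> \<in> sym_group n \<Longrightarrow> \<pi> \<circ> \<sigma> \<in> sym_group n"
  unfolding sym_group_def by (simp add: permutes_compose)

lemma sym_group_transpose:
  "i \<in> {1..n} \<Longrightarrow> k \<in> {1..n} \<Longrightarrow> Transposition.transpose i k \<in> sym_group n"
  unfolding sym_group_def by (simp add: permutes_swap_id)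

lemma sum_sym_group:
  assumes "\<pi> \<in> sym_group n"
  shows "(\<Sum>i\<in>{1..n}. h (\<pi> i)) = (\<Sum>i\<in>{1..n}. h i)"
  using sum.reindex_bij_betw[OF sym_group_bij[OF assms]] .

text \<open>The rows and the columns left free by \<open>s\<close> are equally many, so any
  bijection between them completes \<open>s\<close> to a permutation.\<close>

lemma extension_exists:
  assumes "partial_perm n s" shows "extensions n s \<noteq> {}"
proof -
  define I J where "I = fst ` s" and "J = snd ` s"
  have fin: "finite s" using partial_perm_finite[OF assms] .
  have sub: "I \<subseteq> {1..n}" "J \<subseteq> {1..n}" and inj: "inj_on fst s" "inj_on snd s"
    using assms by (auto simp: partial_perm_def I_def J_def)
  have "card I = card J" by (simp add: I_def J_def card_image inj)
  moreover have "finite I" "finite J" using fin by (auto simp: I_def J_def)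
  ultimately have "card ({1..n} - I) = card ({1..n} - J)" using sub by (simp add: card_Diff_subset)
  then obtain h where h: "bij_betw h ({1..n} - I) ({1..n} - J)"
    using bij_betw_iff_card[of "{1..n} - I" "{1..n} - J"] by auto
  define g where "g = (\<lambda>i. snd (the_inv_into s fst i))"
  have bg: "bij_betw g I J"
  proof -
    have "bij_betw (the_inv_into s fst) I s"
      unfolding I_def using inj(1) by (simp add: bij_betw_the_inv_into bij_betw_imageI)
    moreover have "bij_betw snd s J" unfolding J_def using inj(2) by (simp add: bij_betw_imageI)
    ultimately show ?thesis
      unfolding g_def using bij_betw_trans[of _ I s snd J] by (simp add: comp_def)
  qed
  have g: "g (fst p) = snd p" if "p \<in> s" for p
    using that inj by (simp add: g_def the_inv_into_f_f)
  define \<pi> where "\<pi> = (\<lambda>i. if i \<in> I then g i else if i \<in> {1..n} then h i else i)"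
  have "bij_betw \<pi> (I \<union> ({1..n} - I)) (J \<union> ({1..n} - J))"
  proof (rule bij_betw_combine)
    show "bij_betw \<pi> I J" using bg by (rule bij_betw_cong[THEN iffD1, rotated]) (simp add: \<pi>_def)
    show "bij_betw \<pi> ({1..n} - I) ({1..n} - J)" using h
      by (rule bij_betw_cong[THEN iffD1, rotated]) (auto simp: \<pi>_def)
  qed auto
  moreover have "I \<union> ({1..n} - I) = {1..n}" "J \<union> ({1..n} - J) = {1..n}" using sub by auto
  ultimately have "bij_betw \<pi> {1..n} {1..n}" by simp
  then have "\<pi> permutes {1..n}"
    by (rule bij_imp_permutes) (use sub in \<open>auto simp: \<pi>_def\<close>)
  moreover have "\<pi> (fst p) = snd p" if "p \<in> s" for p
    using that g[OF that] by (auto simp: \<pi>_def I_def)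
  ultimately show ?thesis by (auto simp: extensions_def sym_group_def)
qed

text \<open>Composition with one fixed extension \<open>\<tau>\<close> identifies the extensions
  with the permutations of the free rows.\<close>

lemma card_extensions:
  assumes "partial_perm n s" shows "card (extensions n s) = fact (n - card s)"
proof -
  define I where "I = fst ` s"
  have fin: "finite s" using partial_perm_finite[OF assms] .
  have sub: "I \<subseteq> {1..n}" and inj: "inj_on fst s"
    using assms by (auto simp: partial_perm_def I_def)
  obtain \<tau> where \<tau>: "\<tau> \<in> extensions n s" using extension_exists[OF assms] by auto
  then have perm: "\<tau> permutes {1..n}" by (simp add: extensions_def sym_group_def)
  have fixI: "\<tau> (fst p) = snd p" if "p \<in> s" for p using \<tau> that by (simp add: extensions_def)
  have "bij_betw (\<lambda>\<sigma>. \<tau> \<circ> \<sigma>) {\<sigma>. \<sigma> permutes ({1..n} - I)} (extensions n s)"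
  proof (rule bij_betw_byWitness[where f' = "\<lambda>\<pi>. inv \<tau> \<circ> \<pi>"])
    show "\<forall>a\<in>{\<sigma>. \<sigma> permutes ({1..n} - I)}. inv \<tau> \<circ> (\<tau> \<circ> a) = a"
      using permutes_inv_o[OF perm] by (auto simp: o_assoc)
    show "\<forall>a\<in>extensions n s. \<tau> \<circ> (inv \<tau> \<circ> a) = a"
      using permutes_inv_o[OF perm] by (auto simp: o_assoc)
    show "(\<circ>) \<tau> ` {\<sigma>. \<sigma> permutes ({1..n} - I)} \<subseteq> extensions n s"
    proof safe
      fix \<sigma> assume \<sigma>: "\<sigma> permutes ({1..n} - I)"
      have "\<sigma> permutes {1..n}" using permutes_subset[OF \<sigma>] by auto
      then have "(\<tau> \<circ> \<sigma>) permutes {1..n}" using perm by (rule permutes_compose)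
      moreover have "(\<tau> \<circ> \<sigma>) (fst p) = snd p" if "p \<in> s" for p
        using fixI[OF that] permutes_not_in[OF \<sigma>, of "fst p"] that by (simp add: I_def)
      ultimately show "\<tau> \<circ> \<sigma> \<in> extensions n s" by (auto simp: extensions_def sym_group_def)
    qed
    show "(\<circ>) (inv \<tau>) ` extensions n s \<subseteq> {\<sigma>. \<sigma> permutes ({1..n} - I)}"
    proof safe
      fix \<pi> assume \<pi>: "\<pi> \<in> extensions n s"
      then have p: "(inv \<tau> \<circ> \<pi>) permutes {1..n}"
        using perm by (auto simp: extensions_def sym_group_def intro: permutes_compose permutes_inv)
      show "(inv \<tau> \<circ> \<pi>) permutes ({1..n} - I)"
      proof (rule permutes_superset[OF p])
        fix i assume "i \<in> {1..n} - ({1..n} - I)"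
        then obtain p where "p \<in> s" "i = fst p" by (auto simp: I_def)
        then show "(inv \<tau> \<circ> \<pi>) i = i"
          using fixI[of p] \<pi> permutes_inverses(2)[OF perm, of i] by (auto simp: extensions_def)
      qed
    qed
  qed
  then have "card (extensions n s) = card {\<sigma>. \<sigma> permutes ({1..n} - I)}"
    by (simp add: bij_betw_same_card)
  also have "\<dots> = fact (card ({1..n} - I))" by (rule card_permutations) auto
  also have "card ({1..n} - I) = n - card s"
    using sub fin inj by (simp add: I_def card_Diff_subset card_image)
  finally show ?thesis .
qed

section \<open>Avoiding a sparse set of entries\<close>

definition hits :: "(nat \<times> nat) set \<Rightarrow> (nat \<Rightarrow> nat) \<Rightarrow> (nat \<times> nat) set" where
  "hits N \<pi> = {p \<in> N. \<pi> (fst p) = snd p}"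

lemma finite_subset_square: "N \<subseteq> {1..n} \<times> {1..n::nat} \<Longrightarrow> finite N"
  by (meson finite_SigmaI finite_atLeastAtMost finite_subset)

lemma card_sym_group_preimage:
  assumes "\<pi> \<in> sym_group n"
  shows "card {i \<in> {1..n}. P (\<pi> i)} = card {j \<in> {1..n}. P j}"
proof -
  have im: "\<pi> ` {1..n} = {1..n}" using sym_group_bij[OF assms] by (simp add: bij_betw_def)
  have "{j \<in> \<pi> ` {1..n}. P j} = \<pi> ` {i \<in> {1..n}. P (\<pi> i)}" by blast
  then have "{j \<in> {1..n}. P j} = \<pi> ` {i \<in> {1..n}. P (\<pi> i)}" by (simp only: im)
  moreover have "inj_on \<pi> {i \<in> {1..n}. P (\<pi> i)}"
    using assms by (simp add: inj_on_def sym_group_eq_iff)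
  ultimately show ?thesis by (simp add: card_image)
qed

text \<open>The pairs count three-way rotations: row \<open>i\<close> receives
  \<open>\<pi> i'\<close>, row \<open>i'\<close> receives \<open>\<pi> i''\<close> and row
  \<open>i''\<close> receives \<open>j\<close>, none of these entries being in \<open>N\<close>. A
  plain swap of \<open>i\<close> and \<open>i'\<close> would need one \<open>i'\<close> that is good
  for the row and for the column, and two sets of density \<gamma> may be disjoint. With two
  auxiliary rows the conditions decouple: from the product of the two choices only \<open>n\<close>
  diagonal pairs and at most \<open>card N\<close> pairs violating the third condition are
  lost.\<close>

lemma card_good_switches:
  fixes n :: nat and \<gamma> a :: real
  assumes N: "N \<subseteq> {1..n} \<times> {1..n}" "real (card N) \<le> a * n"
    and row: "real (card {j \<in> {1..n}. (i, j) \<notin> N}) \<ge> \<gamma> * n"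
    and col: "real (card {i \<in> {1..n}. (i, j) \<notin> N}) \<ge> \<gamma> * n"
    and \<pi>: "\<pi> \<in> sym_group n" and F: "finite F" "card F \<le> 2" and big: "\<gamma> * n \<ge> 2"
  shows "real (card {(i', i''). i' \<in> {1..n} - F \<and> i'' \<in> {1..n} - F \<and> i' \<noteq> i'' \<and>
           (i, \<pi> i') \<notin> N \<and> (i'', j) \<notin> N \<and> (i', \<pi> i'') \<notin> N}) \<ge> (\<gamma> * n - 2)\<^sup>2 - (a + 1) * n"
    (is "real (card ?G) \<ge> _")
proof -
  define U V where "U = {i' \<in> {1..n} - F. (i, \<pi> i') \<notin> N}" and "V = {i'' \<in> {1..n} - F. (i'', j) \<notin> N}"
  have "card {i' \<in> {1..n}. (i, \<pi> i') \<notin> N} = card {j \<in> {1..n}. (i, j) \<notin> N}"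
    by (rule card_sym_group_preimage[OF \<pi>])
  moreover have "card {i' \<in> {1..n}. (i, \<pi> i') \<notin> N} \<le> card (U \<union> F)"
    unfolding U_def using F by (intro card_mono) auto
  moreover have "card (U \<union> F) \<le> card U + card F" by (rule card_Un_le)
  ultimately have U: "real (card U) \<ge> \<gamma> * n - 2" using row F by linarith
  have "card {i \<in> {1..n}. (i, j) \<notin> N} \<le> card (V \<union> F)"
    unfolding V_def using F by (intro card_mono) auto
  moreover have "card (V \<union> F) \<le> card V + card F" by (rule card_Un_le)
  ultimately have V: "real (card V) \<ge> \<gamma> * n - 2" using col F by linarith
  define X where "X = {(i', i''). i' \<in> {1..n} \<and> i'' \<in> {1..n} \<and> (i', \<pi> i'') \<in> N}"
  have finX: "finite X" by (rule finite_subset[of _ "{1..n} \<times> {1..n}"]) (auto simp: X_def)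
  have "card X \<le> card N"
  proof (rule card_inj_on_le[of "\<lambda>(i', i''). (i', \<pi> i'')"])
    show "inj_on (\<lambda>(i', i''). (i', \<pi> i'')) X"
      using \<pi> by (auto simp: inj_on_def sym_group_eq_iff)
    show "finite N" using finite_subset_square[OF N(1)] .
  qed (auto simp: X_def)
  have "finite ?G" by (rule finite_subset[of _ "{1..n} \<times> {1..n}"]) auto
  then have "card (U \<times> V) \<le> card (?G \<union> (\<lambda>i. (i, i)) ` {1..n} \<union> X)"
    using finX by (intro card_mono) (auto simp: U_def V_def X_def)
  also have "\<dots> \<le> card (?G \<union> (\<lambda>i. (i, i)) ` {1..n}) + card X" by (rule card_Un_le)
  also have "\<dots> \<le> card ?G + card ((\<lambda>i. (i, i)) ` {1..n}) + card X"
    by (intro add_right_mono card_Un_le)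
  also have "card ((\<lambda>i. (i, i)) ` {1..n}) = n" by (subst card_image) (auto simp: inj_on_def)
  finally have "card U * card V \<le> card ?G + n + card X" by (simp add: card_cartesian_product)
  then have "real (card U) * real (card V) \<le> card ?G + n + card X"
    by (simp only: of_nat_mult[symmetric] of_nat_add[symmetric] of_nat_le_iff)
  moreover have "(\<gamma> * n - 2) * (\<gamma> * n - 2) \<le> real (card U) * real (card V)"
    using U V big by (intro mult_mono) auto
  ultimately show ?thesis using \<open>card X \<le> card N\<close> N(2)
    by (simp add: power2_eq_square algebra_simps)
qed

lemma rotate_apply:
  assumes "i \<noteq> i'" "i \<noteq> i''" "i' \<noteq> i''"
  shows "(\<pi> \<circ> Transposition.transpose i i' \<circ> Transposition.transpose i' i'') i = \<pi> i'"
    "(\<pi> \<circ> Transposition.transpose i i' \<circ> Transposition.transpose i' i'') i' = \<pi> i''"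
    "(\<pi> \<circ> Transposition.transpose i i' \<circ> Transposition.transpose i' i'') i'' = \<pi> i"
    "x \<notin> {i, i', i''} \<Longrightarrow> (\<pi> \<circ> Transposition.transpose i i' \<circ> Transposition.transpose i' i'') x = \<pi> x"
  using assms by (auto simp: Transposition.transpose_def)

text \<open>Double counting of the rotations that remove one extra hit. They avoid the rows of
  \<open>s\<close>, so the result still extends \<open>s\<close>; none of the three rotated rows
  hits \<open>N\<close> afterwards and the other rows are unchanged, so the number of extra hits
  drops.\<close>

lemma switching_step:
  fixes n :: nat and \<gamma> a :: real
  assumes N: "N \<subseteq> {1..n} \<times> {1..n}" "real (card N) \<le> a * n"
    and row: "\<And>i. i \<in> {1..n} \<Longrightarrow> real (card {j \<in> {1..n}. (i, j) \<notin> N}) \<ge> \<gamma> * n"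
    and col: "\<And>j. j \<in> {1..n} \<Longrightarrow> real (card {i \<in> {1..n}. (i, j) \<notin> N}) \<ge> \<gamma> * n"
    and s: "partial_perm n s" "s \<subseteq> N" "card s \<le> 2" and big: "\<gamma> * n \<ge> 2"
  shows "real (card {\<pi> \<in> extensions n s. card (hits N \<pi> - s) = Suc k}) * ((\<gamma> * n - 2)\<^sup>2 - (a + 1) * n)
    \<le> real (card {\<pi> \<in> extensions n s. card (hits N \<pi> - s) \<le> k}) * card N * n"
proof -
  define A B where "A = {\<pi> \<in> extensions n s. card (hits N \<pi> - s) = Suc k}"
    and "B = {\<pi> \<in> extensions n s. card (hits N \<pi> - s) \<le> k}"
  define F where "F = fst ` s"
  have F: "finite F" "card F \<le> 2"
    using partial_perm_finite[OF s(1)] card_image_le[of s fst] s(3) by (auto simp: F_def)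
  have finN: "finite N" by (rule finite_subset_square[OF N(1)])
  have fin: "finite A" "finite B" by (auto simp: A_def B_def)
  define p where "p \<pi> = (SOME p. p \<in> hits N \<pi> - s)" for \<pi>
  have p: "p \<pi> \<in> hits N \<pi> - s" if "\<pi> \<in> A" for \<pi>
  proof -
    have "card (hits N \<pi> - s) \<noteq> 0" using that by (simp add: A_def)
    then have "hits N \<pi> - s \<noteq> {}" by (metis card.empty)
    then show ?thesis unfolding p_def by (meson equals0I someI)
  qed
  define G where "G \<pi> = {(i', i''). i' \<in> {1..n} - F \<and> i'' \<in> {1..n} - F \<and> i' \<noteq> i'' \<and>
           (fst (p \<pi>), \<pi> i') \<notin> N \<and> (i'', snd (p \<pi>)) \<notin> N \<and> (i', \<pi> i'') \<notin> N}" for \<pi>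
  have finG: "finite (G \<pi>)" for \<pi>
    by (rule finite_subset[of _ "{1..n} \<times> {1..n}"]) (auto simp: G_def)
  have G: "real (card (G \<pi>)) \<ge> (\<gamma> * n - 2)\<^sup>2 - (a + 1) * n" if "\<pi> \<in> A" for \<pi>
  proof -
    have "p \<pi> \<in> {1..n} \<times> {1..n}" using p[OF that] N by (auto simp: hits_def)
    then have "fst (p \<pi>) \<in> {1..n}" "snd (p \<pi>) \<in> {1..n}" by auto
    moreover have "\<pi> \<in> sym_group n" using that by (auto simp: A_def extensions_def)
    ultimately show ?thesis
      unfolding G_def using card_good_switches[OF N row col _ F big] by simp
  qed
  \<comment> \<open>The image records the removed entry and \<open>i'\<close>, but not
    \<open>i''\<close>: that row is recovered as the one which the rotated permutation sends to the
    column of the removed entry. This saves a factor \<open>n\<close>, so that both sides of the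
    estimate are of order \<open>n^2\<close> per permutation.\<close>
  define \<Phi> where "\<Phi> = (\<lambda>(\<pi>, i', i''). (\<pi> \<circ> Transposition.transpose (fst (p \<pi>)) i' \<circ> Transposition.transpose i' i'', p \<pi>, i'))"
  define T where "T = Sigma A G"
  have basic: "\<exists>i j. p \<pi> = (i, j) \<and> (i, j) \<in> N \<and> (i, j) \<notin> s \<and> \<pi> i = j \<and> i \<notin> F \<and> i \<noteq> i' \<and> i \<noteq> i'' \<and> i' \<noteq> i'' \<and>
      i \<in> {1..n} \<and> i' \<in> {1..n} \<and> i'' \<in> {1..n} \<and> i' \<notin> F \<and> i'' \<notin> F \<and>
      (i, \<pi> i') \<notin> N \<and> (i'', j) \<notin> N \<and> (i', \<pi> i'') \<notin> N \<and> \<pi> \<in> extensions n s \<and> \<pi> \<in> A"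
    if "(\<pi>, i', i'') \<in> T" for \<pi> i' i''
  proof -
    obtain i j where ij: "p \<pi> = (i, j)" by force
    have \<pi>: "\<pi> \<in> A" and g: "(i', i'') \<in> G \<pi>" using that by (auto simp: T_def)
    have \<pi>': "\<pi> \<in> extensions n s" using \<pi> by (auto simp: A_def)
    have h: "(i, j) \<in> N" "(i, j) \<notin> s" "\<pi> i = j" using p[OF \<pi>] ij by (auto simp: hits_def)
    have "i \<notin> F"
    proof
      assume "i \<in> F"
      then obtain q where q: "q \<in> s" "i = fst q" by (auto simp: F_def)
      then have "\<pi> i = snd q" using \<pi>' by (auto simp: extensions_def)
      with h q show False by auto
    qed
    moreover have "i \<in> {1..n}" using h N by auto
    moreover have "i' \<in> {1..n} - F" "i'' \<in> {1..n} - F" "i' \<noteq> i''" "(i, \<pi> i') \<notin> N" "(i'', j) \<notin> N" "(i', \<pi> i'') \<notin> N"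
      using g ij unfolding G_def by simp_all
    moreover from this have "i \<noteq> i'" "i \<noteq> i''" using h by metis+
    ultimately show ?thesis using ij h \<pi> \<pi>' by (intro exI[of _ i] exI[of _ j]) simp
  qed
  have "inj_on \<Phi> T"
  proof (rule inj_onI)
    fix x y assume x: "x \<in> T" and y: "y \<in> T" and eq: "\<Phi> x = \<Phi> y"
    obtain \<pi> i' i'' \<sigma> k' k'' where xy: "x = (\<pi>, i', i'')" "y = (\<sigma>, k', k'')" by (metis prod_cases3)
    obtain i j where ij: "p \<pi> = (i, j)" "\<pi> i = j" "i \<noteq> i'" "i \<noteq> i''" "i' \<noteq> i''" "\<pi> \<in> extensions n s" "i \<in> {1..n}" "i' \<in> {1..n}" "i'' \<in> {1..n}"
      using basic x xy by blast
    obtain k l where kl: "p \<sigma> = (k, l)" "\<sigma> k = l" "k \<noteq> k'" "k \<noteq> k''" "k' \<noteq> k''" "\<sigma> \<in> extensions n s"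
      using basic y xy by blast
    have e: "k = i" "l = j" "k' = i'" using eq xy ij kl by (auto simp: \<Phi>_def)
    define \<rho> where "\<rho> = \<pi> \<circ> Transposition.transpose i i' \<circ> Transposition.transpose i' i''"
    have \<rho>': "\<rho> = \<sigma> \<circ> Transposition.transpose i i' \<circ> Transposition.transpose i' k''"
      using eq xy ij kl e by (auto simp: \<Phi>_def \<rho>_def)
    have "\<rho> i'' = j" using rotate_apply(3)[of i i' i'' \<pi>] ij by (simp add: \<rho>_def)
    moreover have "\<rho> k'' = j" using rotate_apply(3)[of i i' k'' \<sigma>] kl e by (simp add: \<rho>')
    moreover have "\<rho> \<in> sym_group n"
      unfolding \<rho>_def using ij by (intro sym_group_comp sym_group_transpose) (auto simp: extensions_def)
    ultimately have e2: "k'' = i''" using sym_group_eq_iff[of \<rho> n] by metis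
    have "\<pi> = \<rho> \<circ> Transposition.transpose i' i'' \<circ> Transposition.transpose i i'"
      by (simp add: \<rho>_def fun_eq_iff)
    moreover have "\<sigma> = \<rho> \<circ> Transposition.transpose i' i'' \<circ> Transposition.transpose i i'"
      by (simp add: \<rho>' e2 fun_eq_iff)
    ultimately show "x = y" using xy e e2 by simp
  qed
  moreover have "\<Phi> ` T \<subseteq> B \<times> N \<times> {1..n}"
  proof (rule image_subsetI)
    fix x assume x: "x \<in> T"
    obtain \<pi> i' i'' where xeq: "x = (\<pi>, i', i'')" by (metis prod_cases3)
    with x have T: "(\<pi>, i', i'') \<in> T" by simp
    obtain i j where ij: "p \<pi> = (i, j)" "(i, j) \<in> N" "(i, j) \<notin> s" "\<pi> i = j" "i \<notin> F" "i \<noteq> i'" "i \<noteq> i''" "i' \<noteq> i''"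
      "i \<in> {1..n}" "i' \<in> {1..n}" "i'' \<in> {1..n}" "i' \<notin> F" "i'' \<notin> F"
      "(i, \<pi> i') \<notin> N" "(i'', j) \<notin> N" "(i', \<pi> i'') \<notin> N" "\<pi> \<in> extensions n s" "\<pi> \<in> A"
      using basic[OF T] by blast
    define \<rho> where \<rho>: "\<rho> = \<pi> \<circ> Transposition.transpose i i' \<circ> Transposition.transpose i' i''"
    note app = rotate_apply[where i=i and i'=i' and i''=i'' and \<pi>=\<pi>, folded \<rho>, OF ij(6-8)]
    have "\<rho> \<in> sym_group n"
      unfolding \<rho> using ij by (intro sym_group_comp sym_group_transpose) (auto simp: extensions_def)
    moreover have "\<rho> (fst q) = snd q" if "q \<in> s" for q
    proof -
      have "fst q \<in> F" using that by (simp add: F_def)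
      then have "fst q \<notin> {i, i', i''}" using ij by blast
      then have "\<rho> (fst q) = \<pi> (fst q)" by (rule app(4))
      then show ?thesis using that ij by (simp add: extensions_def)
    qed
    ultimately have ext: "\<rho> \<in> extensions n s" by (simp add: extensions_def)
    have sub: "hits N \<rho> - s \<subseteq> hits N \<pi> - s - {(i, j)}"
    proof
      fix q assume q: "q \<in> hits N \<rho> - s"
      then have qN: "(fst q, \<rho> (fst q)) \<in> N" and qq: "snd q = \<rho> (fst q)" "q \<in> N" "q \<notin> s"
        by (auto simp: hits_def)
      have ni: "fst q \<notin> {i, i', i''}" using qN app(1-3) ij by auto
      then have "\<rho> (fst q) = \<pi> (fst q)" by (rule app(4))
      then show "q \<in> hits N \<pi> - s - {(i, j)}" using qq ni by (auto simp: hits_def)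
    qed
    have "finite (hits N \<pi>)" using finN by (simp add: hits_def)
    then have "card (hits N \<rho> - s) \<le> card (hits N \<pi> - s - {(i, j)})" using sub by (intro card_mono) auto
    also have "\<dots> = k"
      using \<open>\<pi> \<in> A\<close> ij \<open>finite (hits N \<pi>)\<close> by (subst card_Diff_singleton) (auto simp: A_def hits_def)
    finally have "\<rho> \<in> B" using ext by (simp add: B_def)
    then show "\<Phi> x \<in> B \<times> N \<times> {1..n}" using xeq ij by (simp add: \<Phi>_def \<rho>)
  qed
  ultimately have "card T \<le> card (B \<times> N \<times> {1..n})"
    using finN fin by (intro card_inj_on_le) auto
  then have "card T \<le> card B * card N * n" by (simp add: card_cartesian_product)
  then have T_le: "real (card T) \<le> real (card B) * card N * n" by (simp only: of_nat_mult[symmetric] of_nat_le_iff)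
  have "real (card A) * ((\<gamma> * n - 2)\<^sup>2 - (a + 1) * n) \<le> (\<Sum>\<pi>\<in>A. real (card (G \<pi>)))"
    using G by (intro sum_bounded_below) 
  also have "\<dots> = real (card T)" unfolding T_def using fin finG by (subst card_SigmaI) auto
  finally show ?thesis using T_le unfolding A_def B_def by linarith
qed

lemma extensions_partial_perm:
  assumes "s \<subseteq> {1..n} \<times> {1..n}" "\<pi> \<in> extensions n s"
  shows "partial_perm n s"
proof -
  have \<pi>: "\<pi> \<in> sym_group n" and eq: "\<And>p. p \<in> s \<Longrightarrow> \<pi> (fst p) = snd p"
    using assms(2) by (auto simp: extensions_def)
  have "inj_on fst s" by (rule inj_onI) (metis eq prod_eqI)
  moreover have "inj_on snd s"
    by (rule inj_onI) (metis eq prod_eqI sym_group_eq_iff[OF \<pi>])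
  ultimately show ?thesis using assms(1) by (simp add: partial_perm_def)
qed

lemma card_extensions_le:
  assumes "s \<subseteq> {1..n} \<times> {1..n}"
  shows "card (extensions n s) \<le> fact (n - card s)"
proof (cases "extensions n s = {}")
  case False
  then have "partial_perm n s" using extensions_partial_perm[OF assms] by auto
  then show ?thesis by (simp add: card_extensions)
qed auto

lemma finite_hits: "N \<subseteq> {1..n} \<times> {1..n} \<Longrightarrow> finite (hits N \<pi>)"
  unfolding hits_def by (rule finite_subset_square) auto

lemma sum_hits_le:
  assumes N: "N \<subseteq> {1..n} \<times> {1..n}" and s: "s \<subseteq> N" "card s < n"
  shows "(\<Sum>\<pi>\<in>extensions n s. card (hits N \<pi> - s)) \<le> card N * fact (n - card s - 1)"
proof -
  have finN: "finite N" by (rule finite_subset_square[OF N])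
  have fins: "finite s" by (rule finite_subset[OF s(1) finN])
  have "(\<Sum>\<pi>\<in>extensions n s. card (hits N \<pi> - s))
      = (\<Sum>\<pi>\<in>extensions n s. \<Sum>p\<in>N - s. if \<pi> (fst p) = snd p then 1 else 0)"
  proof (rule sum.cong[OF refl])
    fix \<pi>
    have "hits N \<pi> - s = {p \<in> N - s. \<pi> (fst p) = snd p}" by (auto simp: hits_def)
    then show "card (hits N \<pi> - s) = (\<Sum>p\<in>N - s. if \<pi> (fst p) = snd p then 1 else 0)"
      using finN by (simp add: sum.If_cases Int_def)
  qed
  also have "\<dots> = (\<Sum>p\<in>N - s. \<Sum>\<pi>\<in>extensions n s. if \<pi> (fst p) = snd p then 1 else 0)"
    by (rule sum.swap)
  also have "\<dots> \<le> (\<Sum>p\<in>N - s. fact (n - card s - 1))"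
  proof (rule sum_mono)
    fix p assume p: "p \<in> N - s"
    have "extensions n (insert p s) = {\<pi> \<in> extensions n s. \<pi> (fst p) = snd p}"
      by (auto simp: extensions_def)
    then have "(\<Sum>\<pi>\<in>extensions n s. if \<pi> (fst p) = snd p then 1 else 0) = card (extensions n (insert p s))"
      by (simp add: sum.If_cases Int_def)
    also have "\<dots> \<le> fact (n - card (insert p s))"
      by (rule card_extensions_le) (use p s N in auto)
    also have "n - card (insert p s) = n - card s - 1" using p fins by simp
    finally show "(\<Sum>\<pi>\<in>extensions n s. if \<pi> (fst p) = snd p then 1 else 0) \<le> (fact (n - card s - 1) :: nat)" .
  qed
  also have "\<dots> \<le> card N * fact (n - card s - 1)"
    using finN by (simp add: card_mono)
  finally show ?thesis .
qed

text \<open>Let \<open>B k\<close> count the extensions of \<open>s\<close> with at most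
  \<open>k\<close> extra hits. Switching bounds \<open>B (Suc k)\<close> by a constant multiple of
  \<open>B k\<close>, and a first moment bound shows that \<open>B L\<close> is at least half of all
  extensions for a constant \<open>L\<close>. Going down from \<open>L\<close> to 0 loses only the
  constant factor \<open>(1 + M) ^ L\<close>.\<close>

lemma avoidance:
  fixes \<gamma> a :: real
  assumes \<gamma>: "\<gamma> > 0" and a: "a \<ge> 0"
  shows "\<exists>\<delta>>0. \<exists>n0. \<forall>n\<ge>n0. \<forall>N \<subseteq> {1..n} \<times> {1..n}. real (card N) \<le> a * n \<longrightarrow>
     (\<forall>i\<in>{1..n}. real (card {j \<in> {1..n}. (i, j) \<notin> N}) \<ge> \<gamma> * n) \<longrightarrow>
     (\<forall>j\<in>{1..n}. real (card {i \<in> {1..n}. (i, j) \<notin> N}) \<ge> \<gamma> * n) \<longrightarrow>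
     (\<forall>s \<subseteq> N. partial_perm n s \<longrightarrow> card s \<le> 2 \<longrightarrow>
       real (card {\<pi> \<in> sym_group n. hits N \<pi> = s}) \<ge> \<delta> * fact (n - card s))"
proof -
  \<comment> \<open>For \<open>n \<ge> n0\<close> every permutation admits at least
    \<open>(\<gamma> * n)^2 / 2\<close> rotations; \<open>M\<close> is the quotient of
    \<open>a * n * n\<close> by this number.\<close>
  define M where "M = 2 * a / \<gamma>\<^sup>2"
  \<comment> \<open>The mean number of extra hits is at most \<open>a * n / (n - card s)\<close>,
    which is at most \<open>2 * a\<close> since \<open>n \<ge> 4\<close> and
    \<open>card s \<le> 2\<close>. By Markov's inequality more than \<open>L\<close> extra hits
    occur on at most half of the extensions.\<close>
  define L where "L = nat \<lceil>4 * a\<rceil>"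
  define n0 where "n0 = max 4 (nat \<lceil>max (2 / \<gamma>) (2 * (a + 1 + 4 * \<gamma>) / \<gamma>\<^sup>2)\<rceil>)"
  have M: "M \<ge> 0" using a \<gamma> by (simp add: M_def)
  have L: "real L \<ge> 4 * a" unfolding L_def by linarith
  define \<delta> where "\<delta> = 1 / (2 * (1 + M) ^ L)"
  have "\<delta> > 0" using M by (simp add: \<delta>_def)
  moreover have "real (card {\<pi> \<in> sym_group n. hits N \<pi> = s}) \<ge> \<delta> * fact (n - card s)"
    if n: "n \<ge> n0" and N: "N \<subseteq> {1..n} \<times> {1..n}" "real (card N) \<le> a * n"
      and row: "\<forall>i\<in>{1..n}. real (card {j \<in> {1..n}. (i, j) \<notin> N}) \<ge> \<gamma> * n"
      and col: "\<forall>j\<in>{1..n}. real (card {i \<in> {1..n}. (i, j) \<notin> N}) \<ge> \<gamma> * n"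
      and s: "s \<subseteq> N" "partial_perm n s" "card s \<le> 2" for n N s
  proof -
    have n4: "n \<ge> 4" using n by (simp add: n0_def)
    have "real n \<ge> max (2 / \<gamma>) (2 * (a + 1 + 4 * \<gamma>) / \<gamma>\<^sup>2)"
      using n unfolding n0_def by linarith
    then have "2 / \<gamma> \<le> n" "2 * (a + 1 + 4 * \<gamma>) / \<gamma>\<^sup>2 \<le> n" by simp_all
    then have n1: "\<gamma> * n \<ge> 2" and n2: "\<gamma>\<^sup>2 * n \<ge> 2 * (a + 1 + 4 * \<gamma>)"
      using \<gamma> by (simp_all only: pos_divide_le_eq zero_less_power mult.commute)
    define G where "G = (\<gamma> * n - 2)\<^sup>2 - (a + 1) * n"
    have "\<gamma>\<^sup>2 * n * n \<ge> 2 * (a + 1 + 4 * \<gamma>) * n"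
      using n2 by (rule mult_right_mono) simp
    then have G: "G \<ge> \<gamma>\<^sup>2 * (real n)\<^sup>2 / 2"
      unfolding G_def by (simp add: power2_eq_square algebra_simps)
    define E where "E = extensions n s"
    define B where "B k = card {\<pi> \<in> E. card (hits N \<pi> - s) \<le> k}" for k
    have finE: "finite E" by (simp add: E_def)
    have step: "real (B (Suc k)) \<le> (1 + M) * B k" for k
    proof -
      define A where "A = card {\<pi> \<in> E. card (hits N \<pi> - s) = Suc k}"
      have "{\<pi> \<in> E. card (hits N \<pi> - s) \<le> Suc k} =
          {\<pi> \<in> E. card (hits N \<pi> - s) = Suc k} \<union> {\<pi> \<in> E. card (hits N \<pi> - s) \<le> k}"
        by auto
      then have BA: "B (Suc k) \<le> A + B k" unfolding B_def A_def by (simp only: card_Un_le)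
      have "real A * (\<gamma>\<^sup>2 * (real n)\<^sup>2 / 2) \<le> real A * G"
        using G by (intro mult_left_mono) auto
      also have "\<dots> \<le> real (B k) * card N * n"
        unfolding A_def B_def G_def E_def
        using switching_step[OF N _ _ s(2,1,3) n1, of k] row col by blast
      also have "\<dots> \<le> real (B k) * (a * n) * n"
        using N(2) by (intro mult_mono mult_left_mono) auto
      also have "\<dots> = real (B k) * M * (\<gamma>\<^sup>2 * (real n)\<^sup>2 / 2)"
        using \<gamma> by (simp add: M_def power2_eq_square)
      finally have "real A \<le> real (B k) * M" using \<gamma> n4 by (auto dest: mult_right_le_imp_le)
      moreover have "real (B (Suc k)) \<le> real A + real (B k)" using BA by linarith
      ultimately show ?thesis by (simp add: algebra_simps)
    qed
    have pow: "real (B k) \<le> (1 + M) ^ k * B 0" for k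
    proof (induction k)
      case (Suc k)
      have "real (B (Suc k)) \<le> (1 + M) * B k" by (rule step)
      also have "\<dots> \<le> (1 + M) * ((1 + M) ^ k * B 0)" using M Suc by (intro mult_left_mono) auto
      finally show ?case by simp
    qed simp
    define H where "H = {\<pi> \<in> E. card (hits N \<pi> - s) > L}"
    define e where "e = card E"
    have e: "e = fact (n - card s)" unfolding e_def E_def by (rule card_extensions[OF s(2)])
    have "card H * (L + 1) = (\<Sum>\<pi>\<in>H. L + 1)" by simp
    also have "\<dots> \<le> (\<Sum>\<pi>\<in>H. card (hits N \<pi> - s))" by (rule sum_mono) (simp add: H_def)
    also have "\<dots> \<le> (\<Sum>\<pi>\<in>E. card (hits N \<pi> - s))" using finE by (intro sum_mono2) (auto simp: H_def)
    also have "\<dots> \<le> card N * fact (n - card s - 1)"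
      unfolding E_def using s n4 by (intro sum_hits_le N) auto
    finally have H1: "real (card H) * (L + 1) \<le> real (card N) * fact (n - card s - 1)"
      by (metis (mono_tags, lifting) of_nat_fact of_nat_le_iff of_nat_mult of_nat_add of_nat_1)
    have fct: "(fact (n - card s) :: real) = (n - card s) * fact (n - card s - 1)"
      using s n4 by (subst fact_reduce) auto
    have half: "real n / 2 \<le> real (n - card s)" using s n4 by linarith
    have "real (card H) * (L + 1) * (n / 2) \<le> real (card N) * fact (n - card s - 1) * real (n - card s)"
      by (rule mult_mono[OF H1 half]) auto
    also have "\<dots> = real (card N) * e" by (simp add: e fct)
    also have "\<dots> \<le> a * n * e" using N(2) by (intro mult_right_mono) auto
    finally have "real n * (real (card H) * (L + 1)) \<le> real n * (2 * a * e)" by (simp add: algebra_simps)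
    then have "real (card H) * (L + 1) \<le> 2 * a * e" using n4 by simp
    moreover have "2 * a * e \<le> e / 2 * (L + 1)"
    proof -
      have "e / 2 * (4 * a) \<le> e / 2 * (L + 1)" using L by (intro mult_left_mono) auto
      then show ?thesis by simp
    qed
    ultimately have "real (card H) * (L + 1) \<le> e / 2 * (L + 1)" by linarith
    then have "real (card H) \<le> e / 2" by (rule mult_right_le_imp_le) simp
    moreover have "e \<le> B L + card H"
    proof -
      have "E \<subseteq> {\<pi> \<in> E. card (hits N \<pi> - s) \<le> L} \<union> H" by (auto simp: H_def)
      then have "e \<le> card ({\<pi> \<in> E. card (hits N \<pi> - s) \<le> L} \<union> H)"
        unfolding e_def using finE by (intro card_mono) (auto simp: H_def)
      also have "\<dots> \<le> B L + card H" unfolding B_def by (rule card_Un_le)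
      finally show ?thesis .
    qed
    ultimately have "e / 2 \<le> (1 + M) ^ L * B 0" using pow[of L] by linarith
    then have "\<delta> * e \<le> B 0" using M by (simp add: \<delta>_def field_simps add_pos_nonneg)
    moreover have "{\<pi> \<in> sym_group n. hits N \<pi> = s} = {\<pi> \<in> E. card (hits N \<pi> - s) \<le> 0}"
    proof -
      have "\<pi> \<in> sym_group n \<and> hits N \<pi> = s \<longleftrightarrow> \<pi> \<in> E \<and> hits N \<pi> - s = {}" for \<pi>
        using s(1) by (auto simp: E_def extensions_def hits_def)
      moreover have "hits N \<pi> - s = {} \<longleftrightarrow> card (hits N \<pi> - s) \<le> 0" for \<pi>
        using finite_hits[OF N(1), of \<pi>] by simp
      ultimately show ?thesis by auto
    qed
    ultimately show ?thesis by (simp add: B_def e)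
  qed
  ultimately show ?thesis by blast
qed

section \<open>Cross differences of the coefficient matrix\<close>

definition weight :: "nat \<Rightarrow> (nat \<Rightarrow> nat \<Rightarrow> real) \<Rightarrow> (nat \<Rightarrow> nat) \<Rightarrow> real" where
  "weight n c \<pi> = (\<Sum>i\<in>{1..n}. c i (\<pi> i))"

definition defect :: "nat \<Rightarrow> (nat \<Rightarrow> nat \<Rightarrow> real) \<Rightarrow> nat" where
  "defect n c = card {\<pi> \<in> sym_group n. weight n c \<pi> \<notin> {0, 1}}"

text \<open>The alternating sum over the corners of a rectangle; it does not change when constants
  are added to rows or columns.\<close>

definition cross :: "(nat \<Rightarrow> nat \<Rightarrow> real) \<Rightarrow> nat \<Rightarrow> nat \<Rightarrow> nat \<Rightarrow> nat \<Rightarrow> real" where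
  "cross c i k j l = c i j + c k l - c i l - c k j"

lemma cross_same [simp]: "cross c i i j l = 0" "cross c i k j j = 0"
  by (simp_all add: cross_def)

lemma weight_swap:
  assumes "i \<in> {1..n}" "k \<in> {1..n}" "i \<noteq> k"
  shows "weight n c (\<pi> \<circ> Transposition.transpose i k) = weight n c \<pi> - cross c i k (\<pi> i) (\<pi> k)"
proof -
  have split: "weight n c \<sigma> = c i (\<sigma> i) + c k (\<sigma> k) + (\<Sum>x\<in>{1..n} - {i} - {k}. c x (\<sigma> x))" for \<sigma>
  proof -
    have "weight n c \<sigma> = c i (\<sigma> i) + (\<Sum>x\<in>{1..n} - {i}. c x (\<sigma> x))"
      unfolding weight_def by (rule sum.remove) (use assms in auto)
    also have "(\<Sum>x\<in>{1..n} - {i}. c x (\<sigma> x)) = c k (\<sigma> k) + (\<Sum>x\<in>{1..n} - {i} - {k}. c x (\<sigma> x))"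
      by (rule sum.remove) (use assms in auto)
    finally show ?thesis by simp
  qed
  have "(\<Sum>x\<in>{1..n} - {i} - {k}. c x ((\<pi> \<circ> Transposition.transpose i k) x)) = (\<Sum>x\<in>{1..n} - {i} - {k}. c x (\<pi> x))"
    by (rule sum.cong) (auto simp: Transposition.transpose_def)
  then show ?thesis
    using split[of "\<pi> \<circ> Transposition.transpose i k"] split[of \<pi>] by (simp add: cross_def)
qed

lemma card_pullback_defect_le:
  assumes "inj_on g S" "g ` S \<subseteq> sym_group n"
  shows "card {\<pi> \<in> S. weight n c (g \<pi>) \<notin> {0, 1}} \<le> defect n c"
  unfolding defect_def
  by (rule card_inj_on_le[of g]) (use assms in \<open>auto intro: inj_on_subset\<close>)

section \<open>Disjoint row pairs: a second moment bound for nonzero cross differences\<close>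

definition row_matching :: "nat \<Rightarrow> (nat \<times> nat) set \<Rightarrow> bool" where
  "row_matching n M \<longleftrightarrow> M \<subseteq> {1..n} \<times> {1..n} \<and> (\<forall>e\<in>M. fst e \<noteq> snd e) \<and>
     (\<forall>e\<in>M. \<forall>e'\<in>M. e \<noteq> e' \<longrightarrow> {fst e, snd e} \<inter> {fst e', snd e'} = {})"

definition pair_cross :: "(nat \<Rightarrow> nat \<Rightarrow> real) \<Rightarrow> (nat \<Rightarrow> nat) \<Rightarrow> nat \<times> nat \<Rightarrow> real" where
  "pair_cross c \<pi> e = cross c (fst e) (snd e) (\<pi> (fst e)) (\<pi> (snd e))"

definition swap_pair :: "nat \<times> nat \<Rightarrow> nat \<Rightarrow> nat" where
  "swap_pair e = Transposition.transpose (fst e) (snd e)"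

lemma pair_cross_swap:
  assumes "row_matching n M" "e \<in> M" "e' \<in> M"
  shows "pair_cross c (\<pi> \<circ> swap_pair e) e' = (if e = e' then - pair_cross c \<pi> e else pair_cross c \<pi> e')"
proof (cases "e = e'")
  case False
  then have "{fst e, snd e} \<inter> {fst e', snd e'} = {}" using assms unfolding row_matching_def by blast
  then show ?thesis using False
    by (auto simp: pair_cross_def swap_pair_def Transposition.transpose_def)
qed (simp add: pair_cross_def swap_pair_def cross_def)

text \<open>
  If two of the disjoint row pairs have nonzero cross difference, then among the four permutations
  obtained by optionally swapping either pair the weights are \<open>w\<close>, \<open>w - x\<close>, \<open>w - y\<close>, \<open>w - x - y\<close>
  with \<open>x, y \<noteq> 0\<close>, and these cannot all lie in \<open>{0, 1}\<close>.
\<close>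

lemma card_two_nonzero_le:
  assumes M: "row_matching n M"
  shows "card {\<pi> \<in> sym_group n. card {e \<in> M. pair_cross c \<pi> e \<noteq> 0} \<ge> 2} \<le> 4 * defect n c"
proof -
  define A where "A \<pi> = {e \<in> M. pair_cross c \<pi> e \<noteq> 0}" for \<pi>
  define S where "S = {\<pi> \<in> sym_group n. card (A \<pi>) \<ge> 2}"
  have A_swap: "A (\<pi> \<circ> swap_pair e) = A \<pi>" if "e \<in> M" for \<pi> e
    unfolding A_def using pair_cross_swap[OF M that, of _ c \<pi>] by (intro Collect_cong) (auto split: if_splits)
  \<comment> \<open>The two pairs are chosen from the set \<open>A \<pi>\<close> alone, and swapping
    inside a pair preserves this set because it only negates one cross difference. So the choice can
    be read off after the swaps, which makes \<open>g1\<close>, \<open>g2\<close> and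
    \<open>g3\<close> injective.\<close>
  define ch where "ch X = (SOME (x, y). x \<in> X \<and> y \<in> X \<and> x \<noteq> (y :: nat \<times> nat))" for X
  define u v where "u \<pi> = fst (ch (A \<pi>))" and "v \<pi> = snd (ch (A \<pi>))" for \<pi>
  have uv: "u \<pi> \<in> A \<pi>" "v \<pi> \<in> A \<pi>" "u \<pi> \<noteq> v \<pi>" if "\<pi> \<in> S" for \<pi>
  proof -
    have two: "card (A \<pi>) \<ge> 2" using that by (simp add: S_def)
    then have "finite (A \<pi>)" by (intro card_ge_0_finite) simp
    then obtain x y where "x \<in> A \<pi>" "y \<in> A \<pi>" "x \<noteq> y"
      using two card_le_Suc0_iff_eq[of "A \<pi>"] by auto
    then have "\<exists>z. case z of (x, y) \<Rightarrow> x \<in> A \<pi> \<and> y \<in> A \<pi> \<and> x \<noteq> y"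
      by (intro exI[of _ "(x, y)"]) simp
    then have "case ch (A \<pi>) of (x, y) \<Rightarrow> x \<in> A \<pi> \<and> y \<in> A \<pi> \<and> x \<noteq> y"
      unfolding ch_def by (rule someI_ex)
    then show "u \<pi> \<in> A \<pi>" "v \<pi> \<in> A \<pi>" "u \<pi> \<noteq> v \<pi>" by (auto simp: u_def v_def split: prod.splits)
  qed
  have uvM: "u \<pi> \<in> M" "v \<pi> \<in> M" if "\<pi> \<in> S" for \<pi> using uv[OF that] by (auto simp: A_def)
  have sw: "swap_pair e \<in> sym_group n" if "e \<in> M" for e
    using that M unfolding swap_pair_def row_matching_def by (intro sym_group_transpose) auto
  have sw2: "swap_pair e \<circ> swap_pair e = id" for e by (simp add: swap_pair_def)
  have invol: "inj_on g S"
    if "\<And>\<pi>. \<pi> \<in> S \<Longrightarrow> g \<pi> = \<pi> \<circ> h (A \<pi>)" "\<And>\<pi>. \<pi> \<in> S \<Longrightarrow> A (g \<pi>) = A \<pi>" "\<And>\<pi>. \<pi> \<in> S \<Longrightarrow> surj (h (A \<pi>))"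
    for g h
  proof (rule inj_onI)
    fix \<pi> \<sigma> assume \<pi>: "\<pi> \<in> S" "\<sigma> \<in> S" and eq: "g \<pi> = g \<sigma>"
    have "A \<pi> = A \<sigma>" using that(2) \<pi> eq by metis
    then have "\<pi> \<circ> h (A \<pi>) = \<sigma> \<circ> h (A \<pi>)" using that(1) \<pi> eq by metis
    then show "\<pi> = \<sigma>" using that(3)[OF \<pi>(1)] by (metis surj_fun_eq)
  qed
  have surj_sw: "surj (swap_pair e)" for e by (simp add: swap_pair_def)
  define g1 g2 g3 where "g1 \<pi> = \<pi> \<circ> swap_pair (u \<pi>)" and "g2 \<pi> = \<pi> \<circ> swap_pair (v \<pi>)"
    and "g3 \<pi> = \<pi> \<circ> swap_pair (u \<pi>) \<circ> swap_pair (v \<pi>)" for \<pi>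
  have i1: "inj_on g1 S"
    by (rule invol[of _ "\<lambda>X. swap_pair (fst (ch X))"]) (auto simp: g1_def u_def[symmetric] A_swap uvM surj_sw)
  have i2: "inj_on g2 S"
    by (rule invol[of _ "\<lambda>X. swap_pair (snd (ch X))"]) (auto simp: g2_def v_def[symmetric] A_swap uvM surj_sw)
  have i3: "inj_on g3 S"
  proof (rule invol[of _ "\<lambda>X. swap_pair (fst (ch X)) \<circ> swap_pair (snd (ch X))"])
    fix \<pi> assume \<pi>: "\<pi> \<in> S"
    show "g3 \<pi> = \<pi> \<circ> (swap_pair (fst (ch (A \<pi>))) \<circ> swap_pair (snd (ch (A \<pi>))))"
      by (simp add: g3_def u_def v_def o_assoc)
    show "A (g3 \<pi>) = A \<pi>" using uvM[OF \<pi>] by (simp add: g3_def A_swap)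
    show "surj (swap_pair (fst (ch (A \<pi>))) \<circ> swap_pair (snd (ch (A \<pi>))))"
      by (rule comp_surj[OF surj_sw surj_sw])
  qed
  have S: "S \<subseteq> sym_group n" by (auto simp: S_def)
  have m: "g1 ` S \<subseteq> sym_group n" "g2 ` S \<subseteq> sym_group n" "g3 ` S \<subseteq> sym_group n"
    unfolding g1_def g2_def g3_def by (auto intro: subsetD[OF S] intro!: sym_group_comp sw uvM)
  define B where "B g = {\<pi> \<in> S. weight n c (g \<pi>) \<notin> {0, 1}}" for g
  have B: "card (B g) \<le> defect n c" if "inj_on g S" "g ` S \<subseteq> sym_group n" for g
    unfolding B_def using that by (rule card_pullback_defect_le)
  have "S \<subseteq> B (\<lambda>\<pi>. \<pi>) \<union> B g1 \<union> B g2 \<union> B g3"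
  proof
    fix \<pi> assume \<pi>: "\<pi> \<in> S"
    have wsw: "weight n c (\<sigma> \<circ> swap_pair e) = weight n c \<sigma> - pair_cross c \<sigma> e" if "e \<in> M" for \<sigma> e
      using that M unfolding swap_pair_def pair_cross_def row_matching_def
      by (intro weight_swap) auto
    have "pair_cross c \<pi> (u \<pi>) \<noteq> 0" "pair_cross c \<pi> (v \<pi>) \<noteq> 0" using uv[OF \<pi>] by (auto simp: A_def)
    moreover have "weight n c (g3 \<pi>) = weight n c \<pi> - pair_cross c \<pi> (u \<pi>) - pair_cross c \<pi> (v \<pi>)"
      unfolding g3_def using uvM[OF \<pi>] uv(3)[OF \<pi>] by (simp add: wsw pair_cross_swap[OF M])
    moreover have "weight n c (g1 \<pi>) = weight n c \<pi> - pair_cross c \<pi> (u \<pi>)"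
      "weight n c (g2 \<pi>) = weight n c \<pi> - pair_cross c \<pi> (v \<pi>)"
      unfolding g1_def g2_def using uvM[OF \<pi>] by (simp_all add: wsw)
    ultimately show "\<pi> \<in> B (\<lambda>\<pi>. \<pi>) \<union> B g1 \<union> B g2 \<union> B g3"
      using \<pi> by (auto simp: B_def)
  qed
  then have "card S \<le> card (B (\<lambda>\<pi>. \<pi>) \<union> B g1 \<union> B g2 \<union> B g3)"
    using finite_subset[OF S finite_sym_group] by (intro card_mono) (simp_all add: B_def)
  also have "\<dots> \<le> card (B (\<lambda>\<pi>. \<pi>)) + card (B g1) + card (B g2) + card (B g3)"
    by (intro order_trans[OF card_Un_le] add_right_mono order_refl)
  also have "\<dots> \<le> defect n c + defect n c + defect n c + defect n c"
    using B[OF i1 m(1)] B[OF i2 m(2)] B[OF i3 m(3)] B[of "\<lambda>\<pi>. \<pi>"] S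
    by (intro add_mono) (auto simp: inj_on_def)
  finally show ?thesis by (simp add: S_def A_def)
qed

lemma card_perms_pair:
  assumes "i \<in> {1..n}" "k \<in> {1..n}" "i \<noteq> k"
  shows "card {\<pi> \<in> sym_group n. Q (\<pi> i) (\<pi> k)}
    = card {(j, l). j \<in> {1..n} \<and> l \<in> {1..n} \<and> j \<noteq> l \<and> Q j l} * fact (n - 2)"
proof -
  define X where "X = {(j, l). j \<in> {1..n} \<and> l \<in> {1..n} \<and> j \<noteq> l \<and> Q j l}"
  have finX: "finite X" by (rule finite_subset[of _ "{1..n} \<times> {1..n}"]) (auto simp: X_def)
  have "{\<pi> \<in> sym_group n. Q (\<pi> i) (\<pi> k)} = (\<Union>x\<in>X. extensions n {(i, fst x), (k, snd x)})"
    using assms sym_group_in[OF _ assms(1)] sym_group_in[OF _ assms(2)]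
    by (auto simp: X_def extensions_def sym_group_eq_iff)
  also have "card \<dots> = (\<Sum>x\<in>X. card (extensions n {(i, fst x), (k, snd x)}))"
    using finX by (intro card_UN_disjoint) (auto simp: extensions_def)
  also have "\<dots> = (\<Sum>x\<in>X. fact (n - 2))"
  proof (rule sum.cong[OF refl])
    fix x assume "x \<in> X"
    then have "partial_perm n {(i, fst x), (k, snd x)}"
      using assms by (auto simp: X_def partial_perm_def inj_on_def)
    moreover have "card {(i, fst x), (k, snd x)} = 2" using assms by auto
    ultimately show "card (extensions n {(i, fst x), (k, snd x)}) = fact (n - 2)"
      by (simp add: card_extensions)
  qed
  finally show ?thesis by (simp add: X_def)
qed

lemma fact_eq_two_factors:
  assumes "n \<ge> 2"
  shows "(fact n :: real) = real n * (real n - 1) * fact (n - 2)"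
proof -
  have "(fact n :: real) = real n * fact (n - 1)" using assms by (intro fact_reduce) simp
  moreover have "(fact (n - 1) :: real) = real (n - 1) * fact (n - 1 - 1)" using assms by (intro fact_reduce) simp
  ultimately show ?thesis using assms by (simp add: of_nat_diff diff_diff_left numeral_2_eq_2)
qed

definition nonzero_count :: "nat \<Rightarrow> (nat \<Rightarrow> nat \<Rightarrow> real) \<Rightarrow> nat \<Rightarrow> nat \<Rightarrow> nat" where
  "nonzero_count n c i k = card {(j, l). j \<in> {1..n} \<and> l \<in> {1..n} \<and> j \<noteq> l \<and> cross c i k j l \<noteq> 0}"

lemma card_pair_cross_nonzero:
  assumes "row_matching n M" "e \<in> M"
  shows "card {\<pi> \<in> sym_group n. pair_cross c \<pi> e \<noteq> 0} = nonzero_count n c (fst e) (snd e) * fact (n - 2)"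
  unfolding pair_cross_def nonzero_count_def
  by (rule card_perms_pair) (use assms in \<open>auto simp: row_matching_def\<close>)

text \<open>The four rows are distinct, so prescribing their images leaves at most
  \<open>(n - 4)!\<close> permutations. This is only an upper bound: the two column pairs may
  overlap, and then no permutation realises both.\<close>

lemma card_two_pair_cross_nonzero_le:
  assumes "row_matching n M" "e \<in> M" "e' \<in> M" "e \<noteq> e'"
  shows "card {\<pi> \<in> sym_group n. pair_cross c \<pi> e \<noteq> 0 \<and> pair_cross c \<pi> e' \<noteq> 0}
    \<le> nonzero_count n c (fst e) (snd e) * nonzero_count n c (fst e') (snd e') * fact (n - 4)"
proof -
  define Z where "Z e = {(j, l). j \<in> {1..n} \<and> l \<in> {1..n} \<and> j \<noteq> l \<and> cross c (fst e) (snd e) j l \<noteq> 0}" for e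
  have finZ: "finite (Z e)" for e by (rule finite_subset[of _ "{1..n} \<times> {1..n}"]) (auto simp: Z_def)
  define s where "s x y = {(fst e, fst x), (snd e, snd x), (fst e', fst y), (snd e', snd y)}" for x y :: "nat \<times> nat"
  have mem: "fst e \<in> {1..n}" "snd e \<in> {1..n}" "fst e' \<in> {1..n}" "snd e' \<in> {1..n}"
    using assms by (auto simp: row_matching_def)
  have "{fst e, snd e} \<inter> {fst e', snd e'} = {}" "fst e \<noteq> snd e" "fst e' \<noteq> snd e'"
    using assms unfolding row_matching_def by blast+
  then have card_s: "card (s x y) = 4" for x y by (auto simp: s_def)
  have "{\<pi> \<in> sym_group n. pair_cross c \<pi> e \<noteq> 0 \<and> pair_cross c \<pi> e' \<noteq> 0}
      \<subseteq> (\<Union>z\<in>Z e \<times> Z e'. extensions n (s (fst z) (snd z)))"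
  proof
    fix \<pi> assume \<pi>: "\<pi> \<in> {\<pi> \<in> sym_group n. pair_cross c \<pi> e \<noteq> 0 \<and> pair_cross c \<pi> e' \<noteq> 0}"
    then have \<pi>': "\<pi> \<in> sym_group n" by simp
    define z where "z = ((\<pi> (fst e), \<pi> (snd e)), (\<pi> (fst e'), \<pi> (snd e')))"
    have "\<pi> \<in> extensions n (s (fst z) (snd z))" using \<pi> by (simp add: extensions_def s_def z_def)
    moreover have "z \<in> Z e \<times> Z e'"
      using \<pi> \<pi>' sym_group_in[OF _ mem(1)] sym_group_in[OF _ mem(2)] sym_group_in[OF _ mem(3)] sym_group_in[OF _ mem(4)]
        \<open>fst e \<noteq> snd e\<close> \<open>fst e' \<noteq> snd e'\<close>
      by (simp add: z_def Z_def pair_cross_def sym_group_eq_iff[OF \<pi>'])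
    ultimately show "\<pi> \<in> (\<Union>z\<in>Z e \<times> Z e'. extensions n (s (fst z) (snd z)))" by (rule UN_I[rotated])
  qed
  then have "card {\<pi> \<in> sym_group n. pair_cross c \<pi> e \<noteq> 0 \<and> pair_cross c \<pi> e' \<noteq> 0}
      \<le> card (\<Union>z\<in>Z e \<times> Z e'. extensions n (s (fst z) (snd z)))"
    using finZ by (intro card_mono) auto
  also have "\<dots> \<le> (\<Sum>z\<in>Z e \<times> Z e'. card (extensions n (s (fst z) (snd z))))"
    using finZ by (intro card_UN_le) auto
  also have "\<dots> \<le> (\<Sum>z\<in>Z e \<times> Z e'. fact (n - 4))"
  proof (rule sum_mono)
    fix z assume "z \<in> Z e \<times> Z e'"
    then have "s (fst z) (snd z) \<subseteq> {1..n} \<times> {1..n}" using mem by (auto simp: s_def Z_def)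
    then show "card (extensions n (s (fst z) (snd z))) \<le> fact (n - 4)"
      using card_extensions_le[of "s (fst z) (snd z)" n] by (simp add: card_s)
  qed
  also have "\<dots> = nonzero_count n c (fst e) (snd e) * nonzero_count n c (fst e') (snd e') * fact (n - 4)"
    by (simp add: card_cartesian_product nonzero_count_def Z_def)
  finally show ?thesis .
qed

text \<open>
  Second moment method: \<open>X \<pi>\<close> counts the row pairs with nonzero cross difference. Since
  \<open>X \<le> 1\<close> for most permutations, Chebyshev's inequality bounds the mean of \<open>X\<close>.
\<close>

lemma matching_nonzero_sum_le:
  assumes M: "row_matching n M" and n: "n \<ge> 500" and d: "real (defect n c) \<le> fact n / 100"
  shows "(\<Sum>e\<in>M. real (nonzero_count n c (fst e) (snd e))) \<le> 10 * (real n * (real n - 1))"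
proof (rule ccontr)
  assume neg: "\<not> ?thesis"
  define P where "P = sym_group n"
  define T where "T = (fact n :: real)"
  have T: "T > 0" by (simp add: T_def)
  have finM: "finite M" using M by (intro finite_subset_square[of M n]) (simp add: row_matching_def)
  have finP: "finite P" by (simp add: P_def)
  define w where "w = real n * (real n - 1)"
  have w: "w > 0" using n by (simp add: w_def)
  define p where "p e = real (nonzero_count n c (fst e) (snd e)) / w" for e
  have p0: "p e \<ge> 0" for e using w by (simp add: p_def)
  define \<mu> where "\<mu> = (\<Sum>e\<in>M. p e)"
  have \<mu>: "\<mu> > 10" using neg w by (simp add: \<mu>_def p_def w_def flip: sum_divide_distrib) (simp add: field_simps)
  define Y where "Y \<pi> e = (if pair_cross c \<pi> e \<noteq> 0 then 1 else 0 :: real)" for \<pi> e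
  define X where "X \<pi> = (\<Sum>e\<in>M. Y \<pi> e)" for \<pi>
  have X: "X \<pi> = real (card {e \<in> M. pair_cross c \<pi> e \<noteq> 0})" for \<pi>
    unfolding X_def Y_def using finM by (simp add: sum.If_cases Int_def)
  have fact2: "T = w * fact (n - 2)"
    unfolding T_def w_def by (rule fact_eq_two_factors) (use n in simp)
  have fact4: "(fact (n - 2) :: real) = (real n - 2) * (real n - 3) * fact (n - 4)"
    using fact_eq_two_factors[of "n - 2"] n by (simp add: of_nat_diff)
  have EY: "(\<Sum>\<pi>\<in>P. Y \<pi> e) = p e * T" if "e \<in> M" for e
  proof -
    have "(\<Sum>\<pi>\<in>P. Y \<pi> e) = real (card {\<pi> \<in> P. pair_cross c \<pi> e \<noteq> 0})"
      unfolding Y_def using finP by (simp add: sum.If_cases Int_def)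
    then show ?thesis
      using card_pair_cross_nonzero[OF M that, of c] w by (simp add: P_def p_def fact2)
  qed
  have EYY: "(\<Sum>\<pi>\<in>P. Y \<pi> e * Y \<pi> e') \<le> 101/100 * p e * p e' * T" if "e \<in> M" "e' \<in> M" "e \<noteq> e'" for e e'
  proof -
    have "(\<Sum>\<pi>\<in>P. Y \<pi> e * Y \<pi> e') = (\<Sum>\<pi>\<in>P. if pair_cross c \<pi> e \<noteq> 0 \<and> pair_cross c \<pi> e' \<noteq> 0 then 1 else 0)"
      by (rule sum.cong) (auto simp: Y_def)
    also have "\<dots> = real (card {\<pi> \<in> P. pair_cross c \<pi> e \<noteq> 0 \<and> pair_cross c \<pi> e' \<noteq> 0})"
      using finP by (simp add: sum.If_cases Int_def)
    also have "\<dots> \<le> real (nonzero_count n c (fst e) (snd e) * nonzero_count n c (fst e') (snd e') * fact (n - 4))"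
      unfolding P_def of_nat_le_iff using that by (rule card_two_pair_cross_nonzero_le[OF M])
    also have "\<dots> = p e * p e' * w * (w * fact (n - 4))" using w by (simp add: p_def)
    \<comment> \<open>Near independence of two row pairs: the quotient of \<open>n (n - 1)\<close>
      by \<open>(n - 2) (n - 3)\<close> is at most 101/100, which \<open>n \<ge> 500\<close>
      guarantees.\<close>
    also have "w * fact (n - 4) \<le> 101/100 * fact (n - 2)"
    proof -
      have "real n * 500 \<le> real n * real n" using n by (intro mult_left_mono) auto
      moreover have "101/100 * ((real n - 2) * (real n - 3)) - w = 1/100 * (real n * real n) - 405/100 * real n + 606/100"
        by (simp add: w_def algebra_simps)
      ultimately have "w \<le> 101/100 * ((real n - 2) * (real n - 3))" by linarith
      then have "w * fact (n - 4) \<le> 101/100 * ((real n - 2) * (real n - 3)) * fact (n - 4)"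
        by (rule mult_right_mono) simp
      then show ?thesis by (simp only: fact4 mult.assoc)
    qed
    also have "p e * p e' * w * (101/100 * fact (n - 2)) = 101/100 * p e * p e' * T" by (simp add: fact2)
    finally show ?thesis using p0 w by (simp add: mult_left_mono)
  qed
  have EX: "(\<Sum>\<pi>\<in>P. X \<pi>) = \<mu> * T"
    unfolding X_def by (subst sum.swap) (simp add: EY \<mu>_def sum_distrib_right)
  have "(\<Sum>\<pi>\<in>P. (X \<pi>)\<^sup>2) = (\<Sum>\<pi>\<in>P. \<Sum>e\<in>M. \<Sum>e'\<in>M. Y \<pi> e * Y \<pi> e')"
    by (simp add: X_def power2_eq_square sum_product)
  also have "\<dots> = (\<Sum>e\<in>M. \<Sum>\<pi>\<in>P. \<Sum>e'\<in>M. Y \<pi> e * Y \<pi> e')" by (rule sum.swap)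
  also have "\<dots> = (\<Sum>e\<in>M. \<Sum>e'\<in>M. \<Sum>\<pi>\<in>P. Y \<pi> e * Y \<pi> e')" by (intro sum.cong refl sum.swap)
  also have "\<dots> \<le> (\<Sum>e\<in>M. \<Sum>e'\<in>M. (if e' = e then p e * T else 0) + 101/100 * p e * p e' * T)"
  proof (intro sum_mono)
    fix e e' assume e: "e \<in> M" "e' \<in> M"
    show "(\<Sum>\<pi>\<in>P. Y \<pi> e * Y \<pi> e') \<le> (if e' = e then p e * T else 0) + 101/100 * p e * p e' * T"
    proof (cases "e' = e")
      case True
      have "(\<Sum>\<pi>\<in>P. Y \<pi> e * Y \<pi> e) = (\<Sum>\<pi>\<in>P. Y \<pi> e)" by (rule sum.cong) (auto simp: Y_def)
      then show ?thesis using True EY[OF e(1)] p0[of e] T by simp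
    qed (use EYY[OF e] in auto)
  qed
  also have "\<dots> = \<mu> * T + 101/100 * \<mu>\<^sup>2 * T"
    using finM by (simp add: sum.distrib \<mu>_def power2_eq_square sum_distrib_left sum_distrib_right mult_ac)
  finally have EXX: "(\<Sum>\<pi>\<in>P. (X \<pi>)\<^sup>2) \<le> \<mu> * T + 101/100 * \<mu>\<^sup>2 * T" .
  have cardP: "real (card P) = T" by (simp add: P_def T_def card_sym_group)
  have "(\<Sum>\<pi>\<in>P. (X \<pi> - \<mu>)\<^sup>2) = (\<Sum>\<pi>\<in>P. (X \<pi>)\<^sup>2) - 2 * \<mu> * (\<Sum>\<pi>\<in>P. X \<pi>) + \<mu>\<^sup>2 * T"
    by (simp add: power2_diff sum.distrib sum_subtractf sum_distrib_left sum_distrib_right mult_ac cardP[symmetric])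
  also have "\<dots> = (\<Sum>\<pi>\<in>P. (X \<pi>)\<^sup>2) - \<mu>\<^sup>2 * T" by (simp add: EX power2_eq_square)
  finally have V_eq: "(\<Sum>\<pi>\<in>P. (X \<pi> - \<mu>)\<^sup>2) = (\<Sum>\<pi>\<in>P. (X \<pi>)\<^sup>2) - \<mu>\<^sup>2 * T" .
  then have V: "(\<Sum>\<pi>\<in>P. (X \<pi> - \<mu>)\<^sup>2) \<le> \<mu> * T + 1/100 * \<mu>\<^sup>2 * T"
    using EXX unfolding V_eq by (simp add: algebra_simps)
  \<comment> \<open>At least 96 percent of the permutations have \<open>X \<le> 1\<close> and so
    deviate from the mean by at least \<open>\<mu> - 1\<close>. Comparing
    \<open>96/100 * (\<mu> - 1)^2\<close> with the variance bound
    \<open>\<mu> + \<mu>^2 / 100\<close> excludes \<open>\<mu> > 10\<close>.\<close>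
  define G where "G = {\<pi> \<in> P. X \<pi> \<le> 1}"
  have "P = {\<pi> \<in> sym_group n. card {e \<in> M. pair_cross c \<pi> e \<noteq> 0} \<ge> 2} \<union> G"
    by (auto simp: G_def P_def X)
  then have "card P \<le> card {\<pi> \<in> sym_group n. card {e \<in> M. pair_cross c \<pi> e \<noteq> 0} \<ge> 2} + card G"
    by (simp only: card_Un_le)
  then have "T \<le> 4 * real (defect n c) + real (card G)"
    using card_two_nonzero_le[OF M, of c] cardP by linarith
  then have G: "real (card G) \<ge> 96/100 * T" using d by (simp add: T_def)
  have "96/100 * T * (\<mu> - 1)\<^sup>2 \<le> real (card G) * (\<mu> - 1)\<^sup>2" using G by (rule mult_right_mono) simp
  also have "\<dots> = (\<Sum>\<pi>\<in>G. (\<mu> - 1)\<^sup>2)" by simp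
  also have "\<dots> \<le> (\<Sum>\<pi>\<in>G. (X \<pi> - \<mu>)\<^sup>2)"
  proof (rule sum_mono)
    fix \<pi> assume "\<pi> \<in> G"
    then have "(\<mu> - 1)\<^sup>2 \<le> (\<mu> - X \<pi>)\<^sup>2" using \<mu> by (intro power_mono) (auto simp: G_def)
    then show "(\<mu> - 1)\<^sup>2 \<le> (X \<pi> - \<mu>)\<^sup>2" by (simp add: power2_commute)
  qed
  also have "\<dots> \<le> (\<Sum>\<pi>\<in>P. (X \<pi> - \<mu>)\<^sup>2)" using finP by (intro sum_mono2) (auto simp: G_def)
  also have "\<dots> \<le> \<mu> * T + 1/100 * \<mu>\<^sup>2 * T" by (rule V)
  finally have "T * (96/100 * (\<mu> - 1)\<^sup>2) \<le> T * (\<mu> + 1/100 * \<mu>\<^sup>2)" by (simp add: algebra_simps)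
  then have "96/100 * (\<mu> - 1)\<^sup>2 \<le> \<mu> + 1/100 * \<mu>\<^sup>2" using T by simp
  moreover have "\<mu> * 10 \<le> \<mu> * \<mu>" using \<mu> by (intro mult_left_mono) auto
  ultimately show False using \<mu> by (simp add: power2_eq_square algebra_simps)
qed

lemma mod_add_left_cancel:
  fixes n :: nat
  assumes "(x + k) mod n = (x + k') mod n" "k \<in> {1..n}" "k' \<in> {1..n}"
  shows "k = k'"
proof -
  have *: "k = k'" if "k \<le> k'" "(x + k) mod n = (x + k') mod n" "k \<in> {1..n}" "k' \<in> {1..n}" for k k'
  proof -
    have "n dvd (x + k') - (x + k)" using that by (metis add_left_mono mod_eq_dvd_iff_nat)
    then have "n dvd k' - k" by simp
    moreover have "k' - k < n" using that by auto
    ultimately have "k' - k = 0" by (metis dvd_imp_le not_gr_zero not_le)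
    then show ?thesis using that by simp
  qed
  show ?thesis using *[of k k'] *[of k' k] assms by (metis nat_le_linear)
qed

text \<open>The pairs with a fixed residue of \<open>i + k\<close> are the orbits of the involution
  \<open>i\<close> to \<open>s - i\<close> modulo \<open>n\<close>; ordering each orbit one way
  gives a matching. As in a round robin schedule, the \<open>n\<close> residues cover all row pairs,
  so the bound for matchings extends to all pairs with \<open>n\<close> terms per
  orientation.\<close>

lemma reflection_row_matching:
  "row_matching n {(i, k). i \<in> {1..n} \<and> k \<in> {1..n} \<and> (i + k) mod n = s \<and> i < k}" (is "row_matching n ?M")
  "row_matching n {(i, k). i \<in> {1..n} \<and> k \<in> {1..n} \<and> (i + k) mod n = s \<and> k < i}" (is "row_matching n ?M'")
proof -
  have eq: "k = k'" if "(x + k) mod n = s" "(x + k') mod n = s" "k \<in> {1..n}" "k' \<in> {1..n}" for x k k'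
    using mod_add_left_cancel[of x k n k'] that by simp
  have eqr: "k = k'" if "(k + x) mod n = s" "(k' + x) mod n = s" "k \<in> {1..n}" "k' \<in> {1..n}" for x k k'
    using eq[of x k k'] that by (simp only: add.commute[of x])
  have eqm: "k = k'" if "(x + k) mod n = s" "(k' + x) mod n = s" "k \<in> {1..n}" "k' \<in> {1..n}" for x k k'
    using eq[of x k k'] that by (simp only: add.commute[of x])
  have eqs: "i = i' \<Longrightarrow> k = k'" "k = k' \<Longrightarrow> i = i'" "i = k' \<Longrightarrow> k = i'" "k = i' \<Longrightarrow> i = k'"
    if "(i + k) mod n = s" "(i' + k') mod n = s" "i \<in> {1..n}" "k \<in> {1..n}" "i' \<in> {1..n}" "k' \<in> {1..n}" for i k i' k'
    using eq[of i k k'] eqr[of i k i'] eqm[of i k i'] eqm[of k k' i] that by metis+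
  show "row_matching n ?M"
    unfolding row_matching_def
  proof (intro conjI ballI impI)
    fix e e' assume e: "e \<in> ?M" "e' \<in> ?M" "e \<noteq> e'"
    obtain i k i' k' where ee: "e = (i, k)" "e' = (i', k')" by fastforce
    have less: "i < k" "i' < k'" and eqv: "(i + k) mod n = s" "(i' + k') mod n = s" "i \<in> {1..n}" "k \<in> {1..n}" "i' \<in> {1..n}" "k' \<in> {1..n}"
      using e by (simp_all add: ee)
    note cases = eqs[OF eqv]
    have "i \<noteq> i'" "k \<noteq> k'" using cases(1,2) e(3) ee by auto
    moreover have "i \<noteq> k'" "k \<noteq> i'" using cases(3,4) less by auto
    ultimately show "{fst e, snd e} \<inter> {fst e', snd e'} = {}" by (simp add: ee)
  qed auto
  show "row_matching n ?M'"
    unfolding row_matching_def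
  proof (intro conjI ballI impI)
    fix e e' assume e: "e \<in> ?M'" "e' \<in> ?M'" "e \<noteq> e'"
    obtain i k i' k' where ee: "e = (i, k)" "e' = (i', k')" by fastforce
    have less: "k < i" "k' < i'" and eqv: "(i + k) mod n = s" "(i' + k') mod n = s" "i \<in> {1..n}" "k \<in> {1..n}" "i' \<in> {1..n}" "k' \<in> {1..n}"
      using e by (simp_all add: ee)
    note cases = eqs[OF eqv]
    have "i \<noteq> i'" "k \<noteq> k'" using cases(1,2) e(3) ee by auto
    moreover have "i \<noteq> k'" "k \<noteq> i'" using cases(3,4) less by auto
    ultimately show "{fst e, snd e} \<inter> {fst e', snd e'} = {}" by (simp add: ee)
  qed auto
qed

lemma total_nonzero_count_le:
  assumes n: "n \<ge> 500" and d: "real (defect n c) \<le> fact n / 100"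
  shows "(\<Sum>x\<in>{1..n} \<times> {1..n}. real (nonzero_count n c (fst x) (snd x))) \<le> n * (20 * (real n * (real n - 1)))"
proof -
  define h where "h x = real (nonzero_count n c (fst x) (snd x))" for x
  define S where "S = {1..n} \<times> {1..n}"
  have finS: "finite S" by (simp add: S_def)
  \<comment> \<open>The two orientations of the pairs are two matchings, each contributing at most
    10; the fixed points \<open>i = k\<close> contribute nothing.\<close>
  have sumle: "(\<Sum>x\<in>{x \<in> S. (fst x + snd x) mod n = s}. h x) \<le> 20 * (real n * (real n - 1))" for s
  proof -
    define M where "M = {(i, k). i \<in> {1..n} \<and> k \<in> {1..n} \<and> (i + k) mod n = s \<and> i < k}"
    define M' where "M' = {(i, k). i \<in> {1..n} \<and> k \<in> {1..n} \<and> (i + k) mod n = s \<and> k < i}"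
    have fin: "finite M" "finite M'"
      by (rule finite_subset[OF _ finS], auto simp: M_def M'_def S_def)+
    have "(\<Sum>x\<in>{x \<in> S. (fst x + snd x) mod n = s}. h x) = (\<Sum>x\<in>M \<union> M'. h x)"
    proof (rule sum.mono_neutral_right)
      show "\<forall>x\<in>{x \<in> S. (fst x + snd x) mod n = s} - (M \<union> M'). h x = 0"
      proof
        fix x assume "x \<in> {x \<in> S. (fst x + snd x) mod n = s} - (M \<union> M')"
        then have "fst x = snd x" by (cases x) (auto simp: M_def M'_def S_def)
        then show "h x = 0" by (simp add: h_def nonzero_count_def)
      qed
    qed (auto simp: finS M_def M'_def S_def)
    also have "\<dots> = (\<Sum>x\<in>M. h x) + (\<Sum>x\<in>M'. h x)"
      by (rule sum.union_disjoint[OF fin]) (auto simp: M_def M'_def)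
    also have "\<dots> \<le> 10 * (real n * (real n - 1)) + 10 * (real n * (real n - 1))"
      unfolding h_def M_def M'_def
      by (intro add_mono matching_nonzero_sum_le reflection_row_matching n d)
    finally show ?thesis by simp
  qed
  have "(\<Sum>x\<in>S. h x) = (\<Sum>s\<in>{..<n}. \<Sum>x\<in>{x \<in> S. (fst x + snd x) mod n = s}. h x)"
    by (rule sum.group[symmetric]) (use n finS in auto)
  also have "\<dots> \<le> (\<Sum>s\<in>{..<n}. 20 * (real n * (real n - 1)))" by (intro sum_mono sumle)
  finally show ?thesis by (simp add: S_def h_def)
qed

lemma card_prod_eq_sum:
  assumes "finite A" "finite B"
  shows "real (card {(x, y). x \<in> A \<and> y \<in> B \<and> R x y}) = (\<Sum>x\<in>A. \<Sum>y\<in>B. if R x y then 1 else 0)"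
proof -
  have "(\<Sum>x\<in>A. \<Sum>y\<in>B. if R x y then 1 else 0 :: real) = (\<Sum>x\<in>A. real (card {y \<in> B. R x y}))"
    using assms by (simp add: sum.If_cases Int_def)
  also have "\<dots> = real (card (Sigma A (\<lambda>x. {y \<in> B. R x y})))"
    using assms by (subst card_SigmaI) auto
  also have "Sigma A (\<lambda>x. {y \<in> B. R x y}) = {(x, y). x \<in> A \<and> y \<in> B \<and> R x y}" by auto
  finally show ?thesis by simp
qed

text \<open>Averaging over \<open>(k, l)\<close>: at most \<open>20 n^2 (n - 1)\<close> quadruples
  have a nonzero cross difference. If each of the \<open>n^2\<close> choices of
  \<open>(k, l)\<close> accounted for more than \<open>20 n\<close> of them, the total would be at
  least \<open>20 n^3\<close>.\<close>

lemma exists_reference_entry: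
  assumes n: "n \<ge> 500" and d: "real (defect n c) \<le> fact n / 100"
  shows "\<exists>k\<in>{1..n}. \<exists>l\<in>{1..n}.
    real (card {(i, j). i \<in> {1..n} \<and> j \<in> {1..n} \<and> cross c i k j l \<noteq> 0}) \<le> 20 * real n"
proof (rule ccontr)
  assume neg: "\<not> ?thesis"
  define I where "I = {1..n}"
  have finI: "finite I" by (simp add: I_def)
  define h where "h i k j l = (if cross c i k j l \<noteq> 0 then 1 else 0 :: real)" for i k j l
  have "(\<Sum>x\<in>I \<times> I. real (nonzero_count n c (fst x) (snd x))) = (\<Sum>i\<in>I. \<Sum>k\<in>I. real (nonzero_count n c i k))"
    by (simp add: sum.cartesian_product split_beta)
  also have "\<dots> = (\<Sum>i\<in>I. \<Sum>k\<in>I. \<Sum>j\<in>I. \<Sum>l\<in>I. h i k j l)"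
  proof (intro sum.cong refl)
    fix i k
    have "{(j, l). j \<in> {1..n} \<and> l \<in> {1..n} \<and> j \<noteq> l \<and> cross c i k j l \<noteq> 0} =
        {(j, l). j \<in> I \<and> l \<in> I \<and> cross c i k j l \<noteq> 0}" by (auto simp: I_def)
    then show "real (nonzero_count n c i k) = (\<Sum>j\<in>I. \<Sum>l\<in>I. h i k j l)"
      unfolding nonzero_count_def h_def by (simp only: card_prod_eq_sum[OF finI finI])
  qed
  also have "\<dots> = (\<Sum>k\<in>I. \<Sum>i\<in>I. \<Sum>j\<in>I. \<Sum>l\<in>I. h i k j l)" by (rule sum.swap)
  also have "\<dots> = (\<Sum>k\<in>I. \<Sum>i\<in>I. \<Sum>l\<in>I. \<Sum>j\<in>I. h i k j l)" by (intro sum.cong refl sum.swap)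
  also have "\<dots> = (\<Sum>k\<in>I. \<Sum>l\<in>I. \<Sum>i\<in>I. \<Sum>j\<in>I. h i k j l)" by (intro sum.cong refl sum.swap)
  also have "\<dots> \<ge> (\<Sum>k\<in>I. \<Sum>l\<in>I. 20 * real n)"
  proof (intro sum_mono)
    fix k l assume "k \<in> I" "l \<in> I"
    then have "\<not> real (card {(i, j). i \<in> I \<and> j \<in> I \<and> cross c i k j l \<noteq> 0}) \<le> 20 * real n"
      using neg unfolding I_def by blast
    then have "20 * real n \<le> real (card {(i, j). i \<in> I \<and> j \<in> I \<and> cross c i k j l \<noteq> 0})"
      by linarith
    then show "20 * real n \<le> (\<Sum>i\<in>I. \<Sum>j\<in>I. h i k j l)"
      unfolding h_def by (simp only: card_prod_eq_sum[OF finI finI])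
  qed
  finally have "real n * (real n * (20 * real n)) \<le> (\<Sum>x\<in>I \<times> I. real (nonzero_count n c (fst x) (snd x)))"
    by (simp add: I_def)
  also have "\<dots> \<le> n * (20 * (real n * (real n - 1)))"
    unfolding I_def by (rule total_nonzero_count_le[OF n d])
  finally have "real n * (real n * (20 * real n)) \<le> real n * (real n * (20 * (real n - 1)))"
    by (simp add: algebra_simps)
  then show False using n by simp
qed

section \<open>Frequent values in rows and columns, and the normal form\<close>

lemma weight_transpose:
  assumes "\<pi> \<in> sym_group n"
  shows "weight n (\<lambda>i j. c j i) \<pi> = weight n c (inv \<pi>)"
proof -
  have "weight n c (inv \<pi>) = (\<Sum>i\<in>{1..n}. c (\<pi> i) (inv \<pi> (\<pi> i)))"
    unfolding weight_def by (rule sum_sym_group[OF assms, symmetric])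
  also have "\<dots> = weight n (\<lambda>i j. c j i) \<pi>"
    using assms by (simp add: weight_def sym_group_def permutes_inverses)
  finally show ?thesis by simp
qed

text \<open>Transposing the coefficients amounts to inverting the permutation, and inversion is a
  bijection of \<open>sym_group n\<close>. This transfers the results on rows to columns.\<close>

lemma defect_transpose: "defect n (\<lambda>i j. c j i) = defect n c"
proof -
  have inj: "inj_on inv {\<pi>. \<pi> permutes {1..n}}"
    by (rule inj_on_inverseI[of _ inv]) (simp add: permutes_inv_inv)
  have "defect n (\<lambda>i j. c j i) \<le> defect n c" for c :: "nat \<Rightarrow> nat \<Rightarrow> real"
  proof -
    have "defect n (\<lambda>i j. c j i) = card {\<pi> \<in> sym_group n. weight n c (inv \<pi>) \<notin> {0, 1}}"
      unfolding defect_def by (rule arg_cong[of _ _ card]) (auto simp: weight_transpose)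
    also have "\<dots> \<le> defect n c"
      by (rule card_pullback_defect_le) (use inj in \<open>auto simp: sym_group_def permutes_inv\<close>)
    finally show ?thesis .
  qed
  from this[of c] this[of "\<lambda>i j. c j i"] show ?thesis by simp
qed

text \<open>If a permutation and its swap both have weight 0 or 1, the cross difference is a
  difference of two such values. Each exception is thus charged to one of two non-Boolean
  permutations, which gives 2/100. Unlike the averaged bound on nonzero cross differences, this one
  holds for every single pair of rows, hence also for atypical rows.\<close>

lemma card_cross_not_unit_le:
  assumes n: "n \<ge> 2" and d: "real (defect n c) \<le> fact n / 100" and ik: "i \<in> {1..n}" "k \<in> {1..n}"
  shows "real (card {(j, l). j \<in> {1..n} \<and> l \<in> {1..n} \<and> j \<noteq> l \<and> cross c i k j l \<notin> {-1, 0, 1}})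
    \<le> real n * (real n - 1) / 50"
proof (cases "i = k")
  case False
  define N where "N = card {(j, l). j \<in> {1..n} \<and> l \<in> {1..n} \<and> j \<noteq> l \<and> cross c i k j l \<notin> {-1, 0, 1}}"
  define g where "g \<pi> = \<pi> \<circ> Transposition.transpose i k" for \<pi> :: "nat \<Rightarrow> nat"
  have ginj: "inj_on g (sym_group n)"
    unfolding g_def by (rule inj_on_inverseI[of _ "\<lambda>\<pi>. \<pi> \<circ> Transposition.transpose i k"]) (simp add: fun_eq_iff)
  have gim: "g ` sym_group n \<subseteq> sym_group n"
    unfolding g_def by (auto intro!: sym_group_comp sym_group_transpose simp: ik[simplified])
  have "{\<pi> \<in> sym_group n. cross c i k (\<pi> i) (\<pi> k) \<notin> {-1, 0, 1}}
      \<subseteq> {\<pi> \<in> sym_group n. weight n c \<pi> \<notin> {0, 1}} \<union> {\<pi> \<in> sym_group n. weight n c (g \<pi>) \<notin> {0, 1}}"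
    using weight_swap[OF ik False, of c] by (auto simp: g_def)
  then have "card {\<pi> \<in> sym_group n. cross c i k (\<pi> i) (\<pi> k) \<notin> {-1, 0, 1}}
      \<le> card ({\<pi> \<in> sym_group n. weight n c \<pi> \<notin> {0, 1}} \<union> {\<pi> \<in> sym_group n. weight n c (g \<pi>) \<notin> {0, 1}})"
    by (intro card_mono) auto
  also have "\<dots> \<le> defect n c + defect n c"
    using card_pullback_defect_le[OF ginj gim, of c] by (intro order_trans[OF card_Un_le] add_mono) (simp_all add: defect_def)
  finally have "N * fact (n - 2) \<le> 2 * defect n c"
    using card_perms_pair[OF ik False, of "\<lambda>j l. cross c i k j l \<notin> {-1, 0, 1}"] by (simp add: N_def)
  then have "real (N * fact (n - 2)) \<le> real (2 * defect n c)" by (simp only: of_nat_le_iff)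
  then have "real N * fact (n - 2) \<le> fact n / 50" using d by simp
  moreover note fact_eq_two_factors[OF n]
  ultimately have "real N * fact (n - 2) \<le> (real n * (real n - 1) / 50) * fact (n - 2)" by simp
  then show ?thesis unfolding N_def[symmetric] by (rule mult_right_le_imp_le) simp
qed (use n in simp)

text \<open>If every value were taken fewer than \<open>n / 4\<close> times, the three values
  \<open>e l - 1\<close>, \<open>e l\<close>, \<open>e l + 1\<close> would cover less than
  \<open>3 n / 4\<close> of the indices. So each \<open>l\<close> would have more than
  \<open>n / 4\<close> partners at a forbidden difference, far more than the hypothesis
  permits.\<close>

lemma exists_mode:
  fixes e :: "nat \<Rightarrow> real"
  assumes n: "n \<ge> 1"
    and e: "real (card {(j, l). j \<in> {1..n} \<and> l \<in> {1..n} \<and> j \<noteq> l \<and> e j - e l \<notin> {-1, 0, 1}})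
      \<le> real n * (real n - 1) / 50"
  shows "\<exists>u. real (card {j \<in> {1..n}. e j = u}) \<ge> n / 4"
proof (rule ccontr)
  assume neg: "\<not> ?thesis"
  define I where "I = {1..n}"
  have finI: "finite I" and cI: "card I = n" by (auto simp: I_def)
  define B where "B l = {j \<in> I. e j - e l \<notin> {-1, 0, 1}}" for l
  have B: "real (card (B l)) \<ge> n / 50" for l
  proof -
    have "I \<subseteq> B l \<union> {j \<in> I. e j = e l - 1} \<union> {j \<in> I. e j = e l} \<union> {j \<in> I. e j = e l + 1}"
      by (auto simp: B_def)
    then have "card I \<le> card (B l \<union> {j \<in> I. e j = e l - 1} \<union> {j \<in> I. e j = e l} \<union> {j \<in> I. e j = e l + 1})"
      using finI by (intro card_mono) (auto simp: B_def)
    also have "\<dots> \<le> card (B l) + card {j \<in> I. e j = e l - 1} + card {j \<in> I. e j = e l} + card {j \<in> I. e j = e l + 1}"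
      by (intro order_trans[OF card_Un_le] add_right_mono order_refl)
    finally have "real n \<le> real (card (B l)) + real (card {j \<in> I. e j = e l - 1}) + real (card {j \<in> I. e j = e l})
        + real (card {j \<in> I. e j = e l + 1})" using cI by linarith
    moreover have "real (card {j \<in> I. e j = u}) < n / 4" for u using neg unfolding I_def by (meson not_le)
    from this[of "e l - 1"] this[of "e l"] this[of "e l + 1"]
    have "real (card {j \<in> I. e j = e l - 1}) + real (card {j \<in> I. e j = e l})
        + real (card {j \<in> I. e j = e l + 1}) < 3 * real n / 4" by linarith
    ultimately show ?thesis by linarith
  qed
  have "real n * (n / 50) = (\<Sum>l\<in>I. real n / 50)" by (simp add: cI)
  also have "\<dots> \<le> (\<Sum>l\<in>I. real (card (B l)))" by (intro sum_mono B)
  also have "\<dots> = (\<Sum>l\<in>I. \<Sum>j\<in>I. if e j - e l \<notin> {-1, 0, 1} then 1 else 0)"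
    unfolding B_def using finI by (simp add: sum.If_cases Int_def)
  also have "\<dots> = (\<Sum>j\<in>I. \<Sum>l\<in>I. if e j - e l \<notin> {-1, 0, 1} then 1 else 0)" by (rule sum.swap)
  also have "\<dots> = real (card {(j, l). j \<in> I \<and> l \<in> I \<and> e j - e l \<notin> {-1, 0, 1}})"
    by (rule card_prod_eq_sum[OF finI finI, symmetric])
  also have "{(j, l). j \<in> I \<and> l \<in> I \<and> e j - e l \<notin> {-1, 0, 1}} =
      {(j, l). j \<in> {1..n} \<and> l \<in> {1..n} \<and> j \<noteq> l \<and> e j - e l \<notin> {-1, 0, 1}}" by (auto simp: I_def)
  also note e
  finally have "real n * n \<le> real n * (real n - 1)" by simp
  then show False using n by simp
qed

text \<open>The value 0 is preferred whenever it is frequent enough. A row where it is not has more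
  than \<open>3 n / 4\<close> nonzero entries, and \<open>20 n\<close> nonzero entries leave room
  for at most 80/3 such rows; hence 26.\<close>

lemma exists_row_modes:
  fixes e :: "nat \<Rightarrow> nat \<Rightarrow> real"
  assumes n: "n \<ge> 1"
    and few: "real (card {(i, j). i \<in> {1..n} \<and> j \<in> {1..n} \<and> e i j \<noteq> 0}) \<le> 20 * real n"
    and mode: "\<And>i. i \<in> {1..n} \<Longrightarrow> \<exists>u. real (card {j \<in> {1..n}. e i j = u}) \<ge> n / 4"
  shows "\<exists>u. (\<forall>i\<in>{1..n}. real (card {j \<in> {1..n}. e i j = u i}) \<ge> n / 4) \<and> card {i \<in> {1..n}. u i \<noteq> 0} \<le> 26"
proof -
  define I where "I = {1..n}"
  have finI: "finite I" and cI: "card I = n" by (auto simp: I_def)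
  have ex: "\<forall>i. \<exists>u. i \<in> I \<longrightarrow> real (card {j \<in> I. e i j = u}) \<ge> n / 4 \<and> (u \<noteq> 0 \<longrightarrow> real (card {j \<in> I. e i j = 0}) < n / 4)"
  proof
    fix i
    show "\<exists>u. i \<in> I \<longrightarrow> real (card {j \<in> I. e i j = u}) \<ge> n / 4 \<and> (u \<noteq> 0 \<longrightarrow> real (card {j \<in> I. e i j = 0}) < n / 4)"
    proof (cases "real (card {j \<in> I. e i j = 0}) \<ge> n / 4")
      case False
      then show ?thesis using mode[of i] unfolding I_def by auto
    qed auto
  qed
  obtain u where "\<forall>i. i \<in> I \<longrightarrow> real (card {j \<in> I. e i j = u i}) \<ge> n / 4 \<and> (u i \<noteq> 0 \<longrightarrow> real (card {j \<in> I. e i j = 0}) < n / 4)"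
    using choice[OF ex] by blast
  then have u: "\<And>i. i \<in> I \<Longrightarrow> real (card {j \<in> I. e i j = u i}) \<ge> n / 4"
    "\<And>i. i \<in> I \<Longrightarrow> u i \<noteq> 0 \<Longrightarrow> real (card {j \<in> I. e i j = 0}) < n / 4" by simp_all
  define R where "R = {i \<in> I. u i \<noteq> 0}"
  have big: "real (card {j \<in> I. e i j \<noteq> 0}) \<ge> 3 * real n / 4" if "i \<in> R" for i
  proof -
    have "card I \<le> card ({j \<in> I. e i j = 0} \<union> {j \<in> I. e i j \<noteq> 0})"
      using finI by (intro card_mono) auto
    also have "\<dots> \<le> card {j \<in> I. e i j = 0} + card {j \<in> I. e i j \<noteq> 0}" by (rule card_Un_le)
    finally have "real n \<le> real (card {j \<in> I. e i j = 0}) + real (card {j \<in> I. e i j \<noteq> 0})" using cI by linarith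
    then show ?thesis using u(2)[of i] that by (simp add: R_def)
  qed
  have "real (card R) * (3 * real n / 4) = (\<Sum>i\<in>R. 3 * real n / 4)" by simp
  also have "\<dots> \<le> (\<Sum>i\<in>R. real (card {j \<in> I. e i j \<noteq> 0}))" by (intro sum_mono big)
  also have "\<dots> = real (card (Sigma R (\<lambda>i. {j \<in> I. e i j \<noteq> 0})))"
    using finI by (subst card_SigmaI) (auto simp: R_def)
  also have "\<dots> \<le> real (card {(i, j). i \<in> {1..n} \<and> j \<in> {1..n} \<and> e i j \<noteq> 0})"
    unfolding of_nat_le_iff
    by (intro card_mono finite_subset[of "{(i, j). i \<in> {1..n} \<and> j \<in> {1..n} \<and> e i j \<noteq> 0}" "{1..n} \<times> {1..n}"])
      (auto simp: R_def I_def)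
  also note few
  finally have "real n * (real (card R) * 3) \<le> real n * 80" by (simp add: algebra_simps)
  then have "real (card R) * 3 \<le> 80" using n by simp
  then have "card R \<le> 26" by linarith
  then show ?thesis using u(1) unfolding R_def I_def by blast
qed

text \<open>Inside a row, differences of the cross differences relative to \<open>(k, l)\<close> are
  again cross differences, so every row has a frequent value, and by transposition every column.
  Subtracting both kinds of values makes them interfere, but only 26 rows and 26 columns are
  shifted: the nonzero entries number at most \<open>20 n + 26 n + 26 n\<close>, and of the
  \<open>n / 4\<close> zeros gained in a line at most 26 are spoiled, which leaves
  \<open>n / 5\<close>.\<close>

lemma normal_form:
  assumes n: "n \<ge> 1000" and d: "real (defect n c) \<le> fact n / 100"
  obtains a b where
    "real (card {(i, j). i \<in> {1..n} \<and> j \<in> {1..n} \<and> c i j + a i + b j \<noteq> 0}) \<le> 72 * real n"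
    "\<And>i. i \<in> {1..n} \<Longrightarrow> real (card {j \<in> {1..n}. c i j + a i + b j = 0}) \<ge> n / 5"
    "\<And>j. j \<in> {1..n} \<Longrightarrow> real (card {i \<in> {1..n}. c i j + a i + b j = 0}) \<ge> n / 5"
proof -
  obtain k l where k: "k \<in> {1..n}" and l: "l \<in> {1..n}"
    and few: "real (card {(i, j). i \<in> {1..n} \<and> j \<in> {1..n} \<and> cross c i k j l \<noteq> 0}) \<le> 20 * real n"
    using exists_reference_entry[OF _ d] n by auto
  define e where "e i j = cross c i k j l" for i j
  have fewT: "real (card {(j, i). j \<in> {1..n} \<and> i \<in> {1..n} \<and> e i j \<noteq> 0}) \<le> 20 * real n"
  proof -
    have "{(j, i). j \<in> {1..n} \<and> i \<in> {1..n} \<and> e i j \<noteq> 0} =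
        prod.swap ` {(i, j). i \<in> {1..n} \<and> j \<in> {1..n} \<and> cross c i k j l \<noteq> 0}" by (auto simp: e_def)
    then show ?thesis using few by (simp add: card_image)
  qed
  have rowm: "\<exists>u. real (card {j \<in> {1..n}. e i j = u}) \<ge> n / 4" if i: "i \<in> {1..n}" for i
  proof (rule exists_mode)
    have "e i j - e i j' = cross c i k j j'" for j j' by (simp add: e_def cross_def)
    then show "real (card {(j, j'). j \<in> {1..n} \<and> j' \<in> {1..n} \<and> j \<noteq> j' \<and> e i j - e i j' \<notin> {-1, 0, 1}})
        \<le> real n * (real n - 1) / 50"
      using card_cross_not_unit_le[OF _ d i k] n by simp
  qed (use n in simp)
  have dT: "real (defect n (\<lambda>i j. c j i)) \<le> fact n / 100"
    using d unfolding defect_transpose[of n c] .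
  have colm: "\<exists>u. real (card {i \<in> {1..n}. e i j = u}) \<ge> n / 4" if j: "j \<in> {1..n}" for j
  proof (rule exists_mode)
    have "e i j - e i' j = cross (\<lambda>i j. c j i) j l i i'" for i i' by (simp add: e_def cross_def)
    then show "real (card {(i, i'). i \<in> {1..n} \<and> i' \<in> {1..n} \<and> i \<noteq> i' \<and> e i j - e i' j \<notin> {-1, 0, 1}})
        \<le> real n * (real n - 1) / 50"
      using card_cross_not_unit_le[OF _ dT j l] n by simp
  qed (use n in simp)
  have n1: "n \<ge> 1" using n by simp
  obtain u where u: "\<And>i. i \<in> {1..n} \<Longrightarrow> real (card {j \<in> {1..n}. e i j = u i}) \<ge> n / 4" "card {i \<in> {1..n}. u i \<noteq> 0} \<le> 26"
    using exists_row_modes[OF n1 few[folded e_def] rowm] by blast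
  obtain v where v: "\<And>j. j \<in> {1..n} \<Longrightarrow> real (card {i \<in> {1..n}. e i j = v j}) \<ge> n / 4" "card {j \<in> {1..n}. v j \<noteq> 0} \<le> 26"
    using exists_row_modes[OF n1 fewT colm] by blast
  \<comment> \<open>The cross difference relative to \<open>(k, l)\<close> is \<open>c i j\<close>
    plus a row term plus a column term; \<open>u\<close> and \<open>v\<close> subtract the frequent
    values from these terms.\<close>
  define a where "a i = c k l - c i l - u i" for i
  define b where "b j = - c k j - v j" for j
  have ab: "c i j + a i + b j = e i j - u i - v j" for i j by (simp add: a_def b_def e_def cross_def)
  show thesis
  proof (rule that[of a b])
    define E0 where "E0 = {(i, j). i \<in> {1..n} \<and> j \<in> {1..n} \<and> cross c i k j l \<noteq> 0}"
    have finE0: "finite E0" by (rule finite_subset[of _ "{1..n} \<times> {1..n}"]) (auto simp: E0_def)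
    have "{(i, j). i \<in> {1..n} \<and> j \<in> {1..n} \<and> c i j + a i + b j \<noteq> 0} \<subseteq>
        E0 \<union> {i \<in> {1..n}. u i \<noteq> 0} \<times> {1..n} \<union> {1..n} \<times> {j \<in> {1..n}. v j \<noteq> 0}"
      by (auto simp: ab E0_def e_def)
    then have "card {(i, j). i \<in> {1..n} \<and> j \<in> {1..n} \<and> c i j + a i + b j \<noteq> 0} \<le>
        card (E0 \<union> {i \<in> {1..n}. u i \<noteq> 0} \<times> {1..n} \<union> {1..n} \<times> {j \<in> {1..n}. v j \<noteq> 0})"
      using finE0 by (intro card_mono) auto
    also have "\<dots> \<le> card E0 + card ({i \<in> {1..n}. u i \<noteq> 0} \<times> {1..n}) + card ({1..n} \<times> {j \<in> {1..n}. v j \<noteq> 0})"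
      by (intro order_trans[OF card_Un_le] add_right_mono order_refl)
    also have "\<dots> = card E0 + card {i \<in> {1..n}. u i \<noteq> 0} * n + n * card {j \<in> {1..n}. v j \<noteq> 0}"
      by (simp add: card_cartesian_product)
    also have "\<dots> \<le> card E0 + 26 * n + n * 26"
      using u(2) v(2) by (intro add_mono mult_mono order_refl) auto
    finally have "real (card {(i, j). i \<in> {1..n} \<and> j \<in> {1..n} \<and> c i j + a i + b j \<noteq> 0}) \<le> real (card E0) + 52 * real n"
      by linarith
    then show "real (card {(i, j). i \<in> {1..n} \<and> j \<in> {1..n} \<and> c i j + a i + b j \<noteq> 0}) \<le> 72 * real n"
      using few by (simp add: E0_def)
  next
    fix i assume i: "i \<in> {1..n}"
    have "card {j \<in> {1..n}. e i j = u i} \<le> card ({j \<in> {1..n}. c i j + a i + b j = 0} \<union> {j \<in> {1..n}. v j \<noteq> 0})"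
      by (intro card_mono) (auto simp: ab)
    also have "\<dots> \<le> card {j \<in> {1..n}. c i j + a i + b j = 0} + card {j \<in> {1..n}. v j \<noteq> 0}" by (rule card_Un_le)
    finally have "real n / 4 \<le> real (card {j \<in> {1..n}. c i j + a i + b j = 0}) + 26"
      using u(1)[OF i] v(2) by linarith
    then show "real (card {j \<in> {1..n}. c i j + a i + b j = 0}) \<ge> n / 5" using n by simp
  next
    fix j assume j: "j \<in> {1..n}"
    have "card {i \<in> {1..n}. e i j = v j} \<le> card ({i \<in> {1..n}. c i j + a i + b j = 0} \<union> {i \<in> {1..n}. u i \<noteq> 0})"
      by (intro card_mono) (auto simp: ab)
    also have "\<dots> \<le> card {i \<in> {1..n}. c i j + a i + b j = 0} + card {i \<in> {1..n}. u i \<noteq> 0}" by (rule card_Un_le)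
    finally have "real n / 4 \<le> real (card {i \<in> {1..n}. c i j + a i + b j = 0}) + 26"
      using v(1)[OF j] u(2) by linarith
    then show "real (card {i \<in> {1..n}. c i j + a i + b j = 0}) \<ge> n / 5" using n by simp
  qed
qed

section \<open>Hit sets, non-disjoint pairs and lines\<close>

definition support :: "nat \<Rightarrow> (nat \<Rightarrow> nat \<Rightarrow> real) \<Rightarrow> (nat \<times> nat) set" where
  "support n d = {(i, j). i \<in> {1..n} \<and> j \<in> {1..n} \<and> d i j \<noteq> 0}"

text \<open>Patterns of size at most 2 suffice to detect every defect of a 0/1 sum: the empty
  pattern tests the additive constant, single entries test their values, and pairs test
  disjointness.\<close>

definition avoidable :: "real \<Rightarrow> nat \<Rightarrow> (nat \<times> nat) set \<Rightarrow> bool" where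
  "avoidable \<delta> n N \<longleftrightarrow> (\<forall>s \<subseteq> N. partial_perm n s \<longrightarrow> card s \<le> 2 \<longrightarrow>
     real (card {\<pi> \<in> sym_group n. hits N \<pi> = s}) \<ge> \<delta> * fact (n - card s))"

lemma support_subset: "support n d \<subseteq> {1..n} \<times> {1..n}"
  by (auto simp: support_def)

lemma finite_support [simp]: "finite (support n d)"
  by (rule finite_subset_square[OF support_subset])

lemma weight_eq_sum_hits:
  assumes \<pi>: "\<pi> \<in> sym_group n"
  shows "weight n d \<pi> = (\<Sum>p\<in>hits (support n d) \<pi>. d (fst p) (snd p))"
proof -
  have "weight n d \<pi> = (\<Sum>i\<in>{i \<in> {1..n}. d i (\<pi> i) \<noteq> 0}. d i (\<pi> i))"
    unfolding weight_def by (rule sum.mono_neutral_right) auto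
  also have "\<dots> = (\<Sum>p\<in>(\<lambda>i. (i, \<pi> i)) ` {i \<in> {1..n}. d i (\<pi> i) \<noteq> 0}. d (fst p) (snd p))"
    by (subst sum.reindex) (auto simp: inj_on_def)
  also have "(\<lambda>i. (i, \<pi> i)) ` {i \<in> {1..n}. d i (\<pi> i) \<noteq> 0} = hits (support n d) \<pi>"
  proof (rule set_eqI)
    fix p
    have "p \<in> (\<lambda>i. (i, \<pi> i)) ` {i \<in> {1..n}. d i (\<pi> i) \<noteq> 0} \<longleftrightarrow>
        fst p \<in> {1..n} \<and> d (fst p) (\<pi> (fst p)) \<noteq> 0 \<and> snd p = \<pi> (fst p)"
      by (cases p) auto
    also have "\<dots> \<longleftrightarrow> p \<in> hits (support n d) \<pi>"
      using sym_group_in[OF \<pi>, of "fst p"] by (cases p) (auto simp: hits_def support_def)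
    finally show "p \<in> (\<lambda>i. (i, \<pi> i)) ` {i \<in> {1..n}. d i (\<pi> i) \<noteq> 0} \<longleftrightarrow> p \<in> hits (support n d) \<pi>" .
  qed
  finally show ?thesis .
qed

lemma coset_sum_eq_card_hits: "finite C \<Longrightarrow> coset_sum C \<pi> = real (card (hits C \<pi>))"
  by (simp add: coset_sum_def entry_def hits_def split_beta sum.If_cases Int_def)

lemma card_hitting_le:
  assumes "E \<subseteq> {1..n} \<times> {1..n}"
  shows "card {\<pi> \<in> sym_group n. hits E \<pi> \<noteq> {}} \<le> card E * fact (n - 1)"
proof -
  have finE: "finite E" by (rule finite_subset_square[OF assms])
  have "{\<pi> \<in> sym_group n. hits E \<pi> \<noteq> {}} \<subseteq> (\<Union>p\<in>E. extensions n {p})"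
    by (auto simp: hits_def extensions_def)
  then have "card {\<pi> \<in> sym_group n. hits E \<pi> \<noteq> {}} \<le> card (\<Union>p\<in>E. extensions n {p})"
    using finE by (intro card_mono) auto
  also have "\<dots> \<le> (\<Sum>p\<in>E. card (extensions n {p}))" by (rule card_UN_le[OF finE])
  also have "\<dots> \<le> (\<Sum>p\<in>E. fact (n - 1))"
  proof (rule sum_mono)
    fix p assume "p \<in> E"
    then show "card (extensions n {p}) \<le> fact (n - 1)"
      using card_extensions_le[of "{p}" n] assms by auto
  qed
  finally show ?thesis by simp
qed

text \<open>On the permutations whose hit set is exactly \<open>s\<close> the weight is the sum of
  \<open>d\<close> over \<open>s\<close>. For different \<open>s\<close> these classes are disjoint,
  so the contributions of the bad patterns add up without any overcounting.\<close>

lemma card_bad_family_le: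
  assumes av: "avoidable \<delta> n (support n d)" and m: "m \<le> 2"
    and F: "\<And>s. s \<in> \<F> \<Longrightarrow> s \<subseteq> support n d \<and> partial_perm n s \<and> card s = m \<and>
      \<kappa> + (\<Sum>p\<in>s. d (fst p) (snd p)) \<notin> {0, 1}"
  shows "real (card \<F>) * (\<delta> * fact (n - m)) \<le> real (card {\<pi> \<in> sym_group n. \<kappa> + weight n d \<pi> \<notin> {0, 1}})"
proof -
  define H where "H s = {\<pi> \<in> sym_group n. hits (support n d) \<pi> = s}" for s
  have "\<F> \<subseteq> Pow (support n d)" using F by auto
  then have finF: "finite \<F>" by (rule finite_subset) simp
  have "real (card \<F>) * (\<delta> * fact (n - m)) \<le> (\<Sum>s\<in>\<F>. real (card (H s)))"
  proof (rule sum_bounded_below)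
    fix s assume "s \<in> \<F>"
    then show "\<delta> * fact (n - m) \<le> real (card (H s))"
      using F[of s] av m unfolding avoidable_def H_def by auto
  qed
  also have "\<dots> = real (card (\<Union>s\<in>\<F>. H s))"
    using finF by (subst card_UN_disjoint) (auto simp: H_def)
  also have "\<dots> \<le> real (card {\<pi> \<in> sym_group n. \<kappa> + weight n d \<pi> \<notin> {0, 1}})"
    unfolding of_nat_le_iff
  proof (rule card_mono)
    show "(\<Union>s\<in>\<F>. H s) \<subseteq> {\<pi> \<in> sym_group n. \<kappa> + weight n d \<pi> \<notin> {0, 1}}"
    proof
      fix \<pi> assume "\<pi> \<in> (\<Union>s\<in>\<F>. H s)"
      then obtain s where s: "s \<in> \<F>" "\<pi> \<in> sym_group n" "hits (support n d) \<pi> = s" by (auto simp: H_def)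
      then show "\<pi> \<in> {\<pi> \<in> sym_group n. \<kappa> + weight n d \<pi> \<notin> {0, 1}}"
        using F[OF s(1)] by (simp add: weight_eq_sum_hits)
    qed
  qed simp
  finally show ?thesis .
qed

lemma finite_nondisjoint_pairs: "finite C \<Longrightarrow> finite (nondisjoint_pairs n C)"
  by (rule finite_subset[of _ "Pow C"]) (auto simp: nondisjoint_pairs_def)

lemma nondisjoint_pairs_iff:
  assumes "C \<subseteq> {1..n} \<times> {1..n}"
  shows "s \<in> nondisjoint_pairs n C \<longleftrightarrow> (\<exists>p\<in>C. \<exists>q\<in>C. s = {p, q} \<and> fst p \<noteq> fst q \<and> snd p \<noteq> snd q)"
proof -
  have *: "p \<noteq> q \<and> perm_coset n p \<inter> perm_coset n q \<noteq> {} \<longleftrightarrow> fst p \<noteq> fst q \<and> snd p \<noteq> snd q"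
    if "p \<in> C" "q \<in> C" for p q
  proof -
    have "fst p \<in> {1..n}" "snd p \<in> {1..n}" "fst q \<in> {1..n}" "snd q \<in> {1..n}"
      using that assms by auto
    from coset_nondisjoint_iff[OF this] show ?thesis by (cases "p = q") (auto simp: prod_eq_iff)
  qed
  have "s \<in> nondisjoint_pairs n C \<longleftrightarrow>
      (\<exists>p\<in>C. \<exists>q\<in>C. s = {p, q} \<and> (p \<noteq> q \<and> perm_coset n p \<inter> perm_coset n q \<noteq> {}))"
    unfolding nondisjoint_pairs_def by blast
  also have "\<dots> \<longleftrightarrow> (\<exists>p\<in>C. \<exists>q\<in>C. s = {p, q} \<and> (fst p \<noteq> fst q \<and> snd p \<noteq> snd q))"
    by (intro bex_cong refl conj_cong *)
  finally show ?thesis .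
qed

lemma nondisjoint_pair_partial_perm:
  assumes "C \<subseteq> {1..n} \<times> {1..n}" "s \<in> nondisjoint_pairs n C"
  shows "s \<subseteq> C" "partial_perm n s" "card s = 2"
proof -
  obtain p q where pq: "p \<in> C" "q \<in> C" "s = {p, q}" "fst p \<noteq> fst q" "snd p \<noteq> snd q"
    using assms(2) unfolding nondisjoint_pairs_iff[OF assms(1)] by blast
  then show "s \<subseteq> C" by simp
  then show "partial_perm n s" using assms(1) pq by (auto simp: partial_perm_def inj_on_def)
  have "p \<noteq> q" using pq by auto
  then show "card s = 2" by (simp add: pq)
qed

text \<open>Two compatible unit entries alone sum to 2, and a single entry outside {0, 1} is bad by
  itself; both kinds of pattern are therefore rare. A permutation that hits no entry of the second
  kind has weight equal to its number of hits of \<open>C\<close>. The union bound over such entries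
  costs \<open>(n - 1)!\<close> each, and each of them already forces
  \<open>\<delta> * (n - 1)!\<close> non-Boolean permutations, which explains the factor
  \<open>\<epsilon> / \<delta>\<close>.\<close>

lemma unit_entries_structure:
  fixes n :: nat
  assumes n: "n \<ge> 2" and \<delta>: "\<delta> > 0" and av: "avoidable \<delta> n (support n d)"
    and D: "real (defect n d) \<le> \<epsilon> * fact n"
    and C: "C = {(i, j). i \<in> {1..n} \<and> j \<in> {1..n} \<and> d i j = 1}"
  shows "real (card (nondisjoint_pairs n C)) \<le> \<epsilon> / \<delta> * (real n)\<^sup>2"
    and "real (card {\<pi> \<in> sym_group n. weight n d \<pi> \<noteq> coset_sum C \<pi>}) \<le> \<epsilon> / \<delta> * fact n"
proof -
  have Csub: "C \<subseteq> support n d" and Csq: "C \<subseteq> {1..n} \<times> {1..n}" by (auto simp: C support_def)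
  have finC: "finite C" by (rule finite_subset_square[OF Csq])
  note f2 = fact_eq_two_factors[OF n]
  have def0: "card {\<pi> \<in> sym_group n. 0 + weight n d \<pi> \<notin> {0, 1}} = defect n d" by (simp add: defect_def)
  have eps: "\<epsilon> \<ge> 0"
  proof -
    have "0 * fact n \<le> \<epsilon> * fact n" using D by (rule order_trans[rotated]) simp
    then show ?thesis by (rule mult_right_le_imp_le) simp
  qed
  have "real (card (nondisjoint_pairs n C)) * (\<delta> * fact (n - 2)) \<le> real (defect n d)"
    unfolding def0[symmetric]
  proof (rule card_bad_family_le[OF av])
    fix s assume s: "s \<in> nondisjoint_pairs n C"
    note pp = nondisjoint_pair_partial_perm[OF Csq s]
    have "(\<Sum>p\<in>s. d (fst p) (snd p)) = (\<Sum>p\<in>s. 1)"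
      by (rule sum.cong) (use pp(1) in \<open>auto simp: C\<close>)
    then show "s \<subseteq> support n d \<and> partial_perm n s \<and> card s = 2 \<and> 0 + (\<Sum>p\<in>s. d (fst p) (snd p)) \<notin> {0, 1}"
      using pp Csub by auto
  qed simp
  also have "\<dots> \<le> \<epsilon> * fact n" by (rule D)
  also have "\<dots> = \<epsilon> * (real n * (real n - 1)) * fact (n - 2)" by (simp add: f2)
  finally have "(real (card (nondisjoint_pairs n C)) * \<delta>) * fact (n - 2) \<le> (\<epsilon> * (real n * (real n - 1))) * fact (n - 2)"
    by (simp add: mult.assoc)
  then have "real (card (nondisjoint_pairs n C)) * \<delta> \<le> \<epsilon> * (real n * (real n - 1))"
    by (rule mult_right_le_imp_le) simp
  also have "\<dots> \<le> \<epsilon> * (real n)\<^sup>2" using eps by (intro mult_left_mono) (simp_all add: power2_eq_square algebra_simps)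
  finally show "real (card (nondisjoint_pairs n C)) \<le> \<epsilon> / \<delta> * (real n)\<^sup>2"
    using \<delta> by (simp add: pos_le_divide_eq)
  define B where "B = {p \<in> support n d. d (fst p) (snd p) \<noteq> 1}"
  have Bsq: "B \<subseteq> {1..n} \<times> {1..n}" using support_subset by (auto simp: B_def)
  have "real (card ((\<lambda>p. {p}) ` B)) * (\<delta> * fact (n - 1)) \<le> real (defect n d)"
    unfolding def0[symmetric]
  proof (rule card_bad_family_le[OF av])
    fix s assume "s \<in> (\<lambda>p. {p}) ` B"
    then obtain p where p: "s = {p}" "p \<in> B" by auto
    then have "p \<in> support n d" "d (fst p) (snd p) \<notin> {0, 1}" by (auto simp: B_def support_def)
    moreover have "p \<in> {1..n} \<times> {1..n}" using p Bsq by blast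
    ultimately show "s \<subseteq> support n d \<and> partial_perm n s \<and> card s = 1 \<and> 0 + (\<Sum>p\<in>s. d (fst p) (snd p)) \<notin> {0, 1}"
      using p by (simp add: partial_perm_def)
  qed simp
  also have "card ((\<lambda>p. {p}) ` B) = card B" by (simp add: card_image)
  finally have B: "real (card B) * (\<delta> * fact (n - 1)) \<le> \<epsilon> * fact n" using D by linarith
  have "{\<pi> \<in> sym_group n. weight n d \<pi> \<noteq> coset_sum C \<pi>} \<subseteq> {\<pi> \<in> sym_group n. hits B \<pi> \<noteq> {}}"
  proof safe
    fix \<pi> assume \<pi>: "\<pi> \<in> sym_group n" and neq: "weight n d \<pi> \<noteq> coset_sum C \<pi>" and "hits B \<pi> = {}"
    then have "hits (support n d) \<pi> = hits C \<pi>"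
      using Csub by (fastforce simp: hits_def B_def C support_def)
    then have "weight n d \<pi> = (\<Sum>p\<in>hits C \<pi>. d (fst p) (snd p))" by (simp add: weight_eq_sum_hits[OF \<pi>])
    also have "\<dots> = (\<Sum>p\<in>hits C \<pi>. 1)" by (rule sum.cong) (auto simp: C hits_def)
    finally show False using neq finC by (simp add: coset_sum_eq_card_hits)
  qed
  then have "card {\<pi> \<in> sym_group n. weight n d \<pi> \<noteq> coset_sum C \<pi>} \<le> card {\<pi> \<in> sym_group n. hits B \<pi> \<noteq> {}}"
    by (intro card_mono) auto
  also have "\<dots> \<le> card B * fact (n - 1)" by (rule card_hitting_le[OF Bsq])
  finally have "real (card {\<pi> \<in> sym_group n. weight n d \<pi> \<noteq> coset_sum C \<pi>}) \<le> real (card B * fact (n - 1))"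
    by (simp only: of_nat_le_iff)
  also have "\<dots> = real (card B) * (\<delta> * fact (n - 1)) / \<delta>" using \<delta> by simp
  also have "\<dots> \<le> \<epsilon> * fact n / \<delta>" using B \<delta> by (intro divide_right_mono) auto
  finally show "real (card {\<pi> \<in> sym_group n. weight n d \<pi> \<noteq> coset_sum C \<pi>}) \<le> \<epsilon> / \<delta> * fact n" by simp
qed

section \<open>Lines, and concentration of families with few non-disjoint pairs\<close>

definition is_line :: "nat \<Rightarrow> (nat \<times> nat) set \<Rightarrow> bool" where
  "is_line n L \<longleftrightarrow> (\<exists>i\<in>{1..n}. L = {i} \<times> {1..n}) \<or> (\<exists>j\<in>{1..n}. L = {1..n} \<times> {j})"

text \<open>The coset sum of a line is the constant 1, and the cosets of a line are pairwise
  disjoint. Both facts are what allows a subset of a line to be exchanged for its complement in the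
  line.\<close>

lemma line_facts:
  assumes "is_line n L"
  shows "L \<subseteq> {1..n} \<times> {1..n}" "card L = n" "\<pi> \<in> sym_group n \<Longrightarrow> card (hits L \<pi>) = 1"
    "X \<subseteq> L \<Longrightarrow> nondisjoint_pairs n X = {}"
proof -
  show sq: "L \<subseteq> {1..n} \<times> {1..n}" and "card L = n" using assms by (auto simp: is_line_def card_cartesian_product)
  show "card (hits L \<pi>) = 1" if \<pi>: "\<pi> \<in> sym_group n"
  proof -
    consider (row) i where "i \<in> {1..n}" "L = {i} \<times> {1..n}" | (col) j where "j \<in> {1..n}" "L = {1..n} \<times> {j}"
      using assms by (auto simp: is_line_def)
    then show ?thesis
    proof cases
      case row
      then have "hits L \<pi> = {(i, \<pi> i)}" using sym_group_in[OF \<pi>, of i] by (auto simp: hits_def)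
      then show ?thesis by simp
    next
      case col
      obtain i where i: "i \<in> {1..n}" "\<pi> i = j"
        using col sym_group_bij[OF \<pi>] by (metis bij_betw_iff_bijections)
      have "hits L \<pi> = {(i, j)}"
        using col i sym_group_eq_iff[OF \<pi>] by (auto simp: hits_def)
      then show ?thesis by simp
    qed
  qed
  show "nondisjoint_pairs n X = {}" if "X \<subseteq> L"
  proof -
    have Xsq: "X \<subseteq> {1..n} \<times> {1..n}" using that sq by (rule order_trans)
    have line: "fst p = fst q \<or> snd p = snd q" if "p \<in> X" "q \<in> X" for p q
    proof -
      have "p \<in> L" "q \<in> L" using that \<open>X \<subseteq> L\<close> by auto
      then show ?thesis using assms by (auto simp: is_line_def)
    qed
    have "s \<notin> nondisjoint_pairs n X" for s
      unfolding nondisjoint_pairs_iff[OF Xsq] using line by blast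
    then show ?thesis by auto
  qed
qed

lemma card_doubleton_le: "card {x, y} \<le> 2"
  by (cases "x = y") auto

lemma card_ordered_nondisjoint_le:
  assumes C: "C \<subseteq> {1..n} \<times> {1..n}"
  shows "(\<Sum>p\<in>C. card {q \<in> C. fst p \<noteq> fst q \<and> snd p \<noteq> snd q}) \<le> 2 * card (nondisjoint_pairs n C)"
proof -
  have finC: "finite C" by (rule finite_subset_square[OF C])
  define W where "W s = {(p, q). {p, q} = s \<and> p \<noteq> (q :: nat \<times> nat)}" for s
  have W: "finite (W s) \<and> card (W s) \<le> 2" if s: "s \<in> nondisjoint_pairs n C" for s
  proof -
    obtain p q where "s = {p, q}" using s unfolding nondisjoint_pairs_iff[OF C] by blast
    then have sub: "W s \<subseteq> {(p, q), (q, p)}" by (auto simp: W_def doubleton_eq_iff)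
    have "card (W s) \<le> card {(p, q), (q, p)}" by (rule card_mono[OF _ sub]) simp
    also have "\<dots> \<le> 2" by (rule card_doubleton_le)
    finally show ?thesis using finite_subset[OF sub] by simp
  qed
  have "(\<Sum>p\<in>C. card {q \<in> C. fst p \<noteq> fst q \<and> snd p \<noteq> snd q})
      = card (Sigma C (\<lambda>p. {q \<in> C. fst p \<noteq> fst q \<and> snd p \<noteq> snd q}))"
    using finC by (subst card_SigmaI) auto
  also have "\<dots> \<le> card (\<Union>s\<in>nondisjoint_pairs n C. W s)"
  proof (rule card_mono)
    show "finite (\<Union>s\<in>nondisjoint_pairs n C. W s)"
      using W finite_nondisjoint_pairs[OF finC] by blast
    show "Sigma C (\<lambda>p. {q \<in> C. fst p \<noteq> fst q \<and> snd p \<noteq> snd q}) \<subseteq> (\<Union>s\<in>nondisjoint_pairs n C. W s)"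
    proof
      fix x assume "x \<in> Sigma C (\<lambda>p. {q \<in> C. fst p \<noteq> fst q \<and> snd p \<noteq> snd q})"
      then obtain p q where pq: "x = (p, q)" "p \<in> C" "q \<in> C" "fst p \<noteq> fst q" "snd p \<noteq> snd q"
        by (elim SigmaE) simp
      from pq have "p \<noteq> q" by blast
      then have "x \<in> W {p, q}" by (simp add: W_def pq(1))
      moreover have "{p, q} \<in> nondisjoint_pairs n C"
        unfolding nondisjoint_pairs_iff[OF C]
        by (rule bexI[of _ p], rule bexI[of _ q]) (simp_all add: pq)
      ultimately show "x \<in> (\<Union>s\<in>nondisjoint_pairs n C. W s)" by (rule UN_I[rotated])
    qed
  qed
  also have "\<dots> \<le> (\<Sum>s\<in>nondisjoint_pairs n C. card (W s))"
    by (rule card_UN_le[OF finite_nondisjoint_pairs[OF finC]])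
  also have "\<dots> \<le> (\<Sum>s\<in>nondisjoint_pairs n C. 2)" using W by (intro sum_mono) auto
  finally show ?thesis by simp
qed

text \<open>An entry in the row of \<open>p\<close> and an entry in its column, both different from
  \<open>p\<close>, never share a line, so every such choice yields a non-disjoint pair, and
  different choices yield different pairs.\<close>

lemma card_row_col_le:
  assumes C: "C \<subseteq> {1..n} \<times> {1..n}"
  shows "card ({q \<in> C. fst q = fst p} - {p}) * card ({q \<in> C. snd q = snd p} - {p}) \<le> card (nondisjoint_pairs n C)"
proof -
  define R S where "R = {q \<in> C. fst q = fst p} - {p}" and "S = {q \<in> C. snd q = snd p} - {p}"
  have nd: "fst q \<noteq> fst q' \<and> snd q \<noteq> snd q'" if "q \<in> R" "q' \<in> S" for q q'
    using that by (auto simp: R_def S_def prod_eq_iff)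
  have "card (R \<times> S) \<le> card (nondisjoint_pairs n C)"
  proof (rule card_inj_on_le[of "\<lambda>(q, q'). {q, q'}"])
    show "inj_on (\<lambda>(q, q'). {q, q'}) (R \<times> S)"
    proof (rule inj_onI)
      fix x y assume x: "x \<in> R \<times> S" and y: "y \<in> R \<times> S" and eq: "(\<lambda>(q, q'). {q, q'}) x = (\<lambda>(q, q'). {q, q'}) y"
      have "fst x \<noteq> snd y" using nd[of "fst x" "snd y"] x y by auto
      then show "x = y" using eq by (auto simp: split_beta doubleton_eq_iff prod_eq_iff)
    qed
    show "(\<lambda>(q, q'). {q, q'}) ` (R \<times> S) \<subseteq> nondisjoint_pairs n C"
    proof (rule image_subsetI)
      fix x assume "x \<in> R \<times> S"
      then have "fst x \<in> R" "snd x \<in> S" by auto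
      moreover from this have "fst x \<in> C" "snd x \<in> C" by (auto simp: R_def S_def)
      ultimately show "(\<lambda>(q, q'). {q, q'}) x \<in> nondisjoint_pairs n C"
        unfolding nondisjoint_pairs_iff[OF C] split_beta using nd by blast
    qed
    show "finite (nondisjoint_pairs n C)"
      by (rule finite_nondisjoint_pairs[OF finite_subset_square[OF C]])
  qed
  then show ?thesis by (simp add: card_cartesian_product R_def S_def)
qed

text \<open>By averaging over at least \<open>2 / 5 * n\<close> entries, some \<open>p\<close> in
  \<open>C\<close> has at most \<open>5 * \<eta> * n\<close> non-disjoint partners. Everything else
  lies in the row or the column of \<open>p\<close>. The two parts have total size at least
  \<open>29 / 100 * n\<close> but product at most \<open>\<eta> * n^2\<close>; the larger one
  exceeds \<open>n / 10\<close>, so the smaller one has at most \<open>10 * \<eta> * n\<close>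
  entries. Together this gives 15.\<close>

lemma concentrated_on_line:
  fixes n :: nat
  assumes C: "C \<subseteq> {1..n} \<times> {1..n}" and n: "n \<ge> 100" and big: "real (card C) \<ge> 2 / 5 * real n"
    and \<eta>: "\<eta> \<le> 1 / 50" and pairs: "real (card (nondisjoint_pairs n C)) \<le> \<eta> * (real n)\<^sup>2"
  shows "\<exists>L. is_line n L \<and> real (card (C - L)) \<le> 15 * \<eta> * real n"
proof -
  have finC: "finite C" by (rule finite_subset_square[OF C])
  define A where "A p = {q \<in> C. fst p \<noteq> fst q \<and> snd p \<noteq> snd q}" for p
  have "0 \<le> \<eta> * (real n)\<^sup>2" using pairs by (rule order_trans[rotated]) simp
  then have \<eta>0: "\<eta> \<ge> 0" using n by (simp add: zero_le_mult_iff)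
  have "\<exists>p\<in>C. real (card (A p)) \<le> 5 * \<eta> * real n"
  proof (rule ccontr)
    assume neg: "\<not> ?thesis"
    have "2 * \<eta> * (real n)\<^sup>2 = (2 / 5 * real n) * (5 * \<eta> * real n)" by (simp add: power2_eq_square)
    also have "\<dots> \<le> real (card C) * (5 * \<eta> * real n)" using big \<eta>0 by (intro mult_right_mono) auto
    also have "\<dots> = (\<Sum>p\<in>C. 5 * \<eta> * real n)" by simp
    also have "\<dots> < (\<Sum>p\<in>C. real (card (A p)))"
    proof (rule sum_strict_mono[OF finC])
      show "C \<noteq> {}" using big n by auto
    qed (use neg in \<open>auto simp: not_le\<close>)
    also have "\<dots> = real (\<Sum>p\<in>C. card (A p))" by simp
    also have "\<dots> \<le> real (2 * card (nondisjoint_pairs n C))"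
      unfolding A_def of_nat_le_iff by (rule card_ordered_nondisjoint_le[OF C])
    finally show False using pairs by simp
  qed
  then obtain p where p: "p \<in> C" "real (card (A p)) \<le> 5 * \<eta> * real n" by blast
  then have pin: "fst p \<in> {1..n}" "snd p \<in> {1..n}" using C by auto
  define R S where "R = {q \<in> C. fst q = fst p} - {p}" and "S = {q \<in> C. snd q = snd p} - {p}"
  have finA: "finite (A p)" "finite R" "finite S" using finC by (auto simp: A_def R_def S_def)
  have "C \<subseteq> {p} \<union> R \<union> S \<union> A p" by (auto simp: A_def R_def S_def)
  then have "card C \<le> card ({p} \<union> R \<union> S \<union> A p)" using finA by (intro card_mono) auto
  also have "\<dots> \<le> card {p} + card R + card S + card (A p)"
    by (intro order_trans[OF card_Un_le] add_right_mono order_refl)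
  finally have "real (card C) \<le> 1 + real (card R) + real (card S) + 5 * \<eta> * real n"
    using p(2) by simp
  moreover have "\<eta> * real n \<le> 1 / 50 * real n" using \<eta> by (rule mult_right_mono) simp
  moreover have "real n \<ge> 100" using n by simp
  ultimately have RS: "real (card R) + real (card S) \<ge> 29 / 100 * real n" using big by linarith
  have prod: "real (card R) * real (card S) \<le> \<eta> * (real n)\<^sup>2"
  proof -
    have "real (card R * card S) \<le> real (card (nondisjoint_pairs n C))"
      unfolding R_def S_def of_nat_le_iff by (rule card_row_col_le[OF C])
    then show ?thesis using pairs by simp
  qed
  have small: "y \<le> 10 * \<eta> * real n" if "x * y \<le> \<eta> * (real n)\<^sup>2" "x \<ge> y" "x + y \<ge> 29 / 100 * real n" "y \<ge> 0" for x y :: real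
  proof -
    have "x \<ge> real n / 10" using that by simp
    then have "real n / 10 * y \<le> x * y" using that by (intro mult_right_mono) auto
    then have "real n * y \<le> real n * (10 * \<eta> * real n)" using that(1) by (simp add: power2_eq_square algebra_simps)
    then show ?thesis using n by simp
  qed
  show ?thesis
  proof (cases "card R \<ge> card S")
    case True
    then have "real (card S) \<le> 10 * \<eta> * real n" using small[OF prod] RS by simp
    moreover have "card (C - {fst p} \<times> {1..n}) \<le> card (S \<union> A p)"
      using finA pin C by (intro card_mono) (auto simp: A_def S_def)
    moreover have "card (S \<union> A p) \<le> card S + card (A p)" by (rule card_Un_le)
    ultimately have "real (card (C - {fst p} \<times> {1..n})) \<le> 15 * \<eta> * real n" using p(2) by linarith
    moreover have "is_line n ({fst p} \<times> {1..n})" using pin by (auto simp: is_line_def)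
    ultimately show ?thesis by blast
  next
    case False
    then have "real (card R) \<le> 10 * \<eta> * real n"
      using small[of "real (card S)" "real (card R)"] prod RS by (simp add: mult.commute add.commute)
    moreover have "card (C - {1..n} \<times> {snd p}) \<le> card (R \<union> A p)"
      using finA pin C by (intro card_mono) (auto simp: A_def R_def)
    moreover have "card (R \<union> A p) \<le> card R + card (A p)" by (rule card_Un_le)
    ultimately have "real (card (C - {1..n} \<times> {snd p})) \<le> 15 * \<eta> * real n" using p(2) by linarith
    moreover have "is_line n ({1..n} \<times> {snd p})" using pin by (auto simp: is_line_def)
    ultimately show ?thesis by blast
  qed
qed

section \<open>The exactly Boolean case\<close>

text \<open>Induction on the size of \<open>I\<close>. A nonempty proper subset with equality in
  Hall's condition splits the problem into that subset and the rest with its neighbours removed. If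
  there is none, every nonempty proper subset has a neighbour to spare, so one index can be matched
  arbitrarily.\<close>

theorem hall:
  fixes S :: "'a \<Rightarrow> 'b set"
  assumes "finite I" "\<And>i. i \<in> I \<Longrightarrow> finite (S i)"
    and "\<And>J. J \<subseteq> I \<Longrightarrow> card J \<le> card (\<Union>i\<in>J. S i)"
  shows "\<exists>f. inj_on f I \<and> (\<forall>i\<in>I. f i \<in> S i)"
  using assms
proof (induction "card I" arbitrary: I S rule: less_induct)
  case less
  note finI = less.prems(1) and finS = less.prems(2) and hc = less.prems(3)
  have finU: "finite (\<Union>i\<in>J. S i)" if "J \<subseteq> I" for J
    using that finI finS by (meson finite_UN_I finite_subset subsetD)
  consider (empty) "I = {}" | (tight) J where "J \<subset> I" "J \<noteq> {}" "card J = card (\<Union>i\<in>J. S i)"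
    | (slack) "I \<noteq> {}" "\<And>J. J \<subset> I \<Longrightarrow> J \<noteq> {} \<Longrightarrow> card J < card (\<Union>i\<in>J. S i)"
    using hc by (metis le_neq_implies_less psubset_imp_subset)
  then show ?case
  proof cases
    case empty
    then show ?thesis by simp
  next
    case tight
    define T where "T = (\<Union>i\<in>J. S i)"
    have J: "finite J" "J \<subseteq> I" using tight finI finite_subset by auto
    have finT: "finite T" unfolding T_def by (rule finU[OF J(2)])
    have "card J < card I" by (rule psubset_card_mono[OF finI tight(1)])
    then have "\<exists>f. inj_on f J \<and> (\<forall>i\<in>J. f i \<in> S i)"
      using J finS hc by (intro less.hyps) auto
    then obtain f where f: "inj_on f J" "\<And>i. i \<in> J \<Longrightarrow> f i \<in> S i" by blast
    have "\<exists>g. inj_on g (I - J) \<and> (\<forall>i\<in>I - J. g i \<in> S i - T)"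
    proof (rule less.hyps)
      show "card (I - J) < card I" using tight finI by (intro psubset_card_mono) auto
      show "card K \<le> card (\<Union>i\<in>K. S i - T)" if K: "K \<subseteq> I - J" for K
      proof -
        have fK: "finite (\<Union>i\<in>K. S i - T)"
          by (rule finite_subset[of _ "\<Union>i\<in>K. S i"]) (use finU[of K] K in auto)
        have "card J + card K = card (J \<union> K)"
          using K J finI by (intro card_Un_disjoint[symmetric]) (auto intro: finite_subset)
        also have "\<dots> \<le> card (\<Union>i\<in>J \<union> K. S i)" using K J by (intro hc) auto
        also have "(\<Union>i\<in>J \<union> K. S i) = T \<union> (\<Union>i\<in>K. S i - T)" by (auto simp: T_def)
        also have "card \<dots> = card T + card (\<Union>i\<in>K. S i - T)"
          by (rule card_Un_disjoint[OF finT fK]) auto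
        finally show ?thesis using tight(3) by (simp add: T_def)
      qed
    qed (use finI finS in auto)
    then obtain g where g: "inj_on g (I - J)" "\<And>i. i \<in> I - J \<Longrightarrow> g i \<in> S i - T" by blast
    define h where "h i = (if i \<in> J then f i else g i)" for i
    have hT: "h i \<in> T \<longleftrightarrow> i \<in> J" if "i \<in> I" for i
      using that f(2)[of i] g(2)[of i] by (auto simp: h_def T_def)
    have "inj_on h I"
    proof (rule inj_onI)
      fix x y assume xy: "x \<in> I" "y \<in> I" "h x = h y"
      then have "x \<in> J \<longleftrightarrow> y \<in> J" using hT by metis
      then show "x = y" using xy inj_onD[OF f(1), of x y] inj_onD[OF g(1), of x y]
        by (cases "x \<in> J") (auto simp: h_def)
    qed
    moreover have "h i \<in> S i" if "i \<in> I" for i using that f(2)[of i] g(2)[of i] by (auto simp: h_def)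
    ultimately show ?thesis by blast
  next
    case slack
    then obtain i where i: "i \<in> I" by auto
    have "card {i} \<le> card (\<Union>i\<in>{i}. S i)" using i by (intro hc) auto
    then have "S i \<noteq> {}" by auto
    then obtain y where y: "y \<in> S i" by auto
    have "\<exists>g. inj_on g (I - {i}) \<and> (\<forall>k\<in>I - {i}. g k \<in> S k - {y})"
    proof (rule less.hyps)
      show "card (I - {i}) < card I" using i finI by (intro psubset_card_mono) auto
      show "card K \<le> card (\<Union>k\<in>K. S k - {y})" if K: "K \<subseteq> I - {i}" for K
      proof (cases "K = {}")
        case False
        have "K \<subset> I" using K i by auto
        have "card K < card (\<Union>k\<in>K. S k)" using slack(2)[OF \<open>K \<subset> I\<close> False] .
        moreover have "card (\<Union>k\<in>K. S k) - 1 \<le> card ((\<Union>k\<in>K. S k) - {y})"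
          using diff_card_le_card_Diff[of "{y}" "\<Union>k\<in>K. S k"] by simp
        ultimately have "card K \<le> card ((\<Union>k\<in>K. S k) - {y})" by linarith
        also have "(\<Union>k\<in>K. S k) - {y} = (\<Union>k\<in>K. S k - {y})" by auto
        finally show ?thesis .
      qed simp
    qed (use finI finS in auto)
    then obtain g where g: "inj_on g (I - {i})" "\<And>k. k \<in> I - {i} \<Longrightarrow> g k \<in> S k - {y}" by blast
    have "inj_on (g(i := y)) (insert i (I - {i}))"
    proof (subst inj_on_insert, intro conjI)
      have "inj_on (g(i := y)) (I - {i}) \<longleftrightarrow> inj_on g (I - {i})" by (rule inj_on_cong) simp
      with g(1) show "inj_on (g(i := y)) (I - {i})" by simp
      show "(g(i := y)) i \<notin> g(i := y) ` (I - {i} - {i})" using g(2) by force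
    qed
    moreover have "insert i (I - {i}) = I" using i by auto
    ultimately have "inj_on (g(i := y)) I" by simp
    moreover have "(g(i := y)) k \<in> S k" if "k \<in> I" for k using g(2)[of k] y that by auto
    ultimately show ?thesis by blast
  qed
qed

text \<open>
  Egervary's integral duality for the assignment problem: an integral dual solution of maximum value
  has a perfect matching of tight entries, since otherwise a Hall violator would improve it.
\<close>

lemma egervary:
  fixes w :: "nat \<Rightarrow> nat \<Rightarrow> int"
  shows "\<exists>u v. (\<forall>i\<in>{1..n}. \<forall>j\<in>{1..n}. u i + v j \<le> w i j) \<and>
    (\<exists>\<tau>\<in>sym_group n. \<forall>i\<in>{1..n}. w i (\<tau> i) = u i + v (\<tau> i))"
proof -
  define I where "I = {1..n}"
  have finI: "finite I" by (simp add: I_def)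
  define feas :: "(nat \<Rightarrow> int) \<times> (nat \<Rightarrow> int) \<Rightarrow> bool" where "feas = (\<lambda>(u, v). \<forall>i\<in>I. \<forall>j\<in>I. u i + v j \<le> w i j)"
  define val :: "(nat \<Rightarrow> int) \<times> (nat \<Rightarrow> int) \<Rightarrow> int" where "val = (\<lambda>(u, v). \<Sum>i\<in>I. u i + v i)"
  \<comment> \<open>Weak duality against the identity matching bounds \<open>val\<close> from above,
    so on feasible pairs \<open>gap\<close> is the true distance to this bound and a least
    \<open>gap\<close> means a largest \<open>val\<close>.\<close>
  define gap where "gap x = nat ((\<Sum>i\<in>I. w i i) - val x)" for x
  have val_le: "val x \<le> (\<Sum>i\<in>I. w i i)" if "feas x" for x
    using that unfolding feas_def val_def by (cases x) (auto intro: sum_mono)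
  define B where "B = (\<Sum>i\<in>I. \<Sum>j\<in>I. \<bar>w i j\<bar>)"
  have "feas (\<lambda>_. - B, \<lambda>_. 0)"
    unfolding feas_def
  proof (clarsimp)
    fix i j assume ij: "i \<in> I" "j \<in> I"
    have "\<bar>w i j\<bar> \<le> (\<Sum>j\<in>I. \<bar>w i j\<bar>)" using ij finI by (intro member_le_sum) auto
    also have "\<dots> \<le> B" unfolding B_def using ij finI
      by (intro member_le_sum[of i I "\<lambda>i. \<Sum>j\<in>I. \<bar>w i j\<bar>"]) (auto intro: sum_nonneg)
    finally show "- B \<le> w i j" by linarith
  qed
  then obtain x where x: "feas x" "\<And>y. feas y \<Longrightarrow> gap x \<le> gap y"
    using ex_has_least_nat[of feas _ gap] by blast
  obtain u v where uv: "x = (u, v)" by (cases x)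
  have feasuv: "u i + v j \<le> w i j" if "i \<in> I" "j \<in> I" for i j
    using x(1) that by (simp add: feas_def uv)
  define S where "S i = {j \<in> I. w i j = u i + v j}" for i
  have "\<exists>f. inj_on f I \<and> (\<forall>i\<in>I. f i \<in> S i)"
  proof (rule hall[OF finI])
    show "card J \<le> card (\<Union>i\<in>J. S i)" if J: "J \<subseteq> I" for J
    proof (rule ccontr)
      assume neg: "\<not> ?thesis"
      define T where "T = (\<Union>i\<in>J. S i)"
      have T: "T \<subseteq> I" by (auto simp: T_def S_def)
      define u' v' where "u' i = u i + (if i \<in> J then 1 else 0)" and "v' j = v j - (if j \<in> T then 1 else 0)" for i j
      have "feas (u', v')"
        unfolding feas_def
      proof (clarify)
        fix i j assume ij: "i \<in> I" "j \<in> I"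
        \<comment> \<open>This is where integrality enters: an entry that is not tight has slack at
          least 1, so raising \<open>u\<close> by 1 on the violator \<open>J\<close> stays feasible.
          The sum of the dual values grows by \<open>card J - card T\<close>.\<close>
        have "u i + v j \<noteq> w i j" if "i \<in> J" "j \<notin> T" using that ij by (auto simp: T_def S_def)
        then show "u' i + v' j \<le> w i j" using feasuv[OF ij] by (auto simp: u'_def v'_def)
      qed
      have "val (u', v') = val (u, v) + (\<Sum>i\<in>I. if i \<in> J then 1 else 0) - (\<Sum>j\<in>I. if j \<in> T then 1 else 0)"
        by (simp add: val_def u'_def v'_def sum.distrib sum_subtractf)
      also have "(\<Sum>i\<in>I. if i \<in> J then 1 else 0 :: int) = int (card J)"
        using J finI by (simp add: sum.If_cases Int_absorb1 Int_commute)
      also have "(\<Sum>j\<in>I. if j \<in> T then 1 else 0 :: int) = int (card T)"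
        using T finI by (simp add: sum.If_cases Int_absorb1 Int_commute)
      finally have "val (u', v') > val (u, v)" using neg by (simp add: T_def)
      then have "gap (u', v') < gap x"
        using val_le[OF \<open>feas (u', v')\<close>] by (simp add: gap_def uv)
      with x(2)[OF \<open>feas (u', v')\<close>] show False by simp
    qed
  qed (simp add: S_def finI)
  then obtain f where f: "inj_on f I" "\<And>i. i \<in> I \<Longrightarrow> f i \<in> S i" by blast
  define \<tau> where "\<tau> i = (if i \<in> I then f i else i)" for i
  have "f ` I \<subseteq> I" using f(2) by (auto simp: S_def)
  then have "bij_betw f I I" using f(1) finI by (simp add: bij_betw_def endo_inj_surj)
  then have "bij_betw \<tau> I I" by (rule bij_betw_cong[THEN iffD1, rotated]) (simp add: \<tau>_def)
  then have "\<tau> permutes I" by (rule bij_imp_permutes) (simp add: \<tau>_def)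
  then have "\<tau> \<in> sym_group n" by (simp add: sym_group_def I_def)
  moreover have "w i (\<tau> i) = u i + v (\<tau> i)" if "i \<in> I" for i
    using f(2)[OF that] that by (simp add: \<tau>_def S_def)
  ultimately show ?thesis using feasuv unfolding I_def by blast
qed

lemma weight_shift:
  assumes "\<pi> \<in> sym_group n"
  shows "weight n (\<lambda>i j. c i j + a i + b j) \<pi> = weight n c \<pi> + (\<Sum>i\<in>{1..n}. a i) + (\<Sum>j\<in>{1..n}. b j)"
  using sum_sym_group[OF assms, of b] by (simp add: weight_def sum.distrib)

text \<open>Cross differences are differences of values in {0, 1}, so integral coefficients can be
  chosen. Subtracting an optimal integral dual solution makes them nonnegative and lowers the
  function by a constant \<open>U\<close>. The tight permutation \<open>\<tau>\<close> shows that
  \<open>U\<close> is a value of the function, so \<open>U \<ge> 0\<close>; nonnegativity at the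
  zero \<open>\<sigma>\<close> gives \<open>U \<le> 0\<close>. Hence the nonnegative integral
  coefficients represent the function itself, and each is at most 1 because it is bounded by the
  value at a permutation through it. Two compatible unit entries would produce a value of at least
  2.\<close>

lemma boolean_linear_is_disjoint_union:
  assumes n: "n \<ge> 1" and bool: "\<And>\<pi>. \<pi> \<in> sym_group n \<Longrightarrow> weight n c \<pi> \<in> {0, 1}"
    and zero: "\<sigma> \<in> sym_group n" "weight n c \<sigma> = 0"
  shows "\<exists>C \<subseteq> {1..n} \<times> {1..n}. nondisjoint_pairs n C = {} \<and> (\<forall>\<pi>\<in>sym_group n. weight n c \<pi> = coset_sum C \<pi>)"
proof -
  define I where "I = {1..n}"
  have finI: "finite I" and one: "1 \<in> I" using n by (auto simp: I_def)
  have wint: "weight n c \<pi> \<in> \<int>" if "\<pi> \<in> sym_group n" for \<pi> using bool[OF that] by auto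
  have crint: "cross c i k j l \<in> \<int>" if "i \<in> I" "k \<in> I" "j \<in> I" "l \<in> I" for i k j l
  proof (cases "i = k \<or> j = l")
    case False
    then have "partial_perm n {(i, j), (k, l)}"
      using that by (auto simp: partial_perm_def inj_on_def I_def)
    then obtain \<pi> where "\<pi> \<in> extensions n {(i, j), (k, l)}" using extension_exists by blast
    then have \<pi>: "\<pi> \<in> sym_group n" "\<pi> i = j" "\<pi> k = l" by (auto simp: extensions_def)
    have ik: "i \<in> {1..n}" "k \<in> {1..n}" "i \<noteq> k" using that False by (auto simp: I_def)
    have "cross c i k j l = weight n c \<pi> - weight n c (\<pi> \<circ> Transposition.transpose i k)"
      using weight_swap[OF ik, of c \<pi>] \<pi> by simp
    also have "\<dots> \<in> \<int>"
      using wint \<pi>(1) ik by (intro Ints_diff wint sym_group_comp sym_group_transpose) auto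
    finally show ?thesis .
  qed auto
  \<comment> \<open>The total change of the function under normalisation to cross differences
    relative to \<open>(1, 1)\<close>. It is an integer because both the old and the new value at
    \<open>id\<close> are.\<close>
  define \<kappa> where "\<kappa> = (\<Sum>i\<in>I. c 1 1 - c i 1) + (\<Sum>j\<in>I. - c 1 j)"
  have idin: "id \<in> sym_group n" by (simp add: sym_group_def permutes_id)
  have d: "cross c i 1 j 1 = c i j + (c 1 1 - c i 1) + (- c 1 j)" for i j by (simp add: cross_def)
  have \<kappa>int: "\<kappa> \<in> \<int>"
  proof -
    have "\<kappa> = weight n (\<lambda>i j. cross c i 1 j 1) id - weight n c id"
      unfolding d using weight_shift[OF idin, of c "\<lambda>i. c 1 1 - c i 1" "\<lambda>j. - c 1 j"] by (simp add: \<kappa>_def I_def)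
    also have "\<dots> \<in> \<int>"
      using crint one wint[OF idin] by (intro Ints_diff) (auto simp: weight_def I_def intro!: Ints_sum)
    finally show ?thesis .
  qed
  \<comment> \<open>Row 1 contributes exactly one entry to every weight, so subtracting
    \<open>\<kappa>\<close> along that row restores the original function and keeps the coefficients
    integral.\<close>
  define c' where "c' i j = cross c i 1 j 1 - (if i = 1 then \<kappa> else 0)" for i j
  have c'w: "weight n c' \<pi> = weight n c \<pi>" if \<pi>: "\<pi> \<in> sym_group n" for \<pi>
  proof -
    have c'_eq: "c' = (\<lambda>i j. c i j + (c 1 1 - c i 1 - (if i = 1 then \<kappa> else 0)) + (- c 1 j))"
      by (auto simp: c'_def cross_def fun_eq_iff)
    have "weight n c' \<pi> = weight n c \<pi> + (\<Sum>i\<in>I. c 1 1 - c i 1 - (if i = 1 then \<kappa> else 0)) + (\<Sum>j\<in>I. - c 1 j)"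
      unfolding c'_eq I_def by (rule weight_shift[OF \<pi>])
    also have "(\<Sum>i\<in>I. c 1 1 - c i 1 - (if i = 1 then \<kappa> else 0)) = (\<Sum>i\<in>I. c 1 1 - c i 1) - \<kappa>"
      using finI one by (simp add: sum_subtractf)
    finally show ?thesis by (simp add: \<kappa>_def)
  qed
  have c'int: "c' i j \<in> \<int>" if "i \<in> I" "j \<in> I" for i j
    using crint[OF that(1) one that(2) one] \<kappa>int by (auto simp: c'_def)
  define w where "w i j = \<lfloor>c' i j\<rfloor>" for i j
  have w: "c' i j = of_int (w i j)" if "i \<in> I" "j \<in> I" for i j
    using c'int[OF that] by (auto simp: w_def elim: Ints_cases)
  obtain u v \<tau> where uv: "\<And>i j. i \<in> I \<Longrightarrow> j \<in> I \<Longrightarrow> u i + v j \<le> w i j"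
    and \<tau>: "\<tau> \<in> sym_group n" "\<And>i. i \<in> I \<Longrightarrow> w i (\<tau> i) = u i + v (\<tau> i)"
    using egervary[of n w] unfolding I_def by blast
  define e where "e i j = c' i j + - of_int (u i) + - of_int (v j)" for i j
  define U where "U = (\<Sum>i\<in>I. real_of_int (u i)) + (\<Sum>j\<in>I. real_of_int (v j))"
  have ew: "weight n e \<pi> = weight n c \<pi> - U" if \<pi>: "\<pi> \<in> sym_group n" for \<pi>
  proof -
    have "e = (\<lambda>i j. c' i j + - of_int (u i) + - of_int (v j))" by (simp add: e_def fun_eq_iff)
    then show ?thesis using weight_shift[OF \<pi>, of c' "\<lambda>i. - of_int (u i)" "\<lambda>j. - of_int (v j)"] c'w[OF \<pi>]
      by (simp add: U_def I_def sum_negf)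
  qed
  have e0: "e i j \<ge> 0" if "i \<in> I" "j \<in> I" for i j
  proof -
    have "real_of_int (u i + v j) \<le> real_of_int (w i j)" using uv[OF that] by (simp only: of_int_le_iff)
    then show ?thesis using w[OF that] by (simp add: e_def)
  qed
  have in_I: "\<pi> i \<in> I" if "\<pi> \<in> sym_group n" "i \<in> I" for \<pi> i using sym_group_in that by (simp add: I_def)
  have "weight n e \<tau> = 0"
    unfolding weight_def I_def[symmetric]
  proof (rule sum.neutral, rule ballI)
    fix i assume i: "i \<in> I"
    then show "e i (\<tau> i) = 0" using w[OF i in_I[OF \<tau>(1) i]] \<tau>(2)[OF i] by (simp add: e_def)
  qed
  then have U1: "U \<ge> 0" using ew[OF \<tau>(1)] bool[OF \<tau>(1)] by auto
  have "weight n e \<sigma> \<ge> 0"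
    unfolding weight_def I_def[symmetric] using e0 in_I[OF zero(1)] by (intro sum_nonneg) auto
  then have "U \<le> 0" using ew[OF zero(1)] zero(2) by simp
  with U1 have ec: "weight n e \<pi> = weight n c \<pi>" if "\<pi> \<in> sym_group n" for \<pi> using ew[OF that] by simp
  have e1: "e i j \<in> {0, 1}" if ij: "i \<in> I" "j \<in> I" for i j
  proof -
    have "partial_perm n {(i, j)}" using ij by (simp add: partial_perm_def I_def)
    then obtain \<pi> where "\<pi> \<in> extensions n {(i, j)}" using extension_exists by blast
    then have \<pi>: "\<pi> \<in> sym_group n" "\<pi> i = j" by (auto simp: extensions_def)
    have "e i (\<pi> i) \<le> weight n e \<pi>"
      unfolding weight_def I_def[symmetric] using e0 in_I[OF \<pi>(1)] ij finI
      by (intro member_le_sum[of i I "\<lambda>i. e i (\<pi> i)"]) auto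
    then have "e i j \<le> 1" using ec[OF \<pi>(1)] bool[OF \<pi>(1)] \<pi>(2) by auto
    moreover have "e i j \<in> \<int>" unfolding e_def using c'int[OF ij] by simp
    ultimately show ?thesis using e0[OF ij] by (auto elim!: Ints_cases)
  qed
  define C where "C = support n e"
  have Csq: "C \<subseteq> {1..n} \<times> {1..n}" unfolding C_def by (rule support_subset)
  have finC: "finite C" by (simp add: C_def)
  have eC: "weight n c \<pi> = coset_sum C \<pi>" if \<pi>: "\<pi> \<in> sym_group n" for \<pi>
  proof -
    have "weight n e \<pi> = (\<Sum>p\<in>hits C \<pi>. e (fst p) (snd p))" unfolding C_def by (rule weight_eq_sum_hits[OF \<pi>])
    also have "\<dots> = (\<Sum>p\<in>hits C \<pi>. 1)"
    proof (rule sum.cong[OF refl])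
      fix p assume "p \<in> hits C \<pi>"
      then have "fst p \<in> I" "snd p \<in> I" "e (fst p) (snd p) \<noteq> 0" by (auto simp: hits_def C_def support_def I_def)
      then show "e (fst p) (snd p) = 1" using e1 by blast
    qed
    also have "\<dots> = coset_sum C \<pi>" using finC by (simp add: coset_sum_eq_card_hits)
    finally show ?thesis using ec[OF \<pi>] by simp
  qed
  have "s \<notin> nondisjoint_pairs n C" for s
  proof
    assume s: "s \<in> nondisjoint_pairs n C"
    note pp = nondisjoint_pair_partial_perm[OF Csq s]
    obtain \<pi> where \<pi>: "\<pi> \<in> extensions n s" using extension_exists[OF pp(2)] by auto
    then have \<pi>': "\<pi> \<in> sym_group n" by (simp add: extensions_def)
    have "s \<subseteq> hits C \<pi>" using \<pi> pp(1) by (auto simp: hits_def extensions_def)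
    then have "card s \<le> card (hits C \<pi>)" using finC by (intro card_mono) (auto simp: hits_def)
    then have "coset_sum C \<pi> \<ge> 2" using pp(3) finC by (simp add: coset_sum_eq_card_hits)
    then show False using eC[OF \<pi>'] bool[OF \<pi>'] by auto
  qed
  then have "nondisjoint_pairs n C = {}" by auto
  then show ?thesis using Csq eC by blast
qed

section \<open>From the normal form to coset sums\<close>

lemma avoidable_uniform:
  "\<exists>\<delta>>0. \<delta> \<le> 1 \<and> (\<exists>n0. \<forall>n\<ge>n0. \<forall>d. real (card (support n d)) \<le> 72 * real n \<longrightarrow>
     (\<forall>i\<in>{1..n}. real (card {j \<in> {1..n}. d i j = 0}) \<ge> n / 5) \<longrightarrow>
     (\<forall>j\<in>{1..n}. real (card {i \<in> {1..n}. d i j = 0}) \<ge> n / 5) \<longrightarrow> avoidable \<delta> n (support n d))"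
proof -
  have "(1 / 5 :: real) > 0" "(72 :: real) \<ge> 0" by simp_all
  from avoidance[OF this] obtain \<delta> n0 where \<delta>: "\<delta> > 0" and av': "\<forall>n\<ge>n0. \<forall>N \<subseteq> {1..n} \<times> {1..n}. real (card N) \<le> 72 * real n \<longrightarrow>
     (\<forall>i\<in>{1..n}. real (card {j \<in> {1..n}. (i, j) \<notin> N}) \<ge> 1 / 5 * real n) \<longrightarrow>
     (\<forall>j\<in>{1..n}. real (card {i \<in> {1..n}. (i, j) \<notin> N}) \<ge> 1 / 5 * real n) \<longrightarrow>
     (\<forall>s \<subseteq> N. partial_perm n s \<longrightarrow> card s \<le> 2 \<longrightarrow>
       real (card {\<pi> \<in> sym_group n. hits N \<pi> = s}) \<ge> \<delta> * fact (n - card s))"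
    by blast
  note av = av'[rule_format]
  \<comment> \<open>Capping the fraction at 1 ensures later that an error of at most
    \<open>\<delta> / 100\<close> is also at most 1/100.\<close>
  have "avoidable (min \<delta> 1) n (support n d)"
    if n: "n \<ge> n0" and few: "real (card (support n d)) \<le> 72 * real n"
      and row: "\<forall>i\<in>{1..n}. real (card {j \<in> {1..n}. d i j = 0}) \<ge> n / 5"
      and col: "\<forall>j\<in>{1..n}. real (card {i \<in> {1..n}. d i j = 0}) \<ge> n / 5" for n d
  proof -
    have "{j \<in> {1..n}. (i, j) \<notin> support n d} = {j \<in> {1..n}. d i j = 0}" if "i \<in> {1..n}" for i
      using that by (auto simp: support_def)
    then have row': "1 / 5 * real n \<le> real (card {j \<in> {1..n}. (i, j) \<notin> support n d})" if "i \<in> {1..n}" for i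
      using row that by simp
    have "{i \<in> {1..n}. (i, j) \<notin> support n d} = {i \<in> {1..n}. d i j = 0}" if "j \<in> {1..n}" for j
      using that by (auto simp: support_def)
    then have col': "1 / 5 * real n \<le> real (card {i \<in> {1..n}. (i, j) \<notin> support n d})" if "j \<in> {1..n}" for j
      using col that by simp
    show ?thesis
      unfolding avoidable_def
    proof (intro allI impI)
      fix s assume s: "s \<subseteq> support n d" "partial_perm n s" "card s \<le> 2"
      have "min \<delta> 1 * fact (n - card s) \<le> \<delta> * fact (n - card s)" by (intro mult_right_mono) auto
      also have "\<dots> \<le> real (card {\<pi> \<in> sym_group n. hits (support n d) \<pi> = s})"
        by (rule av[OF n support_subset few row' col' s])
      finally show "min \<delta> 1 * fact (n - card s) \<le> real (card {\<pi> \<in> sym_group n. hits (support n d) \<pi> = s})" .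
    qed
  qed
  then show ?thesis using \<delta> by (intro exI[of _ "min \<delta> 1"] conjI exI[of _ n0]) auto
qed

text \<open>
  If \<open>f = 1 - g\<close> with \<open>g\<close> close to the sum over \<open>C\<close>, then \<open>g\<close> is nonzero on a constant fraction of
  the permutations, so \<open>C\<close> is large; having few non-disjoint pairs it is concentrated on a line
  \<open>L\<close>, and \<open>f\<close> is close to the sum over \<open>L - C\<close>.
\<close>

lemma complement_structure:
  fixes n :: nat
  assumes n: "n \<ge> 100" and \<eta>: "\<eta> \<le> 1 / 50" and \<epsilon>: "\<epsilon> \<le> 1 / 50"
    and C: "C \<subseteq> {1..n} \<times> {1..n}" and pairs: "real (card (nondisjoint_pairs n C)) \<le> \<eta> * (real n)\<^sup>2"
    and close: "real (card {\<pi> \<in> sym_group n. 1 - f \<pi> \<noteq> coset_sum C \<pi>}) \<le> \<eta> * fact n"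
    and bool: "real (card {\<pi> \<in> sym_group n. f \<pi> \<notin> {0, 1}}) \<le> \<epsilon> * fact n"
    and half: "real (card {\<pi> \<in> sym_group n. f \<pi> = 1}) \<le> fact n / 2"
  shows "\<exists>C' \<subseteq> {1..n} \<times> {1..n}. card C' \<le> n \<and> nondisjoint_pairs n C' = {} \<and>
    real (card {\<pi> \<in> sym_group n. f \<pi> \<noteq> coset_sum C' \<pi>}) \<le> 16 * \<eta> * fact n"
proof -
  have finC: "finite C" by (rule finite_subset_square[OF C])
  have f1: "(fact n :: real) = real n * fact (n - 1)" using n by (intro fact_reduce) simp
  \<comment> \<open>Where \<open>f\<close> is 0 or 1, agrees with 1 minus the sum over
    \<open>C\<close>, and \<open>C\<close> is not hit, the value is 1. Since that happens on at most
    half of the permutations, those hitting \<open>C\<close> make up at least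
    \<open>1/2 - 1/50 - 1/50\<close>, more than 2/5, and each entry of \<open>C\<close> accounts for
    at most \<open>(n - 1)!\<close> of them.\<close>
  have "sym_group n \<subseteq> {\<pi> \<in> sym_group n. f \<pi> = 1} \<union> {\<pi> \<in> sym_group n. f \<pi> \<notin> {0, 1}} \<union>
      {\<pi> \<in> sym_group n. 1 - f \<pi> \<noteq> coset_sum C \<pi>} \<union> {\<pi> \<in> sym_group n. hits C \<pi> \<noteq> {}}"
    using finC by (auto simp: coset_sum_eq_card_hits)
  then have "card (sym_group n) \<le> card ({\<pi> \<in> sym_group n. f \<pi> = 1} \<union> {\<pi> \<in> sym_group n. f \<pi> \<notin> {0, 1}} \<union>
      {\<pi> \<in> sym_group n. 1 - f \<pi> \<noteq> coset_sum C \<pi>} \<union> {\<pi> \<in> sym_group n. hits C \<pi> \<noteq> {}})"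
    by (intro card_mono) auto
  also have "\<dots> \<le> card {\<pi> \<in> sym_group n. f \<pi> = 1} + card {\<pi> \<in> sym_group n. f \<pi> \<notin> {0, 1}} +
      card {\<pi> \<in> sym_group n. 1 - f \<pi> \<noteq> coset_sum C \<pi>} + card {\<pi> \<in> sym_group n. hits C \<pi> \<noteq> {}}"
    by (intro order_trans[OF card_Un_le] add_right_mono order_refl)
  also have "\<dots> \<le> card {\<pi> \<in> sym_group n. f \<pi> = 1} + card {\<pi> \<in> sym_group n. f \<pi> \<notin> {0, 1}} +
      card {\<pi> \<in> sym_group n. 1 - f \<pi> \<noteq> coset_sum C \<pi>} + card C * fact (n - 1)"
    by (intro add_left_mono card_hitting_le C)
  finally have "real (fact n) \<le> real (card {\<pi> \<in> sym_group n. f \<pi> = 1} + card {\<pi> \<in> sym_group n. f \<pi> \<notin> {0, 1}} +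
      card {\<pi> \<in> sym_group n. 1 - f \<pi> \<noteq> coset_sum C \<pi>} + card C * fact (n - 1))"
    unfolding card_sym_group of_nat_le_iff .
  then have "fact n \<le> fact n / 2 + \<epsilon> * fact n + \<eta> * fact n + real (card C) * fact (n - 1)"
    using half bool close by simp
  moreover have "\<epsilon> * fact n \<le> 1 / 50 * fact n" "\<eta> * fact n \<le> 1 / 50 * fact n"
    using \<epsilon> \<eta> by (simp_all only: mult_right_mono fact_ge_zero)
  ultimately have "2 / 5 * fact n \<le> real (card C) * fact (n - 1)"
    using fact_ge_zero[of n, where 'a = real] by linarith
  then have "(2 / 5 * real n) * fact (n - 1) \<le> real (card C) * fact (n - 1)" by (simp add: f1 mult.assoc)
  then have big: "2 / 5 * real n \<le> real (card C)" by (rule mult_right_le_imp_le) simp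
  obtain L where L: "is_line n L" and CL: "real (card (C - L)) \<le> 15 * \<eta> * real n"
    using concentrated_on_line[OF C n big \<eta> pairs] by blast
  define C' where "C' = L - C"
  note lf = line_facts[OF L]
  have finL: "finite L" by (rule finite_subset_square[OF lf(1)])
  \<comment> \<open>A permutation hits the line exactly once. If it hits no entry of
    \<open>C\<close> off the line, its hits of \<open>C\<close> and of \<open>C'\<close> add up to
    1. The two exceptional sets have proportions \<open>\<eta>\<close> and
    \<open>15 * \<eta>\<close>, hence the factor 16.\<close>
  have "{\<pi> \<in> sym_group n. f \<pi> \<noteq> coset_sum C' \<pi>} \<subseteq>
      {\<pi> \<in> sym_group n. 1 - f \<pi> \<noteq> coset_sum C \<pi>} \<union> {\<pi> \<in> sym_group n. hits (C - L) \<pi> \<noteq> {}}"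
  proof (rule subsetI, rule ccontr)
    fix \<pi> assume "\<pi> \<in> {\<pi> \<in> sym_group n. f \<pi> \<noteq> coset_sum C' \<pi>}"
      and "\<pi> \<notin> {\<pi> \<in> sym_group n. 1 - f \<pi> \<noteq> coset_sum C \<pi>} \<union> {\<pi> \<in> sym_group n. hits (C - L) \<pi> \<noteq> {}}"
    then have \<pi>: "\<pi> \<in> sym_group n" "f \<pi> \<noteq> coset_sum C' \<pi>" "1 - f \<pi> = coset_sum C \<pi>" "hits (C - L) \<pi> = {}" by auto
    have "hits L \<pi> = hits C \<pi> \<union> hits C' \<pi>" "hits C \<pi> \<inter> hits C' \<pi> = {}"
      using \<pi>(4) unfolding hits_def C'_def by blast+
    then have "card (hits L \<pi>) = card (hits C \<pi>) + card (hits C' \<pi>)"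
      using finC finL by (simp add: card_Un_disjoint hits_def C'_def)
    then have "1 = real (card (hits C \<pi>)) + real (card (hits C' \<pi>))" using lf(3)[OF \<pi>(1)] by linarith
    then show False using \<pi> finC finL by (simp add: coset_sum_eq_card_hits C'_def)
  qed
  then have "card {\<pi> \<in> sym_group n. f \<pi> \<noteq> coset_sum C' \<pi>} \<le>
      card ({\<pi> \<in> sym_group n. 1 - f \<pi> \<noteq> coset_sum C \<pi>} \<union> {\<pi> \<in> sym_group n. hits (C - L) \<pi> \<noteq> {}})"
    by (intro card_mono) auto
  also have "\<dots> \<le> card {\<pi> \<in> sym_group n. 1 - f \<pi> \<noteq> coset_sum C \<pi>} + card {\<pi> \<in> sym_group n. hits (C - L) \<pi> \<noteq> {}}"
    by (rule card_Un_le)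
  also have "\<dots> \<le> card {\<pi> \<in> sym_group n. 1 - f \<pi> \<noteq> coset_sum C \<pi>} + card (C - L) * fact (n - 1)"
    by (intro add_left_mono card_hitting_le) (use C in auto)
  finally have "real (card {\<pi> \<in> sym_group n. f \<pi> \<noteq> coset_sum C' \<pi>}) \<le>
      real (card {\<pi> \<in> sym_group n. 1 - f \<pi> \<noteq> coset_sum C \<pi>} + card (C - L) * fact (n - 1))"
    by (simp only: of_nat_le_iff)
  also have "\<dots> \<le> \<eta> * fact n + real (card (C - L)) * fact (n - 1)" using close by simp
  also have "\<dots> \<le> \<eta> * fact n + (15 * \<eta> * real n) * fact (n - 1)"
    using CL by (intro add_left_mono mult_right_mono) auto
  also have "\<dots> = 16 * \<eta> * fact n" by (simp add: f1)
  finally have "real (card {\<pi> \<in> sym_group n. f \<pi> \<noteq> coset_sum C' \<pi>}) \<le> 16 * \<eta> * fact n" .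
  moreover have "C' \<subseteq> {1..n} \<times> {1..n}" "nondisjoint_pairs n C' = {}" using lf(1,4) by (auto simp: C'_def)
  moreover have "card C' \<le> n" using card_mono[OF finL, of C'] lf(2) by (simp add: C'_def)
  ultimately show ?thesis by blast
qed

lemma large_n_structure:
  "\<exists>K>0. \<exists>\<epsilon>0>0. \<exists>n0. \<forall>n\<ge>n0. \<forall>\<epsilon> c. \<epsilon> \<le> \<epsilon>0 \<longrightarrow> real (defect n c) \<le> \<epsilon> * fact n \<longrightarrow>
     real (card {\<pi> \<in> sym_group n. weight n c \<pi> = 1}) \<le> fact n / 2 \<longrightarrow>
     (\<exists>C \<subseteq> {1..n} \<times> {1..n}. real (card C) \<le> K * real n \<and>
        real (card (nondisjoint_pairs n C)) \<le> K * \<epsilon> * (real n)\<^sup>2 \<and>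
        real (card {\<pi> \<in> sym_group n. weight n c \<pi> \<noteq> coset_sum C \<pi>}) \<le> K * \<epsilon> * fact n)"
proof -
  obtain \<delta> n1 where \<delta>: "\<delta> > 0" "\<delta> \<le> 1" and av: "\<And>n d. n \<ge> n1 \<Longrightarrow> real (card (support n d)) \<le> 72 * real n \<Longrightarrow>
     (\<And>i. i \<in> {1..n} \<Longrightarrow> real (card {j \<in> {1..n}. d i j = 0}) \<ge> n / 5) \<Longrightarrow>
     (\<And>j. j \<in> {1..n} \<Longrightarrow> real (card {i \<in> {1..n}. d i j = 0}) \<ge> n / 5) \<Longrightarrow> avoidable \<delta> n (support n d)"
    using avoidable_uniform by blast
  define K where "K = 72 + 16 / \<delta>"
  \<comment> \<open>Small enough for three purposes: the defect is at most
    \<open>fact n / 100\<close> as the normal form demands, \<open>\<epsilon> / \<delta>\<close> is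
    at most 1/50 as concentration on a line demands, and \<open>\<epsilon> < \<delta>\<close>
    decides the additive constant.\<close>
  define \<epsilon>0 where "\<epsilon>0 = \<delta> / 100"
  have "1 / \<delta> > 0" using \<delta> by simp
  then have K: "K > 0" "K \<ge> 72" "K \<ge> 1 / \<delta>" "K \<ge> 16 / \<delta>" unfolding K_def by linarith+
  have "\<exists>C \<subseteq> {1..n} \<times> {1..n}. real (card C) \<le> K * real n \<and>
        real (card (nondisjoint_pairs n C)) \<le> K * \<epsilon> * (real n)\<^sup>2 \<and>
        real (card {\<pi> \<in> sym_group n. weight n c \<pi> \<noteq> coset_sum C \<pi>}) \<le> K * \<epsilon> * fact n"
    if n: "n \<ge> max n1 1000" and \<epsilon>: "\<epsilon> \<le> \<epsilon>0" and D: "real (defect n c) \<le> \<epsilon> * fact n"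
      and half: "real (card {\<pi> \<in> sym_group n. weight n c \<pi> = 1}) \<le> fact n / 2" for n \<epsilon> c
  proof -
    have n': "n \<ge> n1" "n \<ge> 1000" "n \<ge> 2" "n \<ge> 100" using n by auto
    have "0 * fact n \<le> \<epsilon> * fact n" using D by (rule order_trans[rotated]) simp
    then have \<epsilon>_ge: "\<epsilon> \<ge> 0" by (rule mult_right_le_imp_le) simp
    have \<epsilon>s: "\<epsilon> \<le> 1 / 100" "\<epsilon> / \<delta> \<le> 1 / 100" "\<epsilon> < \<delta>" using \<epsilon> \<delta> by (auto simp: \<epsilon>0_def pos_divide_le_eq)
    have K\<epsilon>: "\<epsilon> / \<delta> \<le> K * \<epsilon>" "16 * (\<epsilon> / \<delta>) \<le> K * \<epsilon>"
      using mult_right_mono[OF K(3) \<epsilon>_ge] mult_right_mono[OF K(4) \<epsilon>_ge] by auto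
    have "\<epsilon> * fact n \<le> 1 / 100 * fact n" using \<epsilon>s(1) by (rule mult_right_mono) simp
    then have D': "real (defect n c) \<le> fact n / 100" using D by linarith
    obtain a b where ab: "real (card {(i, j). i \<in> {1..n} \<and> j \<in> {1..n} \<and> c i j + a i + b j \<noteq> 0}) \<le> 72 * real n"
      "\<And>i. i \<in> {1..n} \<Longrightarrow> real (card {j \<in> {1..n}. c i j + a i + b j = 0}) \<ge> n / 5"
      "\<And>j. j \<in> {1..n} \<Longrightarrow> real (card {i \<in> {1..n}. c i j + a i + b j = 0}) \<ge> n / 5"
      using normal_form[OF n'(2) D'] by blast
    define d where "d i j = c i j + a i + b j" for i j
    have d_eq: "d = (\<lambda>i j. c i j + a i + b j)" by (simp add: d_def fun_eq_iff)
    define \<kappa> where "\<kappa> = - (\<Sum>i\<in>{1..n}. a i) - (\<Sum>j\<in>{1..n}. b j)"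
    have w: "weight n c \<pi> = \<kappa> + weight n d \<pi>" if "\<pi> \<in> sym_group n" for \<pi>
      unfolding d_eq \<kappa>_def weight_shift[OF that, of c a b] by simp
    have few: "real (card (support n d)) \<le> 72 * real n"
      using ab(1) by (simp only: support_def d_def)
    have avd: "avoidable \<delta> n (support n d)"
      by (rule av[OF n'(1) few]) (use ab(2,3) in \<open>simp_all only: d_def\<close>)
    have bad: "card {\<pi> \<in> sym_group n. \<kappa> + weight n d \<pi> \<notin> {0, 1}} = defect n c"
      unfolding defect_def by (rule arg_cong[of _ _ card]) (auto simp: w)
    \<comment> \<open>The empty pattern: on at least \<open>\<delta> * fact n\<close> permutations
      no entry of the support is hit and the value is \<open>\<kappa>\<close> itself.\<close>
    have "\<kappa> \<in> {0, 1}"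
    proof (rule ccontr)
      assume "\<kappa> \<notin> {0, 1}"
      then have "real (card {{} :: (nat \<times> nat) set}) * (\<delta> * fact (n - 0)) \<le> real (defect n c)"
        unfolding bad[symmetric] by (intro card_bad_family_le[OF avd]) (auto simp: partial_perm_def)
      then have "\<delta> * fact n \<le> real (defect n c)" by simp
      then have "\<delta> * fact n \<le> \<epsilon> * fact n" using D by (rule order_trans)
      then have "\<delta> \<le> \<epsilon>" by (rule mult_right_le_imp_le) simp
      then show False using \<epsilon>s(3) by simp
    qed
    then consider "\<kappa> = 0" | "\<kappa> = 1" by auto
    then show ?thesis
    proof cases
      case 1
      define C where "C = {(i, j). i \<in> {1..n} \<and> j \<in> {1..n} \<and> d i j = 1}"
      have "real (defect n d) \<le> \<epsilon> * fact n"
        using D bad 1 by (simp add: defect_def)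
      note st = unit_entries_structure[OF n'(3) \<delta>(1) avd this C_def]
      have "card C \<le> card (support n d)" by (rule card_mono[OF finite_support]) (auto simp: C_def support_def)
      then have "real (card C) \<le> 72 * real n" using few by linarith
      also have "\<dots> \<le> K * real n" using K(2) by (rule mult_right_mono) simp
      finally have "real (card C) \<le> K * real n" .
      moreover have "{\<pi> \<in> sym_group n. weight n c \<pi> \<noteq> coset_sum C \<pi>} = {\<pi> \<in> sym_group n. weight n d \<pi> \<noteq> coset_sum C \<pi>}"
        using w 1 by auto
      moreover have "\<epsilon> / \<delta> * (real n)\<^sup>2 \<le> K * \<epsilon> * (real n)\<^sup>2" using K\<epsilon>(1) by (rule mult_right_mono) simp
      moreover have "\<epsilon> / \<delta> * fact n \<le> K * \<epsilon> * fact n" using K\<epsilon>(1) by (rule mult_right_mono) simp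
      ultimately show ?thesis
        using st by (intro exI[of _ C] conjI) (auto simp: C_def)
    next
      case 2
      define d' where "d' i j = - d i j" for i j
      have wd': "weight n d' \<pi> = 1 - weight n c \<pi>" if "\<pi> \<in> sym_group n" for \<pi>
        using w[OF that] 2 by (simp add: weight_def d'_def sum_negf)
      have supp: "support n d' = support n d" by (simp add: support_def d'_def)
      define C where "C = {(i, j). i \<in> {1..n} \<and> j \<in> {1..n} \<and> d' i j = 1}"
      have Csq: "C \<subseteq> {1..n} \<times> {1..n}" by (auto simp: C_def)
      have "defect n d' = defect n c"
        unfolding defect_def by (rule arg_cong[of _ _ card]) (auto simp: wd')
      then have "real (defect n d') \<le> \<epsilon> * fact n" using D by simp
      note st = unit_entries_structure[OF n'(3) \<delta>(1) avd[folded supp] this C_def]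
      have "{\<pi> \<in> sym_group n. 1 - weight n c \<pi> \<noteq> coset_sum C \<pi>} = {\<pi> \<in> sym_group n. weight n d' \<pi> \<noteq> coset_sum C \<pi>}"
        using wd' by auto
      then have close: "real (card {\<pi> \<in> sym_group n. 1 - weight n c \<pi> \<noteq> coset_sum C \<pi>}) \<le> \<epsilon> / \<delta> * fact n"
        using st(2) by simp
      obtain C' where C': "C' \<subseteq> {1..n} \<times> {1..n}" "card C' \<le> n" "nondisjoint_pairs n C' = {}"
        "real (card {\<pi> \<in> sym_group n. weight n c \<pi> \<noteq> coset_sum C' \<pi>}) \<le> 16 * (\<epsilon> / \<delta>) * fact n"
        using complement_structure[OF n'(4) _ _ Csq st(1) close D[unfolded defect_def] half] \<epsilon>s by auto
      have "1 * real n \<le> K * real n" using K(2) by (intro mult_right_mono) auto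
      then have "real (card C') \<le> K * real n" using C'(2) by simp
      moreover have "16 * (\<epsilon> / \<delta>) * fact n \<le> K * \<epsilon> * fact n" using K\<epsilon>(2) by (rule mult_right_mono) simp
      moreover have "0 \<le> K * \<epsilon> * (real n)\<^sup>2" using K \<epsilon>_ge by simp
      ultimately show ?thesis using C' by (intro exI[of _ C'] conjI) auto
    qed
  qed
  note main = this
  have \<epsilon>0: "\<epsilon>0 > 0" using \<delta> by (simp add: \<epsilon>0_def)
  show ?thesis
    by (rule exI[of _ K], rule conjI, rule K(1), rule exI[of _ \<epsilon>0], rule conjI, rule \<epsilon>0,
        rule exI[of _ "max n1 1000"], intro allI impI, rule main)
qed

section \<open>Passage to probabilities and the two directions\<close>

lemma perm_prob_fact: "perm_prob n P = card {\<pi> \<in> sym_group n. P \<pi>} / fact n"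
  by (simp add: perm_prob_eq_card card_sym_group)

lemma linear_eq_weight:
  assumes "linear_on_perms n f"
  obtains c where "\<And>\<pi>. \<pi> \<in> sym_group n \<Longrightarrow> f \<pi> = weight n c \<pi>"
proof -
  obtain c where c: "\<forall>\<pi> \<in> sym_group n. f \<pi> = (\<Sum>i\<in>{1..n}. \<Sum>j\<in>{1..n}. c i j * entry i j \<pi>)"
    using assms unfolding linear_on_perms_def by blast
  have "f \<pi> = weight n c \<pi>" if \<pi>: "\<pi> \<in> sym_group n" for \<pi>
  proof -
    have "(\<Sum>j\<in>{1..n}. c i j * entry i j \<pi>) = c i (\<pi> i)" if "i \<in> {1..n}" for i
      using sym_group_in[OF \<pi> that] by (simp add: entry_def if_distrib cong: if_cong)
    then show ?thesis using c \<pi> by (simp add: weight_def)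
  qed
  then show thesis by (rule that)
qed

lemma nearly_boolean_linear_structure:
  "\<exists>K::real. K > 0 \<and>
     (\<forall>(n::nat) (\<epsilon>::real) (f :: (nat \<Rightarrow> nat) \<Rightarrow> real).
        n \<ge> 1 \<longrightarrow> \<epsilon> \<ge> 0 \<longrightarrow> linear_on_perms n f \<longrightarrow>
        perm_prob n (\<lambda>\<pi>. f \<pi> \<notin> {0, 1}) \<le> \<epsilon> \<longrightarrow>
        perm_prob n (\<lambda>\<pi>. f \<pi> = 1) \<le> 1 / 2 \<longrightarrow>
        (\<exists>C \<subseteq> {1..n} \<times> {1..n}.
           real (card C) \<le> K * real n \<and>
           real (card (nondisjoint_pairs n C)) \<le> K * \<epsilon> * (real n)\<^sup>2 \<and>
           perm_prob n (\<lambda>\<pi>. f \<pi> \<noteq> coset_sum C \<pi>) \<le> K * \<epsilon>))"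
proof -
  obtain K1 \<epsilon>0 :: real and n0 where K1: "K1 > 0" and \<epsilon>0: "\<epsilon>0 > 0" and large': "\<forall>n\<ge>n0. \<forall>\<epsilon> c. \<epsilon> \<le> \<epsilon>0 \<longrightarrow>
     real (defect n c) \<le> \<epsilon> * fact n \<longrightarrow> real (card {\<pi> \<in> sym_group n. weight n c \<pi> = 1}) \<le> fact n / 2 \<longrightarrow>
     (\<exists>C \<subseteq> {1..n} \<times> {1..n}. real (card C) \<le> K1 * real n \<and>
        real (card (nondisjoint_pairs n C)) \<le> K1 * \<epsilon> * (real n)\<^sup>2 \<and>
        real (card {\<pi> \<in> sym_group n. weight n c \<pi> \<noteq> coset_sum C \<pi>}) \<le> K1 * \<epsilon> * fact n)"
    using large_n_structure by blast
  note large = large'[rule_format]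
  \<comment> \<open>Errors of at least \<open>\<epsilon>1\<close> are settled by the empty family,
    because then \<open>K * \<epsilon> \<ge> 1\<close>. Below \<open>\<epsilon>1\<close> and for
    \<open>n < n0\<close>, fewer than one permutation is non-Boolean, so there is none.\<close>
  define \<epsilon>1 where "\<epsilon>1 = min \<epsilon>0 (1 / (2 * fact n0))"
  have \<epsilon>1: "\<epsilon>1 > 0" using \<epsilon>0 by (simp add: \<epsilon>1_def)
  \<comment> \<open>The three summands serve large \<open>n\<close>, large errors, and the size of
    the family for \<open>n < n0\<close>, where \<open>n * n \<le> n0 * n\<close>.\<close>
  define K where "K = K1 + 1 / \<epsilon>1 + real n0"
  have K: "K > 0" "K \<ge> K1" "K \<ge> 1 / \<epsilon>1" "K \<ge> real n0" using K1 \<epsilon>1 by (auto simp: K_def add_pos_nonneg add_increasing add_increasing2)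
  have "\<exists>C \<subseteq> {1..n} \<times> {1..n}. real (card C) \<le> K * real n \<and>
      real (card (nondisjoint_pairs n C)) \<le> K * \<epsilon> * (real n)\<^sup>2 \<and>
      perm_prob n (\<lambda>\<pi>. f \<pi> \<noteq> coset_sum C \<pi>) \<le> K * \<epsilon>"
    if n: "n \<ge> 1" and \<epsilon>: "\<epsilon> \<ge> 0" and lin: "linear_on_perms n f"
      and bool: "perm_prob n (\<lambda>\<pi>. f \<pi> \<notin> {0, 1}) \<le> \<epsilon>" and half: "perm_prob n (\<lambda>\<pi>. f \<pi> = 1) \<le> 1 / 2" for n \<epsilon> f
  proof (cases "\<epsilon> \<ge> \<epsilon>1")
    case True
    have "1 \<le> 1 / \<epsilon>1 * \<epsilon>" using True \<epsilon>1 by simp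
    also have "\<dots> \<le> K * \<epsilon>" using K(3) \<epsilon> by (rule mult_right_mono)
    finally have "perm_prob n (\<lambda>\<pi>. f \<pi> \<noteq> coset_sum {} \<pi>) \<le> K * \<epsilon>"
      unfolding perm_prob_def by (rule order_trans[rotated]) (rule measure_pmf.prob_le_1)
    moreover have "nondisjoint_pairs n {} = {}" by (simp add: nondisjoint_pairs_def)
    ultimately show ?thesis using K(1) \<epsilon> by (intro exI[of _ "{}"]) auto
  next
    case False
    obtain c where c: "\<And>\<pi>. \<pi> \<in> sym_group n \<Longrightarrow> f \<pi> = weight n c \<pi>" using linear_eq_weight[OF lin] by blast
    have "{\<pi> \<in> sym_group n. f \<pi> \<notin> {0, 1}} = {\<pi> \<in> sym_group n. weight n c \<pi> \<notin> {0, 1}}" using c by auto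
    then have D: "real (defect n c) \<le> \<epsilon> * fact n"
      using bool unfolding perm_prob_fact defect_def by (simp add: pos_divide_le_eq)
    have "{\<pi> \<in> sym_group n. f \<pi> = 1} = {\<pi> \<in> sym_group n. weight n c \<pi> = 1}" using c by auto
    then have half': "real (card {\<pi> \<in> sym_group n. weight n c \<pi> = 1}) \<le> fact n / 2"
      using half unfolding perm_prob_fact by (simp add: pos_divide_le_eq)
    have prob: "perm_prob n (\<lambda>\<pi>. f \<pi> \<noteq> coset_sum C \<pi>) = card {\<pi> \<in> sym_group n. weight n c \<pi> \<noteq> coset_sum C \<pi>} / fact n" for C
    proof -
      have "{\<pi> \<in> sym_group n. f \<pi> \<noteq> coset_sum C \<pi>} = {\<pi> \<in> sym_group n. weight n c \<pi> \<noteq> coset_sum C \<pi>}" using c by auto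
      then show ?thesis by (simp only: perm_prob_fact)
    qed
    show ?thesis
    proof (cases "n \<ge> n0")
      case True
      have "\<epsilon> \<le> \<epsilon>0" using False by (simp add: \<epsilon>1_def)
      then obtain C where C: "C \<subseteq> {1..n} \<times> {1..n}" "real (card C) \<le> K1 * real n"
        "real (card (nondisjoint_pairs n C)) \<le> K1 * \<epsilon> * (real n)\<^sup>2"
        "real (card {\<pi> \<in> sym_group n. weight n c \<pi> \<noteq> coset_sum C \<pi>}) \<le> K1 * \<epsilon> * fact n"
        using large[OF True _ D half'] by blast
      have "K1 * real n \<le> K * real n" using K(2) by (rule mult_right_mono) simp
      moreover have "K1 * \<epsilon> \<le> K * \<epsilon>" using K(2) \<epsilon> by (rule mult_right_mono)
      moreover from this have "K1 * \<epsilon> * (real n)\<^sup>2 \<le> K * \<epsilon> * (real n)\<^sup>2" by (rule mult_right_mono) simp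
      moreover have "perm_prob n (\<lambda>\<pi>. f \<pi> \<noteq> coset_sum C \<pi>) \<le> K1 * \<epsilon>"
        unfolding prob using C(4) by (simp add: pos_divide_le_eq)
      ultimately show ?thesis using C by (intro exI[of _ C] conjI) auto
    next
      case n_small: False
      have "real (defect n c) \<le> \<epsilon> * fact n" by (rule D)
      also have "\<dots> \<le> \<epsilon> * fact n0" using n_small \<epsilon> by (intro mult_left_mono fact_mono) auto
      also have "\<dots> \<le> 1 / (2 * fact n0) * fact n0" using False by (intro mult_right_mono) (auto simp: \<epsilon>1_def)
      also have "\<dots> < 1" by simp
      finally have "defect n c = 0" by simp
      then have bool': "weight n c \<pi> \<in> {0, 1}" if "\<pi> \<in> sym_group n" for \<pi>
        using that unfolding defect_def by (auto simp: card_eq_0_iff)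
      have "\<exists>\<sigma>\<in>sym_group n. weight n c \<sigma> \<noteq> 1"
      proof (rule ccontr)
        assume "\<not> ?thesis"
        then have "{\<pi> \<in> sym_group n. weight n c \<pi> = 1} = sym_group n" by auto
        then show False using half' by (simp add: card_sym_group)
      qed
      then obtain \<sigma> where \<sigma>: "\<sigma> \<in> sym_group n" "weight n c \<sigma> = 0" using bool' by blast
      obtain C where C: "C \<subseteq> {1..n} \<times> {1..n}" "nondisjoint_pairs n C = {}" "\<forall>\<pi>\<in>sym_group n. weight n c \<pi> = coset_sum C \<pi>"
        using boolean_linear_is_disjoint_union[OF n bool' \<sigma>] by blast
      have "card C \<le> card ({1..n} \<times> {1..n})" using C(1) by (intro card_mono) auto
      also have "\<dots> = n * n" by (simp add: card_cartesian_product)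
      finally have "real (card C) \<le> real (n * n)" by (simp only: of_nat_le_iff)
      also have "\<dots> \<le> K * real n" using K(4) n_small unfolding of_nat_mult by (intro mult_right_mono) auto
      finally have "real (card C) \<le> K * real n" .
      moreover have "perm_prob n (\<lambda>\<pi>. f \<pi> \<noteq> coset_sum C \<pi>) = 0"
      proof -
        have "{\<pi> \<in> sym_group n. weight n c \<pi> \<noteq> coset_sum C \<pi>} = {}" using C(3) by auto
        then show ?thesis unfolding prob by (simp only: card.empty)
      qed
      ultimately show ?thesis using C K(1) \<epsilon> by (intro exI[of _ C] conjI) auto
    qed
  qed
  then show ?thesis using K(1) by blast
qed

text \<open>A value other than 0 and 1 means at least two hits, and two hits of one permutation are
  a non-disjoint pair since that permutation lies in both cosets. In the union bound each pair has
  probability \<open>1 / (n * (n - 1))\<close>, which is at most \<open>2 / n^2\<close>.\<close>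

lemma few_nondisjoint_pairs_imp_nearly_boolean:
  assumes C: "C \<subseteq> {1..n} \<times> {1..n}" and pairs: "real (card (nondisjoint_pairs n C)) \<le> A * \<epsilon> * (real n)\<^sup>2"
    and A: "A > 0" "\<epsilon> \<ge> 0"
  shows "perm_prob n (\<lambda>\<pi>. coset_sum C \<pi> \<notin> {0, 1}) \<le> 2 * A * \<epsilon>"
proof -
  have finC: "finite C" by (rule finite_subset_square[OF C])
  define X where "X = {\<pi> \<in> sym_group n. coset_sum C \<pi> \<notin> {0, 1}}"
  have two: "\<exists>s\<in>nondisjoint_pairs n C. \<pi> \<in> extensions n s" if \<pi>: "\<pi> \<in> X" for \<pi>
  proof -
    have \<pi>': "\<pi> \<in> sym_group n" and "coset_sum C \<pi> \<notin> {0, 1}" using \<pi> by (auto simp: X_def)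
    then have "card (hits C \<pi>) \<noteq> 0" "card (hits C \<pi>) \<noteq> 1" by (auto simp: coset_sum_eq_card_hits[OF finC])
    then have "\<not> card (hits C \<pi>) \<le> Suc 0" by simp
    moreover have "finite (hits C \<pi>)" using finC by (simp add: hits_def)
    ultimately obtain p q where pq: "p \<in> hits C \<pi>" "q \<in> hits C \<pi>" "p \<noteq> q"
      using card_le_Suc0_iff_eq by blast
    then have "\<pi> \<in> perm_coset n p \<inter> perm_coset n q" using \<pi>' by (simp add: perm_coset_def hits_def)
    then have "{p, q} \<in> nondisjoint_pairs n C" using pq unfolding nondisjoint_pairs_def hits_def by blast
    moreover have "\<pi> \<in> extensions n {p, q}" using pq \<pi>' by (simp add: extensions_def hits_def)
    ultimately show ?thesis by blast
  qed
  show ?thesis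
  proof (cases "nondisjoint_pairs n C = {}")
    case True
    then have "X = {}" using two by auto
    then show ?thesis using A unfolding perm_prob_fact X_def by (simp only: card.empty) simp
  next
    case False
    then obtain s where s: "s \<in> nondisjoint_pairs n C" by auto
    \<comment> \<open>A non-disjoint pair occupies two rows; this excludes \<open>n = 1\<close>,
      where the factor 2 would not compensate for \<open>n - 1\<close>.\<close>
    have n: "n \<ge> 2"
      using partial_perm_card_le[OF nondisjoint_pair_partial_perm(2)[OF C s]] nondisjoint_pair_partial_perm(3)[OF C s] by simp
    have "card X \<le> card (\<Union>s\<in>nondisjoint_pairs n C. extensions n s)"
      using two finite_nondisjoint_pairs[OF finC] by (intro card_mono) auto
    also have "\<dots> \<le> (\<Sum>s\<in>nondisjoint_pairs n C. card (extensions n s))"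
      by (rule card_UN_le[OF finite_nondisjoint_pairs[OF finC]])
    also have "\<dots> = (\<Sum>s\<in>nondisjoint_pairs n C. fact (n - 2))"
    proof (rule sum.cong[OF refl])
      fix s assume "s \<in> nondisjoint_pairs n C"
      from nondisjoint_pair_partial_perm[OF C this] show "card (extensions n s) = fact (n - 2)"
        by (simp add: card_extensions)
    qed
    finally have "real (card X) \<le> real (card (nondisjoint_pairs n C) * fact (n - 2))" by (simp only: of_nat_le_iff) simp
    also have "\<dots> = real (card (nondisjoint_pairs n C)) * fact (n - 2)" by simp
    also have "\<dots> \<le> (A * \<epsilon> * (real n)\<^sup>2) * fact (n - 2)" using pairs by (rule mult_right_mono) simp
    also have "\<dots> \<le> (A * \<epsilon> * (2 * (real n * (real n - 1)))) * fact (n - 2)"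
    proof -
      have "real n * 2 \<le> real n * real n" using n by (intro mult_left_mono) auto
      moreover have "2 * (real n * (real n - 1)) - (real n)\<^sup>2 = real n * real n - real n * 2"
        by (simp add: power2_eq_square algebra_simps)
      ultimately have "(real n)\<^sup>2 \<le> 2 * (real n * (real n - 1))" by linarith
      then show ?thesis using A by (intro mult_right_mono mult_left_mono) auto
    qed
    also have "\<dots> = 2 * A * \<epsilon> * fact n" by (simp add: fact_eq_two_factors[OF n])
    finally show ?thesis unfolding perm_prob_fact X_def[symmetric] by (simp add: pos_divide_le_eq)
  qed
qed

theorem theorem1p3:
  shows "(\<exists>K::real. K > 0 \<and>
           (\<forall>(n::nat) (\<epsilon>::real) (f :: (nat \<Rightarrow> nat) \<Rightarrow> real).
              n \<ge> 1 \<longrightarrow> \<epsilon> \<ge> 0 \<longrightarrow> linear_on_perms n f \<longrightarrow>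
              perm_prob n (\<lambda>\<pi>. f \<pi> \<notin> {0, 1}) \<le> \<epsilon> \<longrightarrow>
              perm_prob n (\<lambda>\<pi>. f \<pi> = 1) \<le> 1 / 2 \<longrightarrow>
              (\<exists>C \<subseteq> {1..n} \<times> {1..n}.
                 real (card C) \<le> K * real n \<and>
                 real (card (nondisjoint_pairs n C)) \<le> K * \<epsilon> * (real n)\<^sup>2 \<and>
                 perm_prob n (\<lambda>\<pi>. f \<pi> \<noteq> coset_sum C \<pi>) \<le> K * \<epsilon>)))
       \<and>
         (\<forall>A::real. A > 0 \<longrightarrow>
           (\<exists>B::real. B > 0 \<and>
             (\<forall>(n::nat) (\<epsilon>::real) (C :: (nat \<times> nat) set).
                n \<ge> 1 \<longrightarrow> \<epsilon> \<ge> 0 \<longrightarrow> C \<subseteq> {1..n} \<times> {1..n} \<longrightarrow>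
                real (card C) \<le> A * real n \<longrightarrow>
                real (card (nondisjoint_pairs n C)) \<le> A * \<epsilon> * (real n)\<^sup>2 \<longrightarrow>
                perm_prob n (\<lambda>\<pi>. coset_sum C \<pi> \<notin> {0, 1}) \<le> B * \<epsilon>)))"
proof (rule conjI[OF nearly_boolean_linear_structure], intro allI impI)
  fix A :: real assume A: "A > 0"
  show "\<exists>B::real. B > 0 \<and>
             (\<forall>(n::nat) (\<epsilon>::real) (C :: (nat \<times> nat) set).
                n \<ge> 1 \<longrightarrow> \<epsilon> \<ge> 0 \<longrightarrow> C \<subseteq> {1..n} \<times> {1..n} \<longrightarrow>
                real (card C) \<le> A * real n \<longrightarrow>
                real (card (nondisjoint_pairs n C)) \<le> A * \<epsilon> * (real n)\<^sup>2 \<longrightarrow>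
                perm_prob n (\<lambda>\<pi>. coset_sum C \<pi> \<notin> {0, 1}) \<le> B * \<epsilon>)"
    using A few_nondisjoint_pairs_imp_nearly_boolean[OF _ _ A]
    by (intro exI[of _ "2 * A"] conjI allI impI) auto
qed

end
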